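(* Let $\gamma_\delta\in L^1(-1,1)$ be such that $\sqrt{1-t^2}\,\gamma_\delta'\in L^1(-1,1)$, and define, for $\ell\ge0$, $$\Lambda_\ell^\delta=\lambda_\ell\{\gamma_\delta\},\qquad \Theta_\ell^\delta=\lambda_\ell\{(1-t)\gamma_\delta'\}.$$ Then, for all $\ell\ge0$ and $-\ell\le m\le\ell$, the weighted nonlocal surface divergence and scalar surface curl satisfy $$\mathcal D_S^\delta\{\nabla_SY_{\ell,m}\}=-\Lambda_\ell^\delta\,\ell(\ell+1)Y_{\ell,m},\quad \mathcal D_S^\delta\{\boldsymbol x\times\nabla_SY_{\ell,m}\}=0,\quad \mathcal D_S^\delta\{Y_{\ell,m}\boldsymbol x\}=0,$$ $$\mathcal C_S^\delta\{\nabla_SY_{\ell,m}\}=0,\quad \mathcal C_S^\delta\{\boldsymbol x\times\nabla_SY_{\ell,m}\}=\Lambda_\ell^\delta\,\ell(\ell+1)Y_{\ell,m},\quad \mathcal C_S^\delta\{Y_{\ell,m}\boldsymbol x\}=0.$$ The weighted nonlocal surface gradient and vector surface curl satisfy $$\boldsymbol{\mathcal G}_S^\delta\{Y_{\ell,m}\}=\Lambda_\ell^\delta\nabla_SY_{\ell,m},\qquad \boldsymbol{\mathcal C}_S^\delta\{Y_{\ell,m}\}=\Lambda_\ell^\delta\,\boldsymbol x\times\nabla_SY_{\ell,m}.$$ Finally, the weighted nonlocal curl and its adjoint satisfy $$\boldsymbol{\mathcal C}^\delta\{\nabla_SY_{\ell,m}\}=[\Theta_0^\delta+\Theta_\ell^\delta-\Lambda_\ell^\delta]\,\boldsymbol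 x\times\nabla_SY_{\ell,m},$$ $$\boldsymbol{\mathcal C}^\delta\{\boldsymbol x\times\nabla_SY_{\ell,m}\}=-\ell(\ell+1)\Lambda_\ell^\delta Y_{\ell,m}\boldsymbol x+[-\Theta_0^\delta+\Theta_\ell^\delta-\Lambda_\ell^\delta]\nabla_SY_{\ell,m},$$ $$\boldsymbol{\mathcal C}^\delta\{Y_{\ell,m}\boldsymbol x\}=-\Lambda_\ell^\delta\,\boldsymbol x\times\nabla_SY_{\ell,m},$$ $$(\boldsymbol{\mathcal C}^\delta)^*\{\nabla_SY_{\ell,m}\}=[-\Theta_0^\delta+\Theta_\ell^\delta-\Lambda_\ell^\delta]\,\boldsymbol x\times\nabla_SY_{\ell,m},$$ $$(\boldsymbol{\mathcal C}^\delta)^*\{\boldsymbol x\times\nabla_SY_{\ell,m}\}=-\ell(\ell+1)\Lambda_\ell^\delta Y_{\ell,m}\boldsymbol x+[\Theta_0^\delta+\Theta_\ell^\delta-\Lambda_\ell^\delta]\nabla_SY_{\ell,m},$$ $$(\boldsymbol{\mathcal C}^\delta)^*\{Y_{\ell,m}\boldsymbol x\}=-\Lambda_\ell^\delta\,\boldsymbol x\times\nabla_SY_{\ell,m}.$$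
   Context: $\mathbb S^2\subset\mathbb R^3$ is the unit sphere with standard measure $\mathrm d\Omega$; a point $\boldsymbol x\in\mathbb S^2$ is identified with the unit normal at $\boldsymbol x$; $|\boldsymbol x-\boldsymbol y|=\sqrt{2(1-\boldsymbol x\cdot\boldsymbol y)}$. $\nabla_S$ and $\Delta_S$ are the surface gradient and the Laplace–Beltrami operator. $Y_{\ell,m}$ ($\ell\ge0$, $-\ell\le m\le\ell$) are the $L^2(\mathbb S^2)$-orthonormal spherical harmonics, $\Delta_SY_{\ell,m}=-\ell(\ell+1)Y_{\ell,m}$. In $Y_{\ell,m}\boldsymbol x$ and $\boldsymbol x\times\nabla_SY_{\ell,m}$, $\boldsymbol x$ denotes the field $\boldsymbol x\mapsto\boldsymbol x$. $P_\ell$ is the Legendre polynomial of degree $\ell$ and, for $f\in L^1(-1,1)$, $\lambda_\ell\{f\}=2\pi\int_{-1}^1P_\ell(t)f(t)\,\mathrm dt$. A prime denotes the derivative with respect to $t=\boldsymbol x\cdot\boldsymbol y$. Kernels. Let $\gamma$ be a differentiable scalar kernel, $0<\delta\le2$ the horizon, $\omega_\delta(\boldsymbol x,\boldsymbol y)=\chi_{[0,\delta]}(|\boldsymbol x-\boldsymbol y|)$ with $\chi_{[0,\delta]}$ the indicator function of $[0,\delta]$, and $$\boldsymbol\alpha(\boldsymbol x,\boldsymbol y)=\gamma'(\boldsymbol x\cdot\boldsymbol y)[\boldsymbol y-(\boldsymbol x\cdot\boldsymbol y)\boldsymbol x],\qquad \boldsymbol\beta(\boldsymbol x,\boldsymbol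 y)=\gamma'(\boldsymbol x\cdot\boldsymbol y)(\boldsymbol y-\boldsymbol x).$$ One sets $\gamma_\delta(\boldsymbol x\cdot\boldsymbol y)=\gamma(\boldsymbol x\cdot\boldsymbol y)\,\omega_\delta(\boldsymbol x,\boldsymbol y)$, $\boldsymbol\alpha_\delta(\boldsymbol x,\boldsymbol y)=\gamma_\delta'(\boldsymbol x\cdot\boldsymbol y)[\boldsymbol y-(\boldsymbol x\cdot\boldsymbol y)\boldsymbol x]$ and $\boldsymbol\beta_\delta(\boldsymbol x,\boldsymbol y)=\gamma_\delta'(\boldsymbol x\cdot\boldsymbol y)(\boldsymbol y-\boldsymbol x)$, and uses these for the weighted kernels $\boldsymbol\alpha\,\omega_\delta$ and $\boldsymbol\beta\,\omega_\delta$ in the operators below. Weighted nonlocal operators. For a smooth scalar field $u$ and a smooth $3$-component vector field $\boldsymbol V$ on $\mathbb S^2$ (the same formulas being applied to the complex-valued harmonics), $$\mathcal D_S^\delta\{\boldsymbol V\}(\boldsymbol x)=\int_{\mathbb S^2}[\boldsymbol V(\boldsymbol x)\cdot\boldsymbol\alpha(\boldsymbol x,\boldsymbol y)-\boldsymbol V(\boldsymbol y)\cdot\boldsymbol\alpha(\boldsymbol y,\boldsymbol x)]\,\omega_\delta(\boldsymbol x,\boldsymbol y)\,\mathrm d\Omega(\boldsymbol y),$$ $$\mathcal C_S^\delta\{\boldsymbol V\}(\boldsymbol x)=\int_{\mathbb S^2}\{\boldsymbol V(\boldsymbol y)\cdot[\boldsymbol y\times\boldsymbol\alpha(\boldsymbol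 y,\boldsymbol x)]-\boldsymbol V(\boldsymbol x)\cdot[\boldsymbol x\times\boldsymbol\alpha(\boldsymbol x,\boldsymbol y)]\}\,\omega_\delta(\boldsymbol x,\boldsymbol y)\,\mathrm d\Omega(\boldsymbol y),$$ $$\boldsymbol{\mathcal G}_S^\delta\{u\}(\boldsymbol x)=\int_{\mathbb S^2}[u(\boldsymbol y)-u(\boldsymbol x)]\,\boldsymbol\alpha(\boldsymbol x,\boldsymbol y)\,\omega_\delta(\boldsymbol x,\boldsymbol y)\,\mathrm d\Omega(\boldsymbol y),$$ $$\boldsymbol{\mathcal C}_S^\delta\{u\}(\boldsymbol x)=\int_{\mathbb S^2}[u(\boldsymbol y)-u(\boldsymbol x)]\,\boldsymbol x\times\boldsymbol\alpha(\boldsymbol x,\boldsymbol y)\,\omega_\delta(\boldsymbol x,\boldsymbol y)\,\mathrm d\Omega(\boldsymbol y),$$ $$\boldsymbol{\mathcal C}^\delta\{\boldsymbol V\}(\boldsymbol x)=\int_{\mathbb S^2}\boldsymbol\beta(\boldsymbol x,\boldsymbol y)\times[\boldsymbol V(\boldsymbol y)-\boldsymbol V(\boldsymbol x)]\,\omega_\delta(\boldsymbol x,\boldsymbol y)\,\mathrm d\Omega(\boldsymbol y),$$ $$(\boldsymbol{\mathcal C}^\delta)^*\{\boldsymbol V\}(\boldsymbol x)=\int_{\mathbb S^2}\boldsymbol\beta(\boldsymbol x,\boldsymbol y)\times[\boldsymbol V(\boldsymbol x)+\boldsymbol V(\boldsymbol y)]\,\omega_\delta(\boldsymbol x,\boldsymbol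 y)\,\mathrm d\Omega(\boldsymbol y).$$
   Formalization: γ_δ' is the weak derivative (no jump of γ_δ at the horizon; else false, e.g. γ=1, δ<2), and for δ=2 the four identities with Θ assume (1−t)γ_δ' ∈ L¹(−1,1), since Θ is otherwise undefined (e.g. γ=(1+t)^(−1/4)). *)

theory Defs
  imports "HOL-Analysis.Analysis"
begin

section \<open>The unit sphere\<close>

abbreviation S2 :: "(real^3) set" where
  "S2 \<equiv> sphere 0 1"

definition spherical_coords :: "real \<times> real \<Rightarrow> real^3" where
  "spherical_coords = (\<lambda>(\<theta>, \<phi>). vector [sin \<theta> * cos \<phi>, sin \<theta> * sin \<phi>, cos \<theta>])"

text \<open>The standard surface measure \<open>d\<Omega> = sin \<theta> d\<theta> d\<phi>\<close>. Its space is the sphere itself and not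
  \<open>\<real>\<^sup>3\<close>, so the values of an integrand off the sphere are irrelevant, also for measurability.\<close>

definition \<Omega> :: "(real^3) measure" where
  "\<Omega> = distr
     (density lborel (\<lambda>(\<theta>, \<phi>). indicator ({0..pi} \<times> {0..<2*pi}) (\<theta>, \<phi>) * ennreal (sin \<theta>)))
     (restrict_space borel S2) spherical_coords"

section \<open>Complex vector fields\<close>

definition cvec :: "real^3 \<Rightarrow> complex^3" where
  "cvec a = (\<chi> i. complex_of_real (a $ i))"

text \<open>The dot product of the (real) formulas, extended bilinearly: there is no conjugation.\<close>

definition cdot :: "complex^3 \<Rightarrow> complex^3 \<Rightarrow> complex" (infixl \<open>\<bullet>\<^sub>c\<close> 70) where
  "a \<bullet>\<^sub>c b = (\<Sum>i\<in>UNIV. a $ i * b $ i)"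

definition ccross :: "complex^3 \<Rightarrow> complex^3 \<Rightarrow> complex^3" (infixr \<open>\<times>\<^sub>c\<close> 80) where
  "a \<times>\<^sub>c b = vector [a$2 * b$3 - a$3 * b$2,
                    a$3 * b$1 - a$1 * b$3,
                    a$1 * b$2 - a$2 * b$1]"

definition partial_deriv :: "3 \<Rightarrow> (real^3 \<Rightarrow> complex) \<Rightarrow> real^3 \<Rightarrow> complex" where
  "partial_deriv i F x = vector_derivative (\<lambda>h. F (x + h *\<^sub>R axis i 1)) (at 0)"

text \<open>The surface gradient of a function on the sphere is the Euclidean gradient, at points of the
  sphere, of its extension \<open>z \<mapsto> u (z / |z|)\<close> that is constant along rays.\<close>

definition surf_grad :: "(real^3 \<Rightarrow> complex) \<Rightarrow> real^3 \<Rightarrow> complex^3" where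
  "surf_grad u x = (\<chi> i. partial_deriv i (\<lambda>z. u (sgn z)) x)"

section \<open>Spherical harmonics and Legendre polynomials\<close>

definition homogeneous_poly :: "nat \<Rightarrow> (real^3 \<Rightarrow> complex) \<Rightarrow> bool" where
  "homogeneous_poly l P \<longleftrightarrow>
     (\<exists>c. \<forall>x. P x = (\<Sum>i\<le>l. \<Sum>j\<le>l - i.
        c i j * complex_of_real ((x$1)^i * (x$2)^j * (x$3)^(l - i - j))))"

definition harmonic :: "(real^3 \<Rightarrow> complex) \<Rightarrow> bool" where
  "harmonic P \<longleftrightarrow> (\<forall>x. (\<Sum>i\<in>UNIV. partial_deriv i (partial_deriv i P) x) = 0)"

definition spherical_harmonic :: "nat \<Rightarrow> (real^3 \<Rightarrow> complex) \<Rightarrow> bool" where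
  "spherical_harmonic l u \<longleftrightarrow>
     (\<exists>P. homogeneous_poly l P \<and> harmonic P \<and> (\<forall>x\<in>S2. u x = P x))"

text \<open>No phase convention is fixed: \<open>Y\<close> is any \<open>L\<^sup>2\<close>-orthonormal system
  \<open>Y\<^bsub>l,m\<^esub>\<close>, \<open>-l \<le> m \<le> l\<close>, of spherical harmonics of degree \<open>l\<close>.\<close>

definition orthonormal_harmonics :: "(nat \<Rightarrow> int \<Rightarrow> real^3 \<Rightarrow> complex) \<Rightarrow> bool" where
  "orthonormal_harmonics Y \<longleftrightarrow>
     (\<forall>l. \<forall>m\<in>{- int l..int l}. spherical_harmonic l (Y l m)) \<and>
     (\<forall>l l'. \<forall>m\<in>{- int l..int l}. \<forall>m'\<in>{- int l'..int l'}.
        (LINT x|\<Omega>. Y l m x * cnj (Y l' m' x)) = (if l = l' \<and> m = m' then 1 else 0))"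

text \<open>Rodrigues' formula \<open>P\<^sub>l = (1 / (2\<^sup>l l!)) (d/dt)\<^sup>l (t\<^sup>2 - 1)\<^sup>l\<close>.\<close>

definition legendre :: "nat \<Rightarrow> real poly" where
  "legendre l = smult (1 / (2 ^ l * fact l)) ((pderiv ^^ l) ([:-1, 0, 1:] ^ l))"

definition legendre_coeff :: "nat \<Rightarrow> (real \<Rightarrow> real) \<Rightarrow> real" where
  "legendre_coeff l f = 2 * pi * (LBINT t:{-1<..<1}. poly (legendre l) t * f t)"

section \<open>Kernels\<close>

text \<open>\<open>g\<close> is the weak (distributional) derivative of \<open>f\<close> on the open set \<open>I\<close>. The test functions are
  the compactly supported \<open>C\<^sup>1\<close> functions; for locally integrable \<open>f\<close> and \<open>g\<close> this is the same as
  testing with smooth ones, by mollification.\<close>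

definition weak_derivative_on :: "real set \<Rightarrow> (real \<Rightarrow> real) \<Rightarrow> (real \<Rightarrow> real) \<Rightarrow> bool" where
  "weak_derivative_on I f g \<longleftrightarrow>
     (\<forall>K. compact K \<and> K \<subseteq> I \<longrightarrow> set_integrable lborel K f \<and> set_integrable lborel K g) \<and>
     (\<forall>\<phi> \<phi>'. (\<forall>t. (\<phi> has_real_derivative \<phi>' t) (at t)) \<and> continuous_on UNIV \<phi>' \<and>
        (\<exists>K. compact K \<and> K \<subseteq> I \<and> (\<forall>t. t \<notin> K \<longrightarrow> \<phi> t = 0)) \<longrightarrow>
        (LBINT t:I. f t * \<phi>' t) = - (LBINT t:I. g t * \<phi> t))"

definition horizon :: "real \<Rightarrow> real^3 \<Rightarrow> real^3 \<Rightarrow> real" where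
  "horizon \<delta> x y = indicator {0..\<delta>} (norm (x - y))"

text \<open>The truncated kernel \<open>\<gamma>\<^sub>\<delta>\<close> as a function of \<open>t = x \<bullet> y\<close>, where \<open>|x - y| = sqrt (2 (1 - t))\<close>.\<close>

definition truncated :: "(real \<Rightarrow> real) \<Rightarrow> real \<Rightarrow> real \<Rightarrow> real" where
  "truncated \<gamma> \<delta> t = \<gamma> t * indicator {0..\<delta>} (sqrt (2 * (1 - t)))"

text \<open>On the sphere \<open>\<alpha> \<gamma> x y * horizon \<delta> x y\<close> and \<open>\<alpha> (truncated \<gamma> \<delta>) x y\<close> agree except possibly
  for \<open>y\<close> in the null set \<open>|x - y| = \<delta>\<close> or \<open>y = x\<close> or \<open>y = -x\<close>; likewise for \<open>\<beta>\<close>.\<close>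

definition \<alpha> :: "(real \<Rightarrow> real) \<Rightarrow> real^3 \<Rightarrow> real^3 \<Rightarrow> real^3" where
  "\<alpha> \<gamma> x y = deriv \<gamma> (x \<bullet> y) *\<^sub>R (y - (x \<bullet> y) *\<^sub>R x)"

definition \<beta> :: "(real \<Rightarrow> real) \<Rightarrow> real^3 \<Rightarrow> real^3 \<Rightarrow> real^3" where
  "\<beta> \<gamma> x y = deriv \<gamma> (x \<bullet> y) *\<^sub>R (y - x)"

definition \<Lambda> :: "(real \<Rightarrow> real) \<Rightarrow> real \<Rightarrow> nat \<Rightarrow> complex" where
  "\<Lambda> \<gamma> \<delta> l = complex_of_real (legendre_coeff l (truncated \<gamma> \<delta>))"

text \<open>\<open>\<Theta>\<close> needs \<open>(1 - t) \<gamma>\<^sub>\<delta>'\<close> to be integrable. For \<open>\<delta> < 2\<close> this follows from integrability of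
  \<open>sqrt (1 - t\<^sup>2) \<gamma>\<^sub>\<delta>'\<close>, since \<open>\<gamma>\<^sub>\<delta>\<close> vanishes near \<open>t = -1\<close>; for \<open>\<delta> = 2\<close> it does not
  (e.g. \<open>\<gamma> t = (1 + t) powr (-1/4)\<close>).\<close>

definition \<Theta> :: "(real \<Rightarrow> real) \<Rightarrow> real \<Rightarrow> nat \<Rightarrow> complex" where
  "\<Theta> \<gamma> \<delta> l = complex_of_real (legendre_coeff l (\<lambda>t. (1 - t) * deriv (truncated \<gamma> \<delta>) t))"

section \<open>Weighted nonlocal operators\<close>

definition nl_surf_div ::
    "(real \<Rightarrow> real) \<Rightarrow> real \<Rightarrow> (real^3 \<Rightarrow> complex^3) \<Rightarrow> real^3 \<Rightarrow> complex" where
  "nl_surf_div \<gamma> \<delta> V x =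
     (LINT y|\<Omega>. horizon \<delta> x y *\<^sub>R (V x \<bullet>\<^sub>c cvec (\<alpha> \<gamma> x y) - V y \<bullet>\<^sub>c cvec (\<alpha> \<gamma> y x)))"

definition nl_scalar_surf_curl ::
    "(real \<Rightarrow> real) \<Rightarrow> real \<Rightarrow> (real^3 \<Rightarrow> complex^3) \<Rightarrow> real^3 \<Rightarrow> complex" where
  "nl_scalar_surf_curl \<gamma> \<delta> V x =
     (LINT y|\<Omega>. horizon \<delta> x y *\<^sub>R
        (V y \<bullet>\<^sub>c cvec (cross3 y (\<alpha> \<gamma> y x)) - V x \<bullet>\<^sub>c cvec (cross3 x (\<alpha> \<gamma> x y))))"

definition nl_surf_grad ::
    "(real \<Rightarrow> real) \<Rightarrow> real \<Rightarrow> (real^3 \<Rightarrow> complex) \<Rightarrow> real^3 \<Rightarrow> complex^3" where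
  "nl_surf_grad \<gamma> \<delta> u x =
     (LINT y|\<Omega>. horizon \<delta> x y *\<^sub>R ((u y - u x) *s cvec (\<alpha> \<gamma> x y)))"

definition nl_vector_surf_curl ::
    "(real \<Rightarrow> real) \<Rightarrow> real \<Rightarrow> (real^3 \<Rightarrow> complex) \<Rightarrow> real^3 \<Rightarrow> complex^3" where
  "nl_vector_surf_curl \<gamma> \<delta> u x =
     (LINT y|\<Omega>. horizon \<delta> x y *\<^sub>R ((u y - u x) *s cvec (cross3 x (\<alpha> \<gamma> x y))))"

definition nl_curl ::
    "(real \<Rightarrow> real) \<Rightarrow> real \<Rightarrow> (real^3 \<Rightarrow> complex^3) \<Rightarrow> real^3 \<Rightarrow> complex^3" where
  "nl_curl \<gamma> \<delta> V x =
     (LINT y|\<Omega>. horizon \<delta> x y *\<^sub>R (cvec (\<beta> \<gamma> x y) \<times>\<^sub>c (V y - V x)))"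

definition nl_curl_adj ::
    "(real \<Rightarrow> real) \<Rightarrow> real \<Rightarrow> (real^3 \<Rightarrow> complex^3) \<Rightarrow> real^3 \<Rightarrow> complex^3" where
  "nl_curl_adj \<gamma> \<delta> V x =
     (LINT y|\<Omega>. horizon \<delta> x y *\<^sub>R (cvec (\<beta> \<gamma> x y) \<times>\<^sub>c (V x + V y)))"

section \<open>Vector fields built from a scalar field\<close>

definition rot_grad :: "(real^3 \<Rightarrow> complex) \<Rightarrow> real^3 \<Rightarrow> complex^3" where
  "rot_grad u x = cvec x \<times>\<^sub>c surf_grad u x"

definition radial :: "(real^3 \<Rightarrow> complex) \<Rightarrow> real^3 \<Rightarrow> complex^3" where
  "radial u x = u x *s cvec x"

end

theory Submission
  imports Defs
begin

text \<open>Everything reduces to integrals over the circles \<open>x \<bullet> y = cos \<theta>\<close>. By rotation invariance of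
  \<open>\<Omega>\<close> a kernel \<open>k (x \<bullet> y)\<close> integrates against \<open>h\<close> as \<open>\<integral> k (t) M (t) dt\<close>, where \<open>M\<close> is the integral
  of \<open>h\<close> over a circle. If \<open>h\<close> is a harmonic \<open>u\<close> of degree \<open>l\<close>, then \<open>M\<close> solves Legendre's equation
  and so is \<open>2 \<pi> P\<^sub>l u (x)\<close>. The components of \<open>x \<times> \<nabla>\<^sub>S u\<close> are again harmonics of degree \<open>l\<close>, and
  integration by parts along the circle reduces \<open>u (y) y\<close> and \<open>\<nabla>\<^sub>S u\<close> to these cases. What remains are
  integrals of \<open>\<gamma>'\<close> against \<open>(1 - t\<^sup>2) P\<^sub>l' (t)\<close>, which become multiples of \<open>\<Lambda>\<close> by the weak form of
  Legendre's equation, and against \<open>(1 - t) P\<^sub>l (t)\<close>, which give \<open>\<Theta>\<close>.\<close>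

section \<open>Legendre polynomials\<close>

text \<open>Legendre's equation is singular at both poles, and initial data exist only at the pole
  x, where the circle collapses: the mean starts at 2 pi u(x) with slope 0. Uniqueness therefore has
  to start from a singular point, and comes from an energy estimate. Means are taken of a polynomial
  extension of u to R^3, so that differentiation under the integral sign only concerns polynomials.
  The kernel is controlled only with the weight sqrt (1 - t^2), which is the length of y - (x
  \<bullet> y) x and of x \<times> y. Integrands with such a factor vanish at both x and -x. Radial
  fields belong here too, since for them the chord y - x collapses to a multiple of x \<times> y. In
  the other four curl identities the chord does not vanish at -x, so (1 - t) times the derivative of
  the truncated kernel must be integrable. For \<delta> < 2 the truncated kernel vanishes near -x
  and this is automatic; for \<delta> = 2 it is the premise of the last block of the theorem. In
  degree l = 0 one cannot divide by l(l+1); there the surface gradient vanishes instead.\<close>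

lemma higher_pderiv_smult: "(pderiv ^^ n) (smult (c::real) p) = smult c ((pderiv ^^ n) p)"
  by (induction n) (auto simp: pderiv_smult)

text \<open>Leibniz's rule stops after two terms, since B'' = 0. It treats the right-hand side 2l B
  A^l in the derivation of Legendre's equation.\<close>

lemma higher_pderiv_mult_linear:
  fixes B r :: "real poly"
  assumes "pderiv B = 1"
  shows "(pderiv ^^ Suc n) (B * r) = B * (pderiv ^^ Suc n) r + of_nat (Suc n) * (pderiv ^^ n) r"
proof (induction n)
  case (Suc n)
  have "(pderiv ^^ Suc (Suc n)) (B * r) = pderiv ((pderiv ^^ Suc n) (B * r))"
    by simp
  also have "\<dots> = B * (pderiv ^^ Suc (Suc n)) r + of_nat (Suc (Suc n)) * (pderiv ^^ Suc n) r"
    unfolding Suc.IH by (simp add: pderiv_add pderiv_mult pderiv_of_nat assms algebra_simps)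
  finally show ?case .
qed (simp add: pderiv_mult assms)

text \<open>Leibniz's rule with three terms, since A''' = 0: the coefficients are n + 1 times A' =
  2B, and n(n+1)/2 times A'' = 2.\<close>

lemma higher_pderiv_mult_quadratic:
  fixes A B r :: "real poly"
  assumes "pderiv A = 2 * B" "pderiv B = 1"
  shows "(pderiv ^^ Suc n) (A * r) = A * (pderiv ^^ Suc n) r
    + of_nat (2 * Suc n) * (B * (pderiv ^^ n) r) + of_nat (Suc n * n) * (pderiv ^^ (n - 1)) r"
proof (induction n)
  case (Suc n)
  \<comment> \<open>For n = 0 the truncated \<open>n - 1\<close> is harmless, because the factor n
    is 0.\<close>
  have *: "of_nat (Suc n * n) * pderiv ((pderiv ^^ (n - 1)) r) = of_nat (Suc n * n) * (pderiv ^^ n) r"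
    by (cases n) auto
  have "(pderiv ^^ Suc (Suc n)) (A * r) = pderiv ((pderiv ^^ Suc n) (A * r))"
    by simp
  also have "\<dots> = A * (pderiv ^^ Suc (Suc n)) r + 2 * B * (pderiv ^^ Suc n) r
     + of_nat (2 * Suc n) * ((pderiv ^^ n) r + B * (pderiv ^^ Suc n) r)
     + of_nat (Suc n * n) * pderiv ((pderiv ^^ (n - 1)) r)"
    unfolding Suc.IH pderiv_add pderiv_mult pderiv_of_nat assms by (simp add: algebra_simps)
  also have "\<dots> = A * (pderiv ^^ Suc (Suc n)) r
    + of_nat (2 * Suc (Suc n)) * (B * (pderiv ^^ Suc n) r)
    + of_nat (Suc (Suc n) * Suc n) * (pderiv ^^ n) r"
    unfolding * by (simp add: algebra_simps)
  finally show ?case by simp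
qed (simp add: pderiv_mult assms algebra_simps)

text \<open>With A = t^2 - 1 and B = t this is the first-order equation A y' = 2l B y of y = A^l,
  the function in Rodrigues' formula. Its derivative of order l + 1 is Legendre's equation.\<close>

lemma mult_pderiv_power:
  fixes A B :: "real poly"
  assumes "pderiv A = 2 * B"
  shows "A * pderiv (A ^ l) = of_nat (2 * l) * (B * A ^ l)"
  using assms by (cases l) (simp_all add: pderiv_power_Suc of_nat_poly numeral_poly algebra_simps del: power_Suc, simp add: algebra_simps)

lemma legendre_ode:
  "(1 - t\<^sup>2) * poly (pderiv (pderiv (legendre l))) t - 2 * t * poly (pderiv (legendre l)) t
     + real (l * (l + 1)) * poly (legendre l) t = 0"
proof -
  define A where "A = [:-1, 0, 1::real:]"
  define B where "B = [:0, 1::real:]"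
  define r where "r = (pderiv ^^ l) (A ^ l)"
  have A: "pderiv A = 2 * B" and B: "pderiv B = 1"
    by (simp_all add: A_def B_def pderiv_pCons numeral_poly one_pCons)
  have r: "(pderiv ^^ Suc l) (pderiv (A ^ l)) = pderiv (pderiv r)"
    "(pderiv ^^ l) (pderiv (A ^ l)) = pderiv r"
    by (simp_all add: r_def flip: funpow_swap1)
  have "(pderiv ^^ (l - 1)) (pderiv (A ^ l)) = r" if "l > 0"
    using that unfolding r_def by (cases l) (simp_all flip: funpow_swap1)
  then have r': "of_nat (Suc l * l) * (pderiv ^^ (l - 1)) (pderiv (A ^ l)) = of_nat (Suc l * l) * r"
    by (cases "l > 0") simp_all
  have "(pderiv ^^ Suc l) (A * pderiv (A ^ l)) = of_nat (2 * l) * (pderiv ^^ Suc l) (B * A ^ l)"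
    unfolding mult_pderiv_power[OF A] of_nat_poly by (simp add: higher_pderiv_smult pderiv_smult)
  then have "A * pderiv (pderiv r) + of_nat (2 * Suc l) * (B * pderiv r) + of_nat (Suc l * l) * r
     = of_nat (2 * l) * (B * pderiv r + of_nat (Suc l) * r)"
    unfolding higher_pderiv_mult_quadratic[OF A B] higher_pderiv_mult_linear[OF B] r r'
    by (simp add: r_def)
  then have "poly (A * pderiv (pderiv r) + of_nat (2 * Suc l) * (B * pderiv r) + of_nat (Suc l * l) * r) t
     = poly (of_nat (2 * l) * (B * pderiv r + of_nat (Suc l) * r)) t"
    by (rule arg_cong)
  then have *: "(1 - t\<^sup>2) * poly (pderiv (pderiv r)) t - 2 * t * poly (pderiv r) t
     + real (l * (l + 1)) * poly r t = 0"
    by (simp add: A_def B_def algebra_simps power2_eq_square poly_of_nat)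
  have "legendre l = smult (1 / (2 ^ l * fact l)) r"
    by (simp add: legendre_def r_def A_def)
  then have "(1 - t\<^sup>2) * poly (pderiv (pderiv (legendre l))) t - 2 * t * poly (pderiv (legendre l)) t
     + real (l * (l + 1)) * poly (legendre l) t = 1 / (2 ^ l * fact l) *
     ((1 - t\<^sup>2) * poly (pderiv (pderiv r)) t - 2 * t * poly (pderiv r) t
     + real (l * (l + 1)) * poly r t)"
    by (simp only: pderiv_smult poly_smult) (simp add: field_simps)
  then show ?thesis using * by simp
qed

text \<open>A^l has a zero of order l at a, so only the terms in which every derivative falls on a
  factor A survive. The induction varies r because each derivative changes the cofactor.\<close>

lemma poly_higher_pderiv_root_power:
  fixes A r :: "real poly"
  assumes "pderiv A = 1" "poly A a = 0"
  shows "poly ((pderiv ^^ l) (A ^ l * r)) a = fact l * poly r a"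
proof (induction l arbitrary: r)
  case (Suc l)
  have "pderiv (A ^ Suc l * r) = A ^ l * (smult (real (Suc l)) r + A * pderiv r)"
    unfolding pderiv_mult pderiv_power_Suc assms by (simp add: algebra_simps)
  then have "(pderiv ^^ Suc l) (A ^ Suc l * r) = (pderiv ^^ l) (A ^ l * (smult (real (Suc l)) r + A * pderiv r))"
    by (simp only: funpow_Suc_right o_def)
  then show ?case
    by (simp only: Suc.IH) (simp add: assms algebra_simps)
qed simp

text \<open>At t = 1 the cofactor (t + 1)^l takes the value 2^l, which together with l! cancels
  Rodrigues' constant. This value fixes the initial datum of the circle mean.\<close>

lemma legendre_at_1: "poly (legendre l) 1 = 1"
proof -
  have "[:-1, 0, 1::real:] ^ l = [:-1, 1:] ^ l * [:1, 1:] ^ l"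
    by (simp flip: power_mult_distrib)
  then show ?thesis
    using poly_higher_pderiv_root_power[of "[:-1, 1:]" 1 l "[:1, 1:] ^ l"]
    by (simp add: legendre_def poly_power pderiv_pCons one_pCons)
qed

text \<open>The energy \<open>D'\<^sup>2 + c D\<^sup>2\<close> decreases on \<open>[0, \<pi>/2]\<close>, and its product with \<open>sin\<^sup>2 \<theta>\<close>
  decreases on \<open>[\<pi>/2, \<pi>]\<close>.\<close>

lemma polar_ode_unique:
  fixes D D' D'' :: "real \<Rightarrow> real"
  assumes D: "\<And>\<theta>. (D has_real_derivative D' \<theta>) (at \<theta>)"
    and D': "\<And>\<theta>. (D' has_real_derivative D'' \<theta>) (at \<theta>)"
    and ode: "\<And>\<theta>. sin \<theta> * D'' \<theta> + cos \<theta> * D' \<theta> + c * sin \<theta> * D \<theta> = 0"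
    and c: "0 \<le> c" and init: "D 0 = 0" "D' 0 = 0" and \<theta>: "0 \<le> \<theta>" "\<theta> < pi"
  shows "D \<theta> = 0"
proof -
  define E where "E = (\<lambda>\<theta>. (D' \<theta>)\<^sup>2 + c * (D \<theta>)\<^sup>2)"
  have E: "(E has_real_derivative 2 * D' \<theta> * D'' \<theta> + 2 * c * D \<theta> * D' \<theta>) (at \<theta>)" for \<theta>
    unfolding E_def by (auto intro!: derivative_eq_intros D D' simp: power2_eq_square)
  have sE: "sin \<theta> * (2 * D' \<theta> * D'' \<theta> + 2 * c * D \<theta> * D' \<theta>) = - 2 * cos \<theta> * (D' \<theta>)\<^sup>2" for \<theta>
  proof -
    have "sin \<theta> * (2 * D' \<theta> * D'' \<theta> + 2 * c * D \<theta> * D' \<theta>)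
        = 2 * D' \<theta> * (sin \<theta> * D'' \<theta> + cos \<theta> * D' \<theta> + c * sin \<theta> * D \<theta>) - 2 * cos \<theta> * (D' \<theta>)\<^sup>2"
      by (simp add: algebra_simps power2_eq_square)
    then show ?thesis using ode by simp
  qed
  have E0: "0 \<le> E \<theta>" for \<theta> using c by (simp add: E_def)
  have 1: "E \<theta> = 0" if "0 \<le> \<theta>" "\<theta> \<le> pi / 2" for \<theta>
  proof -
    have "E \<theta> \<le> E 0"
    \<comment> \<open>The open variant is used because sin vanishes at s = 0, where
      \<open>sE\<close> does not reveal the sign of the derivative of E.\<close>
    proof (rule DERIV_nonpos_imp_decreasing_open[OF that(1)])
      fix s assume s: "0 < s" "s < \<theta>"
      have "0 < sin s" using s that pi_gt_zero by (intro sin_gt_zero) auto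
      moreover have "0 \<le> cos s" using s that by (intro cos_ge_zero) auto
      moreover have "sin s * (2 * D' s * D'' s + 2 * c * D s * D' s) \<le> 0"
        unfolding sE using \<open>0 \<le> cos s\<close> by simp
      ultimately have "2 * D' s * D'' s + 2 * c * D s * D' s \<le> 0"
        by (simp add: mult_le_0_iff)
      then show "\<exists>y. DERIV E s :> y \<and> y \<le> 0" using E by blast
    next
      show "continuous_on {0..\<theta>} E"
        using E by (meson DERIV_isCont continuous_at_imp_continuous_on)
    qed
    then show ?thesis using E0[of \<theta>] init by (simp add: E_def)
  qed
  have 2: "E \<theta> = 0" if "pi / 2 \<le> \<theta>" "\<theta> < pi" for \<theta>
  proof -
    have "E \<theta> * (sin \<theta>)\<^sup>2 \<le> E (pi / 2) * (sin (pi / 2))\<^sup>2"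
    proof (rule DERIV_nonpos_imp_nonincreasing[OF that(1)])
      fix s assume s: "pi / 2 \<le> s" "s \<le> \<theta>"
      have der: "((\<lambda>s. E s * (sin s)\<^sup>2) has_real_derivative
          (2 * D' s * D'' s + 2 * c * D s * D' s) * (sin s)\<^sup>2 + E s * (2 * sin s * cos s)) (at s)"
        by (auto intro!: derivative_eq_intros E)
      have "(2 * D' s * D'' s + 2 * c * D s * D' s) * (sin s)\<^sup>2 =
         sin s * (sin s * (2 * D' s * D'' s + 2 * c * D s * D' s))"
        by (simp add: power2_eq_square)
      also have "\<dots> = - 2 * sin s * cos s * (D' s)\<^sup>2" by (simp only: sE)
      finally have "(2 * D' s * D'' s + 2 * c * D s * D' s) * (sin s)\<^sup>2 + E s * (2 * sin s * cos s)
          = 2 * (sin s * (c * (D s)\<^sup>2)) * cos s" by (simp add: E_def algebra_simps)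
      moreover have "0 \<le> sin s" using s that by (intro sin_ge_zero) (use pi_gt_zero in auto)
      moreover have "cos s \<le> 0"
        using s that cos_monotone_0_pi_le[of "pi/2" s] pi_gt_zero by auto
      ultimately have "(2 * D' s * D'' s + 2 * c * D s * D' s) * (sin s)\<^sup>2 + E s * (2 * sin s * cos s) \<le> 0"
        using c by (simp add: mult_nonneg_nonpos)
      then show "\<exists>y. ((\<lambda>s. E s * (sin s)\<^sup>2) has_real_derivative y) (at s) \<and> y \<le> 0" using der by blast
    qed
    also have "\<dots> = 0" using 1[of "pi / 2"] by simp
    finally have "E \<theta> * (sin \<theta>)\<^sup>2 \<le> 0" .
    moreover have "0 < sin \<theta>" using that by (intro sin_gt_zero) (use pi_gt_zero in auto)
    ultimately have "E \<theta> \<le> 0" by (simp add: mult_le_0_iff)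
    then show ?thesis using E0[of \<theta>] by simp
  qed
  \<comment> \<open>For c = 0 the energy carries no information on D itself, so D is recovered from
    D' = 0 and the initial value.\<close>
  have D'0: "D' s = 0" if "0 \<le> s" "s < pi" for s
  proof -
    have "E s = 0" using 1[of s] 2[of s] that by linarith
    then show ?thesis using c by (simp add: E_def add_nonneg_eq_0_iff)
  qed
  show ?thesis
  proof (cases "\<theta> = 0")
    case False
    have "D \<theta> = D 0"
    proof (rule DERIV_isconst_end[of 0 \<theta> D])
      show "0 < \<theta>" using False \<theta> by simp
      show "continuous_on {0..\<theta>} D" using D by (meson DERIV_isCont continuous_at_imp_continuous_on)
      show "\<And>x. 0 < x \<Longrightarrow> x < \<theta> \<Longrightarrow> DERIV D x :> 0" using D D'0 \<theta> by (metis less_eq_real_def order_less_trans)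
    qed
    then show ?thesis using init by simp
  qed (use init in simp)
qed

section \<open>Integration by parts against a weak derivative\<close>

text \<open>For w > \<epsilon> the denominator is just w. Written through the maximum it stays
  positive for every real w, which keeps the formula continuous without case distinctions; the
  double zero at w = \<epsilon> makes it C^1.\<close>

definition smooth_ramp :: "real \<Rightarrow> real \<Rightarrow> real" where
  "smooth_ramp \<epsilon> w = (max 0 (w - \<epsilon>))\<^sup>2 / (max 0 (w - \<epsilon>) + \<epsilon>)"

definition smooth_ramp' :: "real \<Rightarrow> real \<Rightarrow> real" where
  "smooth_ramp' \<epsilon> w = max 0 (w - \<epsilon>) * (max 0 (w - \<epsilon>) + 2 * \<epsilon>) / (max 0 (w - \<epsilon>) + \<epsilon>)\<^sup>2"

lemma smooth_ramp_deriv: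
  assumes \<epsilon>: "0 < \<epsilon>"
  shows "(smooth_ramp \<epsilon> has_real_derivative smooth_ramp' \<epsilon> w) (at w)"
proof -
  consider "w < \<epsilon>" | "w = \<epsilon>" | "\<epsilon> < w" by linarith
  then show ?thesis
  proof cases
    case 1
    have "((\<lambda>_. 0) has_real_derivative 0) (at w)" by simp
    then have "(smooth_ramp \<epsilon> has_real_derivative 0) (at w)"
      by (rule has_field_derivative_transform_within_open[of _ _ _ "{..<\<epsilon>}"])
         (use 1 in \<open>auto simp: smooth_ramp_def\<close>)
    then show ?thesis using 1 by (simp add: smooth_ramp'_def)
  next
    case 3
    have "((\<lambda>w. (w - \<epsilon>)\<^sup>2 / w) has_real_derivative (w - \<epsilon>) * (w + \<epsilon>) / w\<^sup>2) (at w)"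
      using 3 \<epsilon> by (auto intro!: derivative_eq_intros simp: field_simps power2_eq_square)
    then have "(smooth_ramp \<epsilon> has_real_derivative (w - \<epsilon>) * (w + \<epsilon>) / w\<^sup>2) (at w)"
      by (rule has_field_derivative_transform_within_open[of _ _ _ "{\<epsilon><..}"])
         (use 3 in \<open>auto simp: smooth_ramp_def\<close>)
    then show ?thesis using 3 by (simp add: smooth_ramp'_def add.commute)
  next
    case 2
    have "((\<lambda>h. (smooth_ramp \<epsilon> (\<epsilon> + h) - smooth_ramp \<epsilon> \<epsilon>) / h) \<longlongrightarrow> 0) (at 0)"
    \<comment> \<open>At the corner the difference quotient is 0 from the left and h / (h +
      \<epsilon>) from the right, hence at most |h| / \<epsilon>.\<close>
    proof (rule Lim_null_comparison[of _ "\<lambda>h. \<bar>h\<bar> / \<epsilon>"])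
      have "norm ((smooth_ramp \<epsilon> (\<epsilon> + h) - smooth_ramp \<epsilon> \<epsilon>) / h) \<le> \<bar>h\<bar> / \<epsilon>" for h
      proof (cases "h > 0")
        case True
        have "\<epsilon> * (h * h) \<le> (h * h) * (h + \<epsilon>)" using True \<epsilon> by (simp add: algebra_simps)
        then have "h\<^sup>2 / (h + \<epsilon>) / h \<le> h / \<epsilon>"
          using True \<epsilon> by (simp add: divide_le_eq le_divide_eq power2_eq_square mult_ac)
        then show ?thesis
          using True \<epsilon> by (simp add: smooth_ramp_def)
      qed (use \<epsilon> in \<open>simp_all add: smooth_ramp_def divide_nonpos_pos\<close>)
      then show "\<forall>\<^sub>F h in at 0. norm ((smooth_ramp \<epsilon> (\<epsilon> + h) - smooth_ramp \<epsilon> \<epsilon>) / h) \<le> \<bar>h\<bar> / \<epsilon>"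
        by simp
      show "((\<lambda>h. \<bar>h\<bar> / \<epsilon>) \<longlongrightarrow> 0) (at 0)" using \<epsilon> by (auto intro!: tendsto_eq_intros)
    qed
    then show ?thesis using 2 by (simp add: DERIV_def smooth_ramp'_def)
  qed
qed

lemma smooth_ramp'_continuous: "0 < \<epsilon> \<Longrightarrow> continuous_on A (smooth_ramp' \<epsilon>)"
  unfolding smooth_ramp'_def by (intro continuous_intros) (auto simp: add_nonneg_eq_0_iff max_def)

text \<open>The bounds do not depend on \<epsilon>, as dominated convergence requires.\<close>

lemma smooth_ramp_bounds:
  assumes "0 < \<epsilon>" "0 \<le> w"
  shows "0 \<le> smooth_ramp \<epsilon> w" "smooth_ramp \<epsilon> w \<le> w"
    "0 \<le> smooth_ramp' \<epsilon> w" "smooth_ramp' \<epsilon> w \<le> 1"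
proof -
  define p where "p = max 0 (w - \<epsilon>)"
  have p: "0 \<le> p" "p \<le> w" using assms by (auto simp: p_def)
  have "p\<^sup>2 \<le> p * (p + \<epsilon>)" using p assms by (simp add: power2_eq_square algebra_simps)
  then have "p\<^sup>2 / (p + \<epsilon>) \<le> p" using p assms by (simp add: divide_le_eq)
  then show "smooth_ramp \<epsilon> w \<le> w" using p by (simp add: smooth_ramp_def flip: p_def)
  show "0 \<le> smooth_ramp \<epsilon> w" "0 \<le> smooth_ramp' \<epsilon> w"
    using p assms by (simp_all add: smooth_ramp_def smooth_ramp'_def flip: p_def)
  show "smooth_ramp' \<epsilon> w \<le> 1"
  proof -
    have "p * (p + 2 * \<epsilon>) \<le> (p + \<epsilon>)\<^sup>2" by (simp add: power2_eq_square algebra_simps)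
    moreover have "0 < (p + \<epsilon>)\<^sup>2" using p assms by simp
    ultimately show ?thesis by (simp add: smooth_ramp'_def divide_le_eq_1 flip: p_def)
  qed
qed

lemma smooth_ramp_tendsto:
  assumes "0 < w"
  shows "(\<lambda>n. smooth_ramp (1 / real (Suc n)) w) \<longlonglongrightarrow> w" "(\<lambda>n. smooth_ramp' (1 / real (Suc n)) w) \<longlonglongrightarrow> 1"
proof -
  have e: "(\<lambda>n. 1 / real (Suc n)) \<longlonglongrightarrow> 0" by (rule LIMSEQ_Suc[OF lim_1_over_n])
  have "(\<lambda>n. smooth_ramp (1 / real (Suc n)) w) \<longlonglongrightarrow> (max 0 (w - 0))\<^sup>2 / (max 0 (w - 0) + 0)"
    unfolding smooth_ramp_def using assms by (intro tendsto_intros e) auto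
  then show "(\<lambda>n. smooth_ramp (1 / real (Suc n)) w) \<longlonglongrightarrow> w"
    using assms by (simp add: power2_eq_square)
  have "(\<lambda>n. smooth_ramp' (1 / real (Suc n)) w) \<longlonglongrightarrow>
      max 0 (w - 0) * (max 0 (w - 0) + 2 * 0) / (max 0 (w - 0) + 0)\<^sup>2"
    unfolding smooth_ramp'_def using assms by (intro tendsto_intros e) auto
  then show "(\<lambda>n. smooth_ramp' (1 / real (Suc n)) w) \<longlonglongrightarrow> 1"
    using assms by (simp add: power2_eq_square)
qed

lemma poly_bounded_on_Icc:
  fixes q :: "real poly"
  obtains C where "0 \<le> C" "\<And>t. a \<le> t \<Longrightarrow> t \<le> b \<Longrightarrow> \<bar>poly q t\<bar> \<le> C"
proof -
  have "compact (poly q ` {a..b})" by (intro compact_continuous_image continuous_intros) simp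
  then obtain C where "\<forall>x\<in>poly q ` {a..b}. norm x \<le> C" using compact_imp_bounded bounded_iff by blast
  then show ?thesis using that[of "max C 0"] by (auto simp: le_max_iff_disj)
qed

text \<open>The test function \<open>(1 - t\<^sup>2) q(t)\<close> vanishes on the boundary without having compact support:
  replace \<open>w = 1 - t\<^sup>2\<close> by \<open>(w - \<epsilon>)\<^sup>2 / w\<close> cut off at \<open>w = \<epsilon>\<close>, whose derivative is
  bounded uniformly in \<open>\<epsilon>\<close>.\<close>

lemma weak_derivative_parts:
  fixes f g :: "real \<Rightarrow> real" and q :: "real poly"
  assumes weak: "weak_derivative_on {-1<..<1} f g"
    and f: "set_integrable lborel {-1<..<1} f"
    and g: "set_integrable lborel {-1<..<1} (\<lambda>t. sqrt (1 - t\<^sup>2) * g t)"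
  shows "(LBINT t:{-1<..<1}. g t * ((1 - t\<^sup>2) * poly q t)) =
    - (LBINT t:{-1<..<1}. f t * ((1 - t\<^sup>2) * poly (pderiv q) t - 2 * t * poly q t))"
proof -
  define \<epsilon> where "\<epsilon> n = 1 / real (Suc n)" for n
  have \<epsilon>: "0 < \<epsilon> n" for n by (simp add: \<epsilon>_def)
  define \<phi> where "\<phi> n t = smooth_ramp (\<epsilon> n) (1 - t\<^sup>2) * poly q t" for n t
  define \<phi>' where "\<phi>' n t = smooth_ramp' (\<epsilon> n) (1 - t\<^sup>2) * (- 2 * t) * poly q t
      + smooth_ramp (\<epsilon> n) (1 - t\<^sup>2) * poly (pderiv q) t" for n t
  have eq: "(LBINT t:{-1<..<1}. f t * \<phi>' n t) = - (LBINT t:{-1<..<1}. g t * \<phi> n t)" for n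
  proof -
    have "(\<phi> n has_real_derivative \<phi>' n t) (at t)" for t
    proof -
      have "((\<lambda>t. smooth_ramp (\<epsilon> n) (1 - t\<^sup>2)) has_real_derivative smooth_ramp' (\<epsilon> n) (1 - t\<^sup>2) * (- 2 * t)) (at t)"
        by (rule DERIV_chain2[OF smooth_ramp_deriv[OF \<epsilon>]]) (auto intro!: derivative_eq_intros)
      from DERIV_mult[OF this poly_DERIV[of q t]] show ?thesis
        unfolding \<phi>_def \<phi>'_def by (simp add: algebra_simps)
    qed
    moreover have "continuous_on UNIV (\<phi>' n)"
    proof -
      have "continuous_on UNIV (smooth_ramp (\<epsilon> n))"
        using smooth_ramp_deriv[OF \<epsilon>] by (meson DERIV_isCont continuous_at_imp_continuous_on)
      then have "continuous_on UNIV (\<lambda>t. smooth_ramp (\<epsilon> n) (1 - t\<^sup>2))"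
        by (rule continuous_on_compose2) (auto intro!: continuous_intros)
      moreover have "continuous_on UNIV (\<lambda>t. smooth_ramp' (\<epsilon> n) (1 - t\<^sup>2))"
        by (rule continuous_on_compose2[OF smooth_ramp'_continuous[OF \<epsilon>, of UNIV]]) (auto intro!: continuous_intros)
      ultimately show ?thesis unfolding \<phi>'_def by (intro continuous_intros)
    qed
    moreover have "\<exists>K. compact K \<and> K \<subseteq> {-1<..<1} \<and> (\<forall>t. t \<notin> K \<longrightarrow> \<phi> n t = 0)"
    \<comment> \<open>The constraint 1 - t^2 \<ge> \<epsilon> keeps this compact set away from 1 and
      -1, and outside it the ramp is 0.\<close>
    proof (intro exI[of _ "{-1..1} \<inter> {t. \<epsilon> n \<le> 1 - t\<^sup>2}"] conjI allI impI)
      show "compact ({-1..1} \<inter> {t. \<epsilon> n \<le> 1 - t\<^sup>2})"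
        by (intro compact_Int_closed closed_Collect_le continuous_intros) simp
      show "{-1..1} \<inter> {t. \<epsilon> n \<le> 1 - t\<^sup>2} \<subseteq> {-1<..<1}"
      proof
        fix t assume "t \<in> {-1..1} \<inter> {t. \<epsilon> n \<le> 1 - t\<^sup>2}"
        then have "t \<in> {-1..1}" "t\<^sup>2 < 1" using \<epsilon>[of n] by auto
        then show "t \<in> {-1<..<1}" by (auto simp: abs_square_less_1 abs_less_iff)
      qed
      fix t assume t: "t \<notin> {-1..1} \<inter> {t. \<epsilon> n \<le> 1 - t\<^sup>2}"
      have "1 - t\<^sup>2 < \<epsilon> n"
      proof (cases "t \<in> {-1..1}")
        case False
        then have "1 \<le> \<bar>t\<bar>" by auto
        then have "1 \<le> t\<^sup>2" by (metis one_le_power power2_abs)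
        then show ?thesis using \<epsilon>[of n] by simp
      qed (use t in auto)
      then show "\<phi> n t = 0" by (simp add: \<phi>_def smooth_ramp_def)
    qed
    ultimately show ?thesis using weak unfolding weak_derivative_on_def by blast
  qed
  obtain C where C: "0 \<le> C" "\<And>t. -1 \<le> t \<Longrightarrow> t \<le> 1 \<Longrightarrow> \<bar>poly q t\<bar> \<le> C"
    using poly_bounded_on_Icc[of "-1" 1 q] by blast
  obtain C' where C': "0 \<le> C'" "\<And>t. -1 \<le> t \<Longrightarrow> t \<le> 1 \<Longrightarrow> \<bar>poly (pderiv q) t\<bar> \<le> C'"
    using poly_bounded_on_Icc[of "-1" 1 "pderiv q"] by blast
  have w: "0 < 1 - t\<^sup>2" "1 - t\<^sup>2 \<le> 1" if "t \<in> {-1<..<1}" for t :: real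
    using that by (auto simp: abs_square_less_1 abs_less_iff)
  have I: "{-1<..<1::real} \<in> sets lborel" by simp
  have fm: "set_borel_measurable lborel {-1<..<1} f"
    using f by (simp add: set_borel_measurable_def set_integrable_def)
  \<comment> \<open>Measurability of \<open>g\<close> is recovered from the weighted function by
    dividing by the weight, which is positive on the open interval.\<close>
  have gm: "set_borel_measurable lborel {-1<..<1} g"
  proof -
    have "(\<lambda>t. (indicator {-1<..<1} t *\<^sub>R (sqrt (1 - t\<^sup>2) * g t)) / sqrt (1 - t\<^sup>2)) \<in> borel_measurable lborel"
      using g unfolding set_integrable_def by (intro borel_measurable_divide) auto
    also have "(\<lambda>t. (indicator {-1<..<1} t *\<^sub>R (sqrt (1 - t\<^sup>2) * g t)) / sqrt (1 - t\<^sup>2)) = (\<lambda>t. indicator {-1<..<1} t *\<^sub>R g t)"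
      using w by (force simp: fun_eq_iff indicator_def)
    finally show ?thesis by (simp add: set_borel_measurable_def)
  qed
  have ramp_meas: "(\<lambda>t. smooth_ramp (\<epsilon> n) (1 - t\<^sup>2)) \<in> borel_measurable lborel"
    "(\<lambda>t. smooth_ramp' (\<epsilon> n) (1 - t\<^sup>2)) \<in> borel_measurable lborel" for n
    unfolding smooth_ramp_def smooth_ramp'_def by measurable
  have L: "(\<lambda>n. LBINT t:{-1<..<1}. f t * \<phi>' n t) \<longlonglongrightarrow>
     (LBINT t:{-1<..<1}. f t * ((1 - t\<^sup>2) * poly (pderiv q) t - 2 * t * poly q t))"
    unfolding set_lebesgue_integral_def
  \<comment> \<open>The factor 2C + C' comes from |t| \<le> 1 and from the bound 1 on the ramp and
    on its derivative.\<close>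
  proof (rule integral_dominated_convergence[where w = "\<lambda>t. (2 * C + C') * \<bar>indicator {-1<..<1} t *\<^sub>R f t\<bar>"])
    show "(\<lambda>t. indicator {-1<..<1} t *\<^sub>R (f t * ((1 - t\<^sup>2) * poly (pderiv q) t - 2 * t * poly q t))) \<in> borel_measurable lborel"
    proof -
      have "(\<lambda>t. (indicator {-1<..<1} t *\<^sub>R f t) * ((1 - t\<^sup>2) * poly (pderiv q) t - 2 * t * poly q t)) \<in> borel_measurable lborel"
        using fm unfolding set_borel_measurable_def
        by (intro borel_measurable_times) (auto intro!: borel_measurable_continuous_onI continuous_intros)
      then show ?thesis by (simp add: mult.assoc)
    qed
    show "(\<lambda>t. indicator {-1<..<1} t *\<^sub>R (f t * \<phi>' n t)) \<in> borel_measurable lborel" for n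
    proof -
      have "(\<lambda>t. (indicator {-1<..<1} t *\<^sub>R f t) * \<phi>' n t) \<in> borel_measurable lborel"
        using fm unfolding set_borel_measurable_def \<phi>'_def
        by (intro borel_measurable_times borel_measurable_add ramp_meas)
          (auto intro!: borel_measurable_continuous_onI continuous_intros)
      then show ?thesis by (simp add: mult.assoc)
    qed
    show "integrable lborel (\<lambda>t. (2 * C + C') * \<bar>indicator {-1<..<1} t *\<^sub>R f t\<bar>)"
      using f unfolding set_integrable_def by (intro integrable_mult_right integrable_abs)
    show "AE t in lborel. (\<lambda>n. indicator {-1<..<1} t *\<^sub>R (f t * \<phi>' n t)) \<longlonglongrightarrow>
      indicator {-1<..<1} t *\<^sub>R (f t * ((1 - t\<^sup>2) * poly (pderiv q) t - 2 * t * poly q t))"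
    proof (rule AE_I2)
      fix t :: real
      show "(\<lambda>n. indicator {-1<..<1} t *\<^sub>R (f t * \<phi>' n t)) \<longlonglongrightarrow>
        indicator {-1<..<1} t *\<^sub>R (f t * ((1 - t\<^sup>2) * poly (pderiv q) t - 2 * t * poly q t))"
      proof (cases "t \<in> {-1<..<1}")
        case True
        have "(\<lambda>n. \<phi>' n t) \<longlonglongrightarrow> 1 * (- 2 * t) * poly q t + (1 - t\<^sup>2) * poly (pderiv q) t"
          unfolding \<phi>'_def \<epsilon>_def
          by (intro tendsto_intros smooth_ramp_tendsto w(1)[OF True])
        then have "(\<lambda>n. \<phi>' n t) \<longlonglongrightarrow> (1 - t\<^sup>2) * poly (pderiv q) t - 2 * t * poly q t"
          by simp
        then show ?thesis by (intro tendsto_intros)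
      qed simp
    qed
    show "AE t in lborel. norm (indicator {-1<..<1} t *\<^sub>R (f t * \<phi>' n t)) \<le> (2 * C + C') * \<bar>indicator {-1<..<1} t *\<^sub>R f t\<bar>" for n
    proof (rule AE_I2)
      fix t :: real
      show "norm (indicator {-1<..<1} t *\<^sub>R (f t * \<phi>' n t)) \<le> (2 * C + C') * \<bar>indicator {-1<..<1} t *\<^sub>R f t\<bar>"
      proof (cases "t \<in> {-1<..<1}")
        case True
        note r = smooth_ramp_bounds[OF \<epsilon>[of n] less_imp_le[OF w(1)[OF True]]]
        have "\<bar>\<phi>' n t\<bar> \<le> \<bar>smooth_ramp' (\<epsilon> n) (1 - t\<^sup>2)\<bar> * (2 * \<bar>t\<bar>) * \<bar>poly q t\<bar>
            + \<bar>smooth_ramp (\<epsilon> n) (1 - t\<^sup>2)\<bar> * \<bar>poly (pderiv q) t\<bar>"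
          unfolding \<phi>'_def by (rule order_trans[OF abs_triangle_ineq]) (simp add: abs_mult)
        also have "\<dots> \<le> 1 * (2 * 1) * C + 1 * C'"
        proof -
          have "\<bar>smooth_ramp (\<epsilon> n) (1 - t\<^sup>2)\<bar> \<le> 1" using r w(2)[OF True] by linarith
          then show ?thesis using r C C' True by (intro add_mono mult_mono) auto
        qed
        finally have "\<bar>f t\<bar> * \<bar>\<phi>' n t\<bar> \<le> \<bar>f t\<bar> * (2 * C + C')"
          by (intro mult_left_mono) auto
        then show ?thesis using True by (simp add: abs_mult mult.commute)
      qed simp
    qed
  qed
  have R: "(\<lambda>n. LBINT t:{-1<..<1}. g t * \<phi> n t) \<longlonglongrightarrow> (LBINT t:{-1<..<1}. g t * ((1 - t\<^sup>2) * poly q t))"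
    unfolding set_lebesgue_integral_def
  proof (rule integral_dominated_convergence[where w = "\<lambda>t. C * \<bar>indicator {-1<..<1} t *\<^sub>R (sqrt (1 - t\<^sup>2) * g t)\<bar>"])
    show "(\<lambda>t. indicator {-1<..<1} t *\<^sub>R (g t * ((1 - t\<^sup>2) * poly q t))) \<in> borel_measurable lborel"
    proof -
      have "(\<lambda>t. (indicator {-1<..<1} t *\<^sub>R g t) * ((1 - t\<^sup>2) * poly q t)) \<in> borel_measurable lborel"
        using gm unfolding set_borel_measurable_def
        by (intro borel_measurable_times) (auto intro!: borel_measurable_continuous_onI continuous_intros)
      then show ?thesis by (simp add: mult.assoc)
    qed
    show "(\<lambda>t. indicator {-1<..<1} t *\<^sub>R (g t * \<phi> n t)) \<in> borel_measurable lborel" for n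
    proof -
      have "(\<lambda>t. (indicator {-1<..<1} t *\<^sub>R g t) * \<phi> n t) \<in> borel_measurable lborel"
        using gm unfolding set_borel_measurable_def \<phi>_def
        by (intro borel_measurable_times ramp_meas)
          (auto intro!: borel_measurable_continuous_onI continuous_intros)
      then show ?thesis by (simp add: mult.assoc)
    qed
    show "integrable lborel (\<lambda>t. C * \<bar>indicator {-1<..<1} t *\<^sub>R (sqrt (1 - t\<^sup>2) * g t)\<bar>)"
      using g unfolding set_integrable_def by (intro integrable_mult_right integrable_abs)
    show "AE t in lborel. (\<lambda>n. indicator {-1<..<1} t *\<^sub>R (g t * \<phi> n t)) \<longlonglongrightarrow>
      indicator {-1<..<1} t *\<^sub>R (g t * ((1 - t\<^sup>2) * poly q t))"
    proof (rule AE_I2)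
      fix t :: real
      show "(\<lambda>n. indicator {-1<..<1} t *\<^sub>R (g t * \<phi> n t)) \<longlonglongrightarrow>
        indicator {-1<..<1} t *\<^sub>R (g t * ((1 - t\<^sup>2) * poly q t))"
      proof (cases "t \<in> {-1<..<1}")
        case True
        then show ?thesis
          unfolding \<phi>_def \<epsilon>_def by (intro tendsto_intros smooth_ramp_tendsto w(1))
      qed simp
    qed
    show "AE t in lborel. norm (indicator {-1<..<1} t *\<^sub>R (g t * \<phi> n t)) \<le> C * \<bar>indicator {-1<..<1} t *\<^sub>R (sqrt (1 - t\<^sup>2) * g t)\<bar>" for n
    proof (rule AE_I2)
      fix t :: real
      show "norm (indicator {-1<..<1} t *\<^sub>R (g t * \<phi> n t)) \<le> C * \<bar>indicator {-1<..<1} t *\<^sub>R (sqrt (1 - t\<^sup>2) * g t)\<bar>"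
      proof (cases "t \<in> {-1<..<1}")
        case True
        note r = smooth_ramp_bounds[OF \<epsilon>[of n] less_imp_le[OF w(1)[OF True]]]
        \<comment> \<open>A number in (0, 1] is at most its square root; this is how the weight in
          the hypothesis on \<open>g\<close> dominates the test function.\<close>
        have "1 - t\<^sup>2 \<le> sqrt (1 - t\<^sup>2)"
          using w[OF True] by (intro real_le_rsqrt) (simp add: power2_eq_square mult_left_le)
        then have "\<bar>\<phi> n t\<bar> \<le> sqrt (1 - t\<^sup>2) * C"
          unfolding \<phi>_def abs_mult using r C True w[OF True] by (intro mult_mono) auto
        then have "\<bar>g t\<bar> * \<bar>\<phi> n t\<bar> \<le> \<bar>g t\<bar> * (sqrt (1 - t\<^sup>2) * C)"
          by (intro mult_left_mono) auto
        then show ?thesis using True w[OF True] by (simp add: abs_mult mult_ac)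
      qed simp
    qed
  qed
  have "(\<lambda>n. LBINT t:{-1<..<1}. f t * \<phi>' n t) \<longlonglongrightarrow> - (LBINT t:{-1<..<1}. g t * ((1 - t\<^sup>2) * poly q t))"
    unfolding eq by (intro tendsto_minus R)
  with L show ?thesis using LIMSEQ_unique by force
qed

section \<open>Solid harmonics\<close>

inductive cpoly :: "(real^3 \<Rightarrow> complex) \<Rightarrow> bool" where
  cpoly_const: "cpoly (\<lambda>_. c)"
| cpoly_coord: "cpoly (\<lambda>x. complex_of_real (x $ i))"
| cpoly_add: "cpoly f \<Longrightarrow> cpoly g \<Longrightarrow> cpoly (\<lambda>x. f x + g x)"
| cpoly_mult: "cpoly f \<Longrightarrow> cpoly g \<Longrightarrow> cpoly (\<lambda>x. f x * g x)"

lemma cpoly_diff: "cpoly f \<Longrightarrow> cpoly g \<Longrightarrow> cpoly (\<lambda>x. f x - g x)"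
  using cpoly_add[of f "\<lambda>x. (- 1) * g x"] cpoly_mult[OF cpoly_const[of "- 1"], of g] by simp

lemma cpoly_sum: "(\<And>i. i \<in> I \<Longrightarrow> cpoly (f i)) \<Longrightarrow> cpoly (\<lambda>x. \<Sum>i\<in>I. f i x)"
  by (induction I rule: infinite_finite_induct) (auto intro!: cpoly_const cpoly_add)

lemma cpoly_power: "cpoly f \<Longrightarrow> cpoly (\<lambda>x. f x ^ n)"
  by (induction n) (auto intro!: cpoly_const cpoly_mult)

lemmas cpoly_intros = cpoly_const cpoly_coord cpoly_add cpoly_mult cpoly_diff cpoly_sum cpoly_power

text \<open>\<open>partial_deriv\<close> is the derivative along a line and has a prescribed value
  only once differentiability is known. All computations of it go through a total derivative in
  gradient form.\<close>

lemma partial_deriv_eqI: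
  assumes "(f has_derivative (\<lambda>v. \<Sum>i\<in>UNIV. complex_of_real (v $ i) * G i)) (at x)"
  shows "partial_deriv i f x = G i"
proof -
  have "((\<lambda>h. x + h *\<^sub>R axis i 1) has_derivative (\<lambda>h. h *\<^sub>R axis i 1)) (at (0::real))"
    by (auto intro!: derivative_eq_intros)
  then have "((\<lambda>h. f (x + h *\<^sub>R axis i 1)) has_derivative
      (\<lambda>h. \<Sum>j\<in>UNIV. complex_of_real ((h *\<^sub>R axis i 1) $ j) * G j)) (at 0)"
    by (rule has_derivative_compose) (use assms in simp)
  also have "(\<lambda>h. \<Sum>j\<in>UNIV. complex_of_real ((h *\<^sub>R axis i 1) $ j) * G j) = (\<lambda>h. h *\<^sub>R G i)"
  proof
    fix h :: real
    have "(\<Sum>j\<in>UNIV. complex_of_real ((h *\<^sub>R axis i 1) $ j) * G j) = (\<Sum>j\<in>UNIV. if j = i then h *\<^sub>R G i else 0)"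
      by (intro sum.cong) (auto simp: axis_def scaleR_conv_of_real[of h "G i"])
    then show "(\<Sum>j\<in>UNIV. complex_of_real ((h *\<^sub>R axis i 1) $ j) * G j) = h *\<^sub>R G i" by simp
  qed
  finally show ?thesis
    unfolding partial_deriv_def has_vector_derivative_def[symmetric] by (rule vector_derivative_at)
qed

text \<open>The induction cannot yet speak of \<open>partial_deriv\<close>, so it carries along
  polynomial candidates for the gradient; they are identified with the partial derivatives
  afterwards.\<close>

lemma cpoly_gradient_ex:
  assumes "cpoly f"
  shows "\<exists>G. (\<forall>i. cpoly (G i)) \<and>
    (\<forall>x. (f has_derivative (\<lambda>v. \<Sum>i\<in>UNIV. complex_of_real (v $ i) * G i x)) (at x))"
  using assms
proof induction
  case (cpoly_const c)
  show ?case by (intro exI[of _ "\<lambda>_ _. 0"]) (auto intro: cpoly.cpoly_const)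
next
  case (cpoly_coord i)
  have "(\<Sum>j\<in>UNIV. complex_of_real (v $ j) * (if j = i then 1 else 0)) = complex_of_real (v $ i)" for v :: "real^3"
    by (simp add: if_distrib[of "\<lambda>c. _ * c"] cong: if_cong)
  moreover have "((\<lambda>x. complex_of_real (x $ i)) has_derivative (\<lambda>v. complex_of_real (v $ i))) (at x)" for x :: "real^3"
    by (intro bounded_linear_imp_has_derivative bounded_linear_compose[OF bounded_linear_of_real bounded_linear_vec_nth])
  ultimately show ?case
    by (intro exI[of _ "\<lambda>j _. if j = i then 1 else 0"]) (auto intro: cpoly.cpoly_const)
next
  case (cpoly_add f g)
  then obtain F G where F: "\<And>i. cpoly (F i)" "\<And>x. (f has_derivative (\<lambda>v. \<Sum>i\<in>UNIV. complex_of_real (v $ i) * F i x)) (at x)"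
    and G: "\<And>i. cpoly (G i)" "\<And>x. (g has_derivative (\<lambda>v. \<Sum>i\<in>UNIV. complex_of_real (v $ i) * G i x)) (at x)"
    by blast
  have "((\<lambda>x. f x + g x) has_derivative (\<lambda>v. \<Sum>i\<in>UNIV. complex_of_real (v $ i) * (F i x + G i x))) (at x)" for x
    using has_derivative_add[OF F(2) G(2)] by (simp add: sum.distrib distrib_left)
  then show ?case by (intro exI[of _ "\<lambda>i x. F i x + G i x"]) (auto intro: cpoly.cpoly_add F G)
next
  case (cpoly_mult f g)
  then obtain F G where F: "\<And>i. cpoly (F i)" "\<And>x. (f has_derivative (\<lambda>v. \<Sum>i\<in>UNIV. complex_of_real (v $ i) * F i x)) (at x)"
    and G: "\<And>i. cpoly (G i)" "\<And>x. (g has_derivative (\<lambda>v. \<Sum>i\<in>UNIV. complex_of_real (v $ i) * G i x)) (at x)"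
    by blast
  have "((\<lambda>x. f x * g x) has_derivative (\<lambda>v. \<Sum>i\<in>UNIV. complex_of_real (v $ i) * (f x * G i x + F i x * g x))) (at x)" for x
    using has_derivative_mult[OF F(2) G(2)]
    by (simp add: sum.distrib distrib_left sum_distrib_left sum_distrib_right mult_ac)
  then show ?case
    by (intro exI[of _ "\<lambda>i x. f x * G i x + F i x * g x"])
       (intro conjI allI cpoly.cpoly_add cpoly.cpoly_mult F(1) G(1) cpoly_mult.hyps)
qed

lemma cpoly_gradient:
  assumes "cpoly f"
  shows "cpoly (partial_deriv i f)"
    and "(f has_derivative (\<lambda>v. \<Sum>i\<in>UNIV. complex_of_real (v $ i) * partial_deriv i f x)) (at x)"
proof -
  obtain G where G: "\<And>i. cpoly (G i)"
      "\<And>x. (f has_derivative (\<lambda>v. \<Sum>i\<in>UNIV. complex_of_real (v $ i) * G i x)) (at x)"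
    using cpoly_gradient_ex[OF assms] by blast
  have "partial_deriv i f = G i" for i
    using partial_deriv_eqI[OF G(2)] by (auto simp: fun_eq_iff)
  then show "cpoly (partial_deriv i f)"
      "(f has_derivative (\<lambda>v. \<Sum>i\<in>UNIV. complex_of_real (v $ i) * partial_deriv i f x)) (at x)"
    using G by auto
qed

lemma cpoly_continuous_on: "cpoly f \<Longrightarrow> continuous_on A f"
  by (meson cpoly_gradient(2) has_derivative_continuous continuous_at_imp_continuous_on)

lemma partial_deriv_const: "partial_deriv i (\<lambda>_. c) = (\<lambda>_. 0)"
proof
  show "partial_deriv i (\<lambda>_. c) x = 0" for x
    by (rule partial_deriv_eqI[where G = "\<lambda>_. 0"]) simp
qed

lemma partial_deriv_coord: "partial_deriv i (\<lambda>x. complex_of_real (x $ j)) = (\<lambda>_. if i = j then 1 else 0)"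
proof
  fix x
  have "((\<lambda>x. complex_of_real (x $ j)) has_derivative (\<lambda>v. complex_of_real (v $ j))) (at x)"
    by (intro bounded_linear_imp_has_derivative bounded_linear_compose[OF bounded_linear_of_real bounded_linear_vec_nth])
  then show "partial_deriv i (\<lambda>x. complex_of_real (x $ j)) x = (if i = j then 1 else 0)"
    by (intro partial_deriv_eqI[where G = "\<lambda>i. if i = j then 1 else 0"])
       (simp add: if_distrib[of "\<lambda>c. _ * c"] cong: if_cong)
qed

lemma partial_deriv_add:
  assumes "cpoly f" "cpoly g"
  shows "partial_deriv i (\<lambda>x. f x + g x) = (\<lambda>x. partial_deriv i f x + partial_deriv i g x)"
proof
  show "partial_deriv i (\<lambda>x. f x + g x) x = partial_deriv i f x + partial_deriv i g x" for x
    using has_derivative_add[OF cpoly_gradient(2)[OF assms(1)] cpoly_gradient(2)[OF assms(2)], of x]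
    by (intro partial_deriv_eqI[where G = "\<lambda>i. partial_deriv i f x + partial_deriv i g x"])
       (simp add: sum.distrib distrib_left)
qed

lemma partial_deriv_mult:
  assumes "cpoly f" "cpoly g"
  shows "partial_deriv i (\<lambda>x. f x * g x) = (\<lambda>x. f x * partial_deriv i g x + partial_deriv i f x * g x)"
proof
  show "partial_deriv i (\<lambda>x. f x * g x) x = f x * partial_deriv i g x + partial_deriv i f x * g x" for x
    using has_derivative_mult[OF cpoly_gradient(2)[OF assms(1)] cpoly_gradient(2)[OF assms(2)], of x]
    by (intro partial_deriv_eqI[where G = "\<lambda>i. f x * partial_deriv i g x + partial_deriv i f x * g x"])
       (simp add: sum.distrib distrib_left sum_distrib_left sum_distrib_right mult_ac)
qed

lemma partial_deriv_diff:
  assumes "cpoly f" "cpoly g"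
  shows "partial_deriv i (\<lambda>x. f x - g x) = (\<lambda>x. partial_deriv i f x - partial_deriv i g x)"
proof
  show "partial_deriv i (\<lambda>x. f x - g x) x = partial_deriv i f x - partial_deriv i g x" for x
    using has_derivative_diff[OF cpoly_gradient(2)[OF assms(1)] cpoly_gradient(2)[OF assms(2)], of x]
    by (intro partial_deriv_eqI[where G = "\<lambda>i. partial_deriv i f x - partial_deriv i g x"])
       (simp add: sum_subtractf right_diff_distrib)
qed

text \<open>In the product case two applications of the product rule give a sum that is symmetric in
  i and j by the induction hypotheses.\<close>

lemma partial_deriv_commute:
  assumes "cpoly f"
  shows "partial_deriv i (partial_deriv j f) = partial_deriv j (partial_deriv i f)"
  using assms
proof induction
  case (cpoly_mult f g)
  note c = cpoly_mult.hyps cpoly_gradient(1)[OF cpoly_mult.hyps(1)] cpoly_gradient(1)[OF cpoly_mult.hyps(2)]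
  show ?case
    by (simp add: partial_deriv_mult partial_deriv_add cpoly.cpoly_mult c cpoly_mult.IH, simp add: add_ac)
next
  case (cpoly_add f g)
  note c = cpoly_add.hyps cpoly_gradient(1)[OF cpoly_add.hyps(1)] cpoly_gradient(1)[OF cpoly_add.hyps(2)]
  show ?case by (simp add: partial_deriv_add c cpoly_add.IH)
qed (simp_all add: partial_deriv_const partial_deriv_coord)

text \<open>Homogeneity enters through Euler's identity instead of coefficients: being a
  differential identity, it passes to derivatives and to the angular momentum operators by
  differentiating it.\<close>

definition solid_harmonic :: "nat \<Rightarrow> (real^3 \<Rightarrow> complex) \<Rightarrow> bool" where
  "solid_harmonic l P \<longleftrightarrow> cpoly P \<and> harmonic P \<and>
     (\<forall>x. (\<Sum>i\<in>UNIV. complex_of_real (x $ i) * partial_deriv i P x) = of_nat l * P x)"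

text \<open>Euler's identity results from differentiating P (s x) = s^l P x at s = 1, on the left by
  the chain rule.\<close>

lemma homogeneous_poly_solid:
  assumes "homogeneous_poly l P" "harmonic P"
  shows "solid_harmonic l P"
  unfolding solid_harmonic_def
proof (intro conjI allI)
  obtain c where c: "\<And>x. P x = (\<Sum>i\<le>l. \<Sum>j\<le>l - i. c i j * complex_of_real ((x$1)^i * (x$2)^j * (x$3)^(l - i - j)))"
    using assms(1) unfolding homogeneous_poly_def by blast
  have P: "P = (\<lambda>x. \<Sum>i\<le>l. \<Sum>j\<le>l - i. c i j * (complex_of_real (x$1) ^ i * complex_of_real (x$2) ^ j * complex_of_real (x$3) ^ (l - i - j)))"
    by (simp add: c fun_eq_iff)
  show cp: "cpoly P"
    unfolding P by (intro cpoly_intros)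
  show "harmonic P" by fact
  fix x
  have hom: "P (s *\<^sub>R x) = of_real (s ^ l) * P x" for s
    unfolding P sum_distrib_left
  proof (intro sum.cong refl)
    fix i j assume ij: "i \<in> {..l}" "j \<in> {..l - i}"
    \<comment> \<open>Because i \<le> l and j \<le> l - i, the natural subtraction is exact and the
      three exponents add up to l.\<close>
    then have "s ^ l = s ^ i * s ^ j * s ^ (l - i - j)" by (simp flip: power_add)
    then show "c i j * (complex_of_real ((s *\<^sub>R x) $ 1) ^ i * complex_of_real ((s *\<^sub>R x) $ 2) ^ j * complex_of_real ((s *\<^sub>R x) $ 3) ^ (l - i - j))
      = complex_of_real (s ^ l) * (c i j * (complex_of_real (x$1) ^ i * complex_of_real (x$2) ^ j * complex_of_real (x$3) ^ (l - i - j)))"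
      by (simp add: power_mult_distrib mult_ac)
  qed
  have "((\<lambda>s. s *\<^sub>R x) has_derivative (\<lambda>h. h *\<^sub>R x)) (at (1::real))"
    by (auto intro!: derivative_eq_intros)
  then have "((\<lambda>s. P (s *\<^sub>R x)) has_derivative (\<lambda>h. \<Sum>i\<in>UNIV. complex_of_real ((h *\<^sub>R x) $ i) * partial_deriv i P x)) (at (1::real))"
    by (rule has_derivative_compose) (use cpoly_gradient(2)[OF cp, of x] in simp)
  then have 1: "((\<lambda>s. P (s *\<^sub>R x)) has_vector_derivative (\<Sum>i\<in>UNIV. complex_of_real (x $ i) * partial_deriv i P x)) (at (1::real))"
    by (simp add: has_vector_derivative_def scaleR_conv_of_real[where 'a = complex] sum_distrib_left mult_ac)
  have "((\<lambda>s::real. s ^ l) has_real_derivative real l) (at 1)"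
    by (auto intro!: derivative_eq_intros)
  then have "((\<lambda>s. of_real (s ^ l) * P x) has_vector_derivative of_real (real l) * P x) (at (1::real))"
    by (intro has_vector_derivative_mult_left has_vector_derivative_of_real)
  then have "((\<lambda>s. of_real (s ^ l) * P x) has_vector_derivative of_nat l * P x) (at (1::real))"
    by simp
  then show "(\<Sum>i\<in>UNIV. complex_of_real (x $ i) * partial_deriv i P x) = of_nat l * P x"
    using 1 unfolding hom by (metis vector_derivative_unique_at)
qed

lemma homogeneous_poly_0: "homogeneous_poly 0 P \<Longrightarrow> partial_deriv i P = (\<lambda>_. 0)"
proof -
  assume "homogeneous_poly 0 P"
  then obtain c where "P = (\<lambda>_. c)" by (auto simp: homogeneous_poly_def fun_eq_iff)
  then show ?thesis by (simp add: partial_deriv_const)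
qed

text \<open>Euler's identity is differentiated in direction j; the extra first-order term comes from
  differentiating the factor x_j. The subtraction l - 1 is one of complex numbers, so the factor is
  -1 for l = 0.\<close>

lemma solid_harmonic_euler2:
  assumes "solid_harmonic l P"
  shows "(\<Sum>i\<in>UNIV. complex_of_real (x $ i) * partial_deriv i (partial_deriv j P) x) = (of_nat l - 1) * partial_deriv j P x"
proof -
  have cp: "cpoly P" "\<And>i. cpoly (partial_deriv i P)"
    using assms cpoly_gradient by (auto simp: solid_harmonic_def)
  have "(\<lambda>x. \<Sum>i\<in>UNIV. complex_of_real (x $ i) * partial_deriv i P x) = (\<lambda>x. of_nat l * P x)"
    using assms by (auto simp: solid_harmonic_def)
  then have "partial_deriv j (\<lambda>x. \<Sum>i\<in>UNIV. complex_of_real (x $ i) * partial_deriv i P x) x = partial_deriv j (\<lambda>x. of_nat l * P x) x"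
    by simp
  moreover have "partial_deriv j (\<lambda>x. \<Sum>i\<in>UNIV. complex_of_real (x $ i) * partial_deriv i P x) x
     = (\<Sum>i\<in>UNIV. complex_of_real (x $ i) * partial_deriv j (partial_deriv i P) x) + partial_deriv j P x"
    using exhaust_3[of j]
    by (auto simp: sum_3 partial_deriv_add partial_deriv_mult partial_deriv_coord cpoly_intros cp)
  moreover have "partial_deriv j (\<lambda>x. of_nat l * P x) x = of_nat l * partial_deriv j P x"
    by (simp add: partial_deriv_mult partial_deriv_const cpoly_const cp)
  ultimately show ?thesis
    by (simp add: partial_deriv_commute[OF cp(1), of _ j] algebra_simps)
qed

text \<open>The angular momentum operators \<open>x\<^sub>i \<partial>\<^sub>j - x\<^sub>j \<partial>\<^sub>i\<close> commute with the Laplacian.\<close>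

lemma solid_harmonic_rotation:
  assumes "solid_harmonic l P"
  shows "solid_harmonic l (\<lambda>x. complex_of_real (x $ i) * partial_deriv j P x - complex_of_real (x $ j) * partial_deriv i P x)"
proof -
  have cp: "cpoly P" "\<And>i. cpoly (partial_deriv i P)" "\<And>i j. cpoly (partial_deriv i (partial_deriv j P))"
    using assms cpoly_gradient by (auto simp: solid_harmonic_def)
  let ?D = "partial_deriv"
  define R where "R = (\<lambda>x. complex_of_real (x $ i) * ?D j P x - complex_of_real (x $ j) * ?D i P x)"
  have DR: "?D k R = (\<lambda>x. complex_of_real (x $ i) * ?D k (?D j P) x + (if k = i then 1 else 0) * ?D j P x
     - (complex_of_real (x $ j) * ?D k (?D i P) x + (if k = j then 1 else 0) * ?D i P x))" for k
    unfolding R_def by (simp add: partial_deriv_diff partial_deriv_mult partial_deriv_coord cpoly_intros cp)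
  have "harmonic R"
    unfolding harmonic_def
  proof
    fix x
    have lap: "(\<Sum>k\<in>UNIV. ?D k (?D k (?D m P)) x) = 0" for m
    proof -
      have "(\<lambda>x. \<Sum>k\<in>UNIV. ?D k (?D k P) x) = (\<lambda>x. 0)"
        using assms by (auto simp: solid_harmonic_def harmonic_def)
      then have "?D m (\<lambda>x. \<Sum>k\<in>UNIV. ?D k (?D k P) x) x = 0"
        by (simp add: partial_deriv_const)
      moreover have "?D k (?D k (?D m P)) = ?D m (?D k (?D k P))" for k
        by (simp add: partial_deriv_commute[of _ _ m] cp)
      ultimately show ?thesis
        by (simp add: sum_3 partial_deriv_add cpoly_intros cp)
    qed
    \<comment> \<open>Differentiating the coefficient x_i leaves a cross term 2 \<partial>_k
      \<partial>_j P at k = i, and likewise for x_j; summed over k they form a commutator of partial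
      derivatives.\<close>
    have "?D k (?D k R) x = complex_of_real (x $ i) * ?D k (?D k (?D j P)) x - complex_of_real (x $ j) * ?D k (?D k (?D i P)) x
      + 2 * ((if k = i then 1 else 0) * ?D k (?D j P) x - (if k = j then 1 else 0) * ?D k (?D i P) x)" for k
      unfolding DR
      by (simp add: partial_deriv_diff partial_deriv_add partial_deriv_mult partial_deriv_coord partial_deriv_const cpoly_intros cp algebra_simps)
    then have "(\<Sum>k\<in>UNIV. ?D k (?D k R) x) =
        complex_of_real (x $ i) * (\<Sum>k\<in>UNIV. ?D k (?D k (?D j P)) x) - complex_of_real (x $ j) * (\<Sum>k\<in>UNIV. ?D k (?D k (?D i P)) x)
      + 2 * ((\<Sum>k\<in>UNIV. (if k = i then 1 else 0) * ?D k (?D j P) x) - (\<Sum>k\<in>UNIV. (if k = j then 1 else 0) * ?D k (?D i P) x))"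
      by (simp add: sum.distrib sum_subtractf sum_distrib_left)
    also have "\<dots> = 2 * (?D i (?D j P) x - ?D j (?D i P) x)"
      by (simp add: lap if_distrib[of "\<lambda>c. c * _"] cong: if_cong)
    also have "\<dots> = 0" by (simp add: partial_deriv_commute[OF cp(1), of i j])
    finally show "(\<Sum>k\<in>UNIV. ?D k (?D k R) x) = 0" .
  qed
  moreover have "cpoly R" unfolding R_def by (intro cpoly_intros cp)
  moreover have "(\<Sum>k\<in>UNIV. complex_of_real (x $ k) * ?D k R x) = of_nat l * R x" for x
  proof -
    have "(\<Sum>k\<in>UNIV. complex_of_real (x $ k) * ?D k R x) =
      (\<Sum>k\<in>UNIV. complex_of_real (x $ i) * (complex_of_real (x $ k) * ?D k (?D j P) x)
        - complex_of_real (x $ j) * (complex_of_real (x $ k) * ?D k (?D i P) x)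
        + ((if k = i then complex_of_real (x $ k) * ?D j P x else 0)
          - (if k = j then complex_of_real (x $ k) * ?D i P x else 0)))"
      by (intro sum.cong refl) (simp add: DR algebra_simps)
    also have "\<dots> = complex_of_real (x $ i) * (\<Sum>k\<in>UNIV. complex_of_real (x $ k) * ?D k (?D j P) x)
      - complex_of_real (x $ j) * (\<Sum>k\<in>UNIV. complex_of_real (x $ k) * ?D k (?D i P) x)
      + (complex_of_real (x $ i) * ?D j P x - complex_of_real (x $ j) * ?D i P x)"
      by (simp add: sum.distrib sum_subtractf flip: sum_distrib_left)
    finally have "(\<Sum>k\<in>UNIV. complex_of_real (x $ k) * ?D k R x) = \<dots>" .
    then show ?thesis
      unfolding solid_harmonic_euler2[OF assms] by (simp add: R_def algebra_simps)
  qed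
  ultimately show ?thesis unfolding solid_harmonic_def R_def by blast
qed

section \<open>Circle means\<close>

definition dird :: "real^3 \<Rightarrow> (real^3 \<Rightarrow> complex) \<Rightarrow> real^3 \<Rightarrow> complex" where
  "dird v f x = (\<Sum>i\<in>UNIV. complex_of_real (v $ i) * partial_deriv i f x)"

lemma dird_linear:
  "dird (v + w) f x = dird v f x + dird w f x" "dird (v - w) f x = dird v f x - dird w f x"
  "dird (c *\<^sub>R v) f x = c * dird v f x" "dird (- v) f x = - dird v f x"
  by (simp_all add: dird_def sum.distrib sum_subtractf sum_distrib_left sum_negf algebra_simps)

lemma dird_chain:
  assumes "cpoly f" "(p has_vector_derivative p') (at s)"
  shows "((\<lambda>s. f (p s)) has_vector_derivative dird p' f (p s)) (at s)"
proof -
  have "((\<lambda>s. f (p s)) has_derivative (\<lambda>h. \<Sum>i\<in>UNIV. complex_of_real ((h *\<^sub>R p') $ i) * partial_deriv i f (p s))) (at s)"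
    using assms(2) unfolding has_vector_derivative_def
    by (rule has_derivative_compose) (rule cpoly_gradient(2)[OF assms(1)])
  then show ?thesis
    by (simp add: has_vector_derivative_def dird_def scaleR_conv_of_real[where 'a = complex] sum_distrib_left mult_ac)
qed

definition hess :: "real^3 \<Rightarrow> real^3 \<Rightarrow> (real^3 \<Rightarrow> complex) \<Rightarrow> real^3 \<Rightarrow> complex" where
  "hess v w f x = (\<Sum>i\<in>UNIV. complex_of_real (w $ i) * dird v (partial_deriv i f) x)"

lemma hess_scaleR: "hess (c *\<^sub>R v) w f x = c * hess v w f x"
  by (simp add: hess_def dird_linear sum_distrib_left mult_ac)

lemma dird_chain2:
  assumes "cpoly f" "(p has_vector_derivative p') (at s)" "(w has_vector_derivative w') (at s)"
  shows "((\<lambda>s. dird (w s) f (p s)) has_vector_derivative dird w' f (p s) + hess p' (w s) f (p s)) (at s)"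
proof -
  have "((\<lambda>s. complex_of_real (w s $ i)) has_vector_derivative complex_of_real (w' $ i)) (at s)" for i
    by (intro bounded_linear.has_vector_derivative[OF _ assms(3)] bounded_linear_compose[OF bounded_linear_of_real bounded_linear_vec_nth])
  then have "((\<lambda>s. \<Sum>i\<in>UNIV. complex_of_real (w s $ i) * partial_deriv i f (p s)) has_vector_derivative
     (\<Sum>i\<in>UNIV. complex_of_real (w s $ i) * dird p' (partial_deriv i f) (p s) + complex_of_real (w' $ i) * partial_deriv i f (p s))) (at s)"
    by (intro has_vector_derivative_sum has_vector_derivative_mult dird_chain assms cpoly_gradient)
  then show ?thesis by (simp add: dird_def[of "w _"] dird_def[of w'] hess_def sum.distrib add.commute)
qed

text \<open>The symmetric tensor of an orthogonal pair is unchanged when the pair is rotated in its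
  plane. This serves the rotation by \<phi> as well as the one by \<theta>.\<close>

lemma rotate_pair:
  fixes c s :: real
  assumes "c\<^sup>2 + s\<^sup>2 = 1"
  shows "(c * a1 + s * b1) * (c * a2 + s * b2) + (c * b1 - s * a1) * (c * b2 - s * a2) = a1 * a2 + b1 * b2"
proof -
  have "(c * a1 + s * b1) * (c * a2 + s * b2) + (c * b1 - s * a1) * (c * b2 - s * a2) = (c\<^sup>2 + s\<^sup>2) * (a1 * a2 + b1 * b2)"
    by (simp add: power2_eq_square algebra_simps)
  then show ?thesis using assms by simp
qed

section \<open>The moving frame of polar coordinates about the pole x\<close>

locale frame =
  fixes x a b :: "real^3"
  assumes unit: "x \<bullet> x = 1" "a \<bullet> a = 1" "b \<bullet> b = 1"
    and orth: "x \<bullet> a = 0" "x \<bullet> b = 0" "a \<bullet> b = 0"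
    and cross: "cross3 x a = b" "cross3 x b = - a"
begin

text \<open>\<open>\<omega> \<phi>\<close> and \<open>\<nu> \<phi>\<close> rotate a and b in the
  plane orthogonal to x. The vectors \<open>pt\<close>, \<open>pt'\<close> and \<open>\<nu>\<close>
  are the orthonormal frame of polar coordinates: normal, meridian and azimuthal direction.\<close>

definition \<omega> where "\<omega> \<phi> = cos \<phi> *\<^sub>R a + sin \<phi> *\<^sub>R b"
definition \<nu> where "\<nu> \<phi> = cos \<phi> *\<^sub>R b - sin \<phi> *\<^sub>R a"
definition pt where "pt \<theta> \<phi> = cos \<theta> *\<^sub>R x + sin \<theta> *\<^sub>R \<omega> \<phi>"
definition pt' where "pt' \<theta> \<phi> = cos \<theta> *\<^sub>R \<omega> \<phi> - sin \<theta> *\<^sub>R x"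

lemma \<omega>_deriv: "(\<omega> has_vector_derivative \<nu> \<phi>) (at \<phi>)"
  unfolding \<omega>_def \<nu>_def by (auto intro!: derivative_eq_intros)

lemma \<nu>_deriv: "(\<nu> has_vector_derivative - \<omega> \<phi>) (at \<phi>)"
  unfolding \<omega>_def \<nu>_def by (auto intro!: derivative_eq_intros)

lemma pt_deriv: "((\<lambda>\<theta>. pt \<theta> \<phi>) has_vector_derivative pt' \<theta> \<phi>) (at \<theta>)"
  unfolding pt_def pt'_def by (auto intro!: derivative_eq_intros)

lemma pt'_deriv: "((\<lambda>\<theta>. pt' \<theta> \<phi>) has_vector_derivative - pt \<theta> \<phi>) (at \<theta>)"
  unfolding pt_def pt'_def by (auto intro!: derivative_eq_intros)

lemma pt_deriv_\<phi>: "((\<lambda>\<phi>. pt \<theta> \<phi>) has_vector_derivative sin \<theta> *\<^sub>R \<nu> \<phi>) (at \<phi>)"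
  unfolding pt_def by (auto intro!: derivative_eq_intros \<omega>_deriv)

lemma periodic: "\<omega> (2 * pi) = \<omega> 0" "\<nu> (2 * pi) = \<nu> 0" "pt \<theta> (2 * pi) = pt \<theta> 0"
  by (simp_all add: \<omega>_def \<nu>_def pt_def)

text \<open>The rotation field about x is the \<phi>-derivative of \<open>pt\<close>; this is why
  directional derivatives along \<open>cross3 x y\<close> have mean zero on the circle.\<close>

lemma cross_pt: "cross3 x (pt \<theta> \<phi>) = sin \<theta> *\<^sub>R \<nu> \<phi>"
  unfolding pt_def \<omega>_def \<nu>_def
  by (simp add: cross cross_add_right cross_mult_right algebra_simps)

lemma orth_sym: "a \<bullet> x = 0" "b \<bullet> x = 0" "b \<bullet> a = 0"
  using orth by (simp_all add: inner_commute)

lemma norm_pt: "norm (pt \<theta> \<phi>) = 1"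
proof -
  have "\<omega> \<phi> \<bullet> \<omega> \<phi> = 1" "\<omega> \<phi> \<bullet> x = 0" "x \<bullet> \<omega> \<phi> = 0"
    by (simp_all add: \<omega>_def inner_add_left inner_add_right unit orth orth_sym)
  then have "pt \<theta> \<phi> \<bullet> pt \<theta> \<phi> = 1"
    by (simp add: pt_def inner_add_left inner_add_right unit)
  then show ?thesis by (simp add: norm_eq_sqrt_inner)
qed

lemma inner_pt: "x \<bullet> pt \<theta> \<phi> = cos \<theta>"
  by (simp add: pt_def \<omega>_def inner_add_right unit orth)

text \<open>Orthonormal rows of a square matrix make its columns orthonormal.\<close>

lemma frame_completeness: "x $ i * x $ j + a $ i * a $ j + b $ i * b $ j = (if i = j then 1 else 0)"
proof -
  define M :: "real^3^3" where "M = vector [x, a, b]"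
  have "M ** transpose M = mat 1"
    using unit orth
    by (simp add: vec_eq_iff forall_3 matrix_matrix_mult_def transpose_def mat_def M_def inner_vec_def sum_3 mult.commute)
  then have "transpose M ** M = mat 1" by (simp add: matrix_left_right_inverse)
  then have "(transpose M ** M) $ i $ j = mat 1 $ i $ j" by simp
  then show ?thesis
    by (simp add: matrix_matrix_mult_def transpose_def mat_def M_def sum_3)
qed

text \<open>The sum over a frame survives two planar rotations, by \<phi> in the plane of a and b
  and by \<theta> in the plane of x and \<omega>.\<close>

lemma completeness_rotated:
  "x $ i * x $ j + \<omega> \<phi> $ i * \<omega> \<phi> $ j + \<nu> \<phi> $ i * \<nu> \<phi> $ j = (if i = j then 1 else 0)"
  "pt \<theta> \<phi> $ i * pt \<theta> \<phi> $ j + pt' \<theta> \<phi> $ i * pt' \<theta> \<phi> $ j + \<nu> \<phi> $ i * \<nu> \<phi> $ j = (if i = j then 1 else 0)"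
proof -
  have "\<omega> \<phi> $ i * \<omega> \<phi> $ j + \<nu> \<phi> $ i * \<nu> \<phi> $ j = a $ i * a $ j + b $ i * b $ j"
    using rotate_pair[of "cos \<phi>" "sin \<phi>" "a $ i" "b $ i" "a $ j" "b $ j"] by (simp add: \<omega>_def \<nu>_def)
  then show 1: "x $ i * x $ j + \<omega> \<phi> $ i * \<omega> \<phi> $ j + \<nu> \<phi> $ i * \<nu> \<phi> $ j = (if i = j then 1 else 0)"
    using frame_completeness[of i j] by simp
  have "pt \<theta> \<phi> $ i * pt \<theta> \<phi> $ j + pt' \<theta> \<phi> $ i * pt' \<theta> \<phi> $ j = x $ i * x $ j + \<omega> \<phi> $ i * \<omega> \<phi> $ j"
    using rotate_pair[of "cos \<theta>" "sin \<theta>" "x $ i" "\<omega> \<phi> $ i" "x $ j" "\<omega> \<phi> $ j"] by (simp add: pt_def pt'_def)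
  then show "pt \<theta> \<phi> $ i * pt \<theta> \<phi> $ j + pt' \<theta> \<phi> $ i * pt' \<theta> \<phi> $ j + \<nu> \<phi> $ i * \<nu> \<phi> $ j = (if i = j then 1 else 0)"
    using 1 by simp
qed

lemma continuous_frame:
  fixes A :: "'z::t2_space set"
  shows "continuous_on A f \<Longrightarrow> continuous_on A (\<lambda>z. \<omega> (f z))"
  "continuous_on A f \<Longrightarrow> continuous_on A (\<lambda>z. \<nu> (f z))"
  "continuous_on A f \<Longrightarrow> continuous_on A g \<Longrightarrow> continuous_on A (\<lambda>z. pt (g z) (f z))"
  "continuous_on A f \<Longrightarrow> continuous_on A g \<Longrightarrow> continuous_on A (\<lambda>z. pt' (g z) (f z))"
  unfolding \<omega>_def \<nu>_def pt_def pt'_def by (auto intro!: continuous_intros continuous_on_cos continuous_on_sin)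

lemma continuous_cpoly_comp: "cpoly f \<Longrightarrow> continuous_on A p \<Longrightarrow> continuous_on A (\<lambda>z. f (p z))"
  by (rule continuous_on_compose2[OF cpoly_continuous_on[of f UNIV]]) auto

lemma continuous_dird: "cpoly f \<Longrightarrow> continuous_on A p \<Longrightarrow> continuous_on A w \<Longrightarrow> continuous_on A (\<lambda>z. dird (w z) f (p z))"
  unfolding dird_def by (intro continuous_intros continuous_cpoly_comp cpoly_gradient) auto

lemma continuous_hess:
  "cpoly f \<Longrightarrow> continuous_on A p \<Longrightarrow> continuous_on A v \<Longrightarrow> continuous_on A w \<Longrightarrow> continuous_on A (\<lambda>z. hess (v z) (w z) f (p z))"
  unfolding hess_def by (intro continuous_intros continuous_dird cpoly_gradient) auto

lemmas cont_intros = continuous_on_add continuous_on_minus continuous_on_mult continuous_dird continuous_hess continuous_frame continuous_on_const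
  continuous_on_fst continuous_on_snd continuous_on_id

lemma integral_periodic_deriv:
  assumes "\<And>\<phi>. (f has_vector_derivative f' \<phi>) (at \<phi>)" "f (2 * pi) = f 0"
  shows "integral {0..2*pi} f' = (0 :: complex)"
proof -
  have "(f' has_integral f (2 * pi) - f 0) {0..2*pi}"
    by (rule fundamental_theorem_of_calculus) (auto intro: has_vector_derivative_at_within assms)
  then show ?thesis using assms(2) by (simp add: integral_unique)
qed

text \<open>An integral over the circle rather than an average, hence the factor 2 pi in all closed
  forms.\<close>

definition cmean :: "(real^3 \<Rightarrow> complex) \<Rightarrow> real \<Rightarrow> complex" where
  "cmean h \<theta> = integral {0..2*pi} (\<lambda>\<phi>. h (pt \<theta> \<phi>))"

lemma cmean_integrable: "cpoly h \<Longrightarrow> (\<lambda>\<phi>. h (pt \<theta> \<phi>)) integrable_on {0..2*pi}"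
  by (intro integrable_continuous_interval continuous_cpoly_comp cont_intros)

lemma cmean_add: "cpoly f \<Longrightarrow> cpoly g \<Longrightarrow> cmean (\<lambda>y. f y + g y) \<theta> = cmean f \<theta> + cmean g \<theta>"
  unfolding cmean_def by (intro integral_add cmean_integrable)

lemma cmean_diff: "cpoly f \<Longrightarrow> cpoly g \<Longrightarrow> cmean (\<lambda>y. f y - g y) \<theta> = cmean f \<theta> - cmean g \<theta>"
  unfolding cmean_def by (intro integral_diff cmean_integrable)

lemma cmean_cmult: "cmean (\<lambda>y. c * f y) \<theta> = c * cmean f \<theta>"
  unfolding cmean_def by simp

lemma cmean_cong: "(\<And>y. norm y = 1 \<Longrightarrow> x \<bullet> y = cos \<theta> \<Longrightarrow> f y = g y) \<Longrightarrow> cmean f \<theta> = cmean g \<theta>"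
  unfolding cmean_def by (intro integral_cong) (simp add: norm_pt inner_pt)

lemma cmean_rotation:
  assumes "cpoly h"
  shows "cmean (\<lambda>y. dird (cross3 x y) h y) \<theta> = 0"
  unfolding cmean_def cross_pt
  by (rule integral_periodic_deriv[OF dird_chain[OF assms pt_deriv_\<phi>]]) (simp add: periodic)

lemma leibniz_circle:
  fixes f f' :: "real \<Rightarrow> real \<Rightarrow> complex"
  assumes "\<And>\<theta> \<phi>. ((\<lambda>\<theta>. f \<theta> \<phi>) has_vector_derivative f' \<theta> \<phi>) (at \<theta>)"
    and "continuous_on UNIV (\<lambda>z. f' (fst z) (snd z))" "\<And>\<theta>. continuous_on UNIV (f \<theta>)"
  shows "((\<lambda>\<theta>. integral {0..2*pi} (f \<theta>)) has_vector_derivative integral {0..2*pi} (f' \<theta>)) (at \<theta>)"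
proof -
  have "((\<lambda>\<theta>. integral (cbox 0 (2*pi)) (f \<theta>)) has_vector_derivative integral (cbox 0 (2*pi)) (f' \<theta>)) (at \<theta> within UNIV)"
  proof (rule leibniz_rule_vector_derivative)
    show "((\<lambda>\<theta>. f \<theta> t) has_vector_derivative f' \<theta> t) (at \<theta> within UNIV)" for \<theta> t using assms(1) by simp
    show "f \<theta> integrable_on cbox 0 (2 * pi)" for \<theta>
      using assms(3) by (intro integrable_continuous) (auto intro: continuous_on_subset)
    show "continuous_on (UNIV \<times> cbox 0 (2 * pi)) (\<lambda>(\<theta>, \<phi>). f' \<theta> \<phi>)"
      using assms(2) by (auto simp: split_beta intro: continuous_on_subset)
  qed auto
  then show ?thesis by simp
qed

lemma cmean_deriv:
  assumes "cpoly h"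
  shows "(cmean h has_vector_derivative integral {0..2*pi} (\<lambda>\<phi>. dird (pt' \<theta> \<phi>) h (pt \<theta> \<phi>))) (at \<theta>)"
  unfolding cmean_def
  by (rule leibniz_circle; intro dird_chain continuous_cpoly_comp[OF assms] assms pt_deriv cont_intros)

lemma cmean_deriv2:
  assumes "cpoly h"
  shows "((\<lambda>\<theta>. integral {0..2*pi} (\<lambda>\<phi>. dird (pt' \<theta> \<phi>) h (pt \<theta> \<phi>))) has_vector_derivative
     integral {0..2*pi} (\<lambda>\<phi>. dird (- pt \<theta> \<phi>) h (pt \<theta> \<phi>) + hess (pt' \<theta> \<phi>) (pt' \<theta> \<phi>) h (pt \<theta> \<phi>))) (at \<theta>)"
  by (rule leibniz_circle; intro dird_chain2 assms pt_deriv pt'_deriv cont_intros)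

text \<open>By completeness of the moving frame the three pure second derivatives add up to the
  Laplacian.\<close>

lemma trace_hess:
  assumes "harmonic P"
  shows "hess (pt \<theta> \<phi>) (pt \<theta> \<phi>) P y + hess (pt' \<theta> \<phi>) (pt' \<theta> \<phi>) P y + hess (\<nu> \<phi>) (\<nu> \<phi>) P y = 0"
proof -
  let ?D = "partial_deriv"
  have "hess (pt \<theta> \<phi>) (pt \<theta> \<phi>) P y + hess (pt' \<theta> \<phi>) (pt' \<theta> \<phi>) P y + hess (\<nu> \<phi>) (\<nu> \<phi>) P y
    = (\<Sum>i\<in>UNIV. \<Sum>j\<in>UNIV. complex_of_real (pt \<theta> \<phi> $ i * pt \<theta> \<phi> $ j + pt' \<theta> \<phi> $ i * pt' \<theta> \<phi> $ j + \<nu> \<phi> $ i * \<nu> \<phi> $ j)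
       * ?D j (?D i P) y)"
    unfolding hess_def dird_def sum_distrib_left sum.distrib[symmetric]
    by (intro sum.cong refl) (simp add: algebra_simps)
  also have "\<dots> = (\<Sum>i\<in>UNIV. ?D i (?D i P) y)"
    unfolding completeness_rotated
    by (simp add: if_distrib[of complex_of_real] if_distrib[of "\<lambda>c. c * _"] cong: if_cong)
  also have "\<dots> = 0" using assms by (simp add: harmonic_def)
  finally show ?thesis .
qed

text \<open>The gradient is expanded in x, \<omega>, \<nu>, which is orthonormal but not adapted to
  the tangent plane at the point of the circle.\<close>

lemma dird_decomp: "partial_deriv i P y = x $ i * dird x P y + \<omega> \<phi> $ i * dird (\<omega> \<phi>) P y + \<nu> \<phi> $ i * dird (\<nu> \<phi>) P y"
proof -
  have "x $ i * dird x P y + \<omega> \<phi> $ i * dird (\<omega> \<phi>) P y + \<nu> \<phi> $ i * dird (\<nu> \<phi>) P y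
    = (\<Sum>j\<in>UNIV. complex_of_real (x $ i * x $ j + \<omega> \<phi> $ i * \<omega> \<phi> $ j + \<nu> \<phi> $ i * \<nu> \<phi> $ j) * partial_deriv j P y)"
    unfolding dird_def sum_distrib_left sum.distrib[symmetric]
    by (intro sum.cong refl) (simp add: algebra_simps)
  also have "\<dots> = partial_deriv i P y"
    unfolding completeness_rotated
    by (simp add: if_distrib[of complex_of_real] if_distrib[of "\<lambda>c. c * _"] cong: if_cong)
  finally show ?thesis by simp
qed

text \<open>The second identity combines Euler's identity for P with that for its partial
  derivatives, of degree l - 1.\<close>

lemma euler_pt:
  assumes "solid_harmonic l P"
  shows "dird y P y = of_nat l * P y" "hess y y P y = of_nat l * (of_nat l - 1) * P y"
proof -
  show 1: "dird y P y = of_nat l * P y"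
    using assms by (simp add: solid_harmonic_def dird_def)
  show "hess y y P y = of_nat l * (of_nat l - 1) * P y"
  proof -
    have "hess y y P y = (\<Sum>i\<in>UNIV. (of_nat l - 1) * (complex_of_real (y $ i) * partial_deriv i P y))"
      unfolding hess_def dird_def solid_harmonic_euler2[OF assms] by (simp only: mult.left_commute)
    also have "\<dots> = (of_nat l - 1) * (of_nat l * P y)"
      unfolding 1[symmetric] dird_def by (rule sum_distrib_left[symmetric])
    finally show ?thesis by (simp only: mult_ac)
  qed
qed

lemma \<omega>_eq_pt: "\<omega> \<phi> = sin \<theta> *\<^sub>R pt \<theta> \<phi> + cos \<theta> *\<^sub>R pt' \<theta> \<phi>"
proof -
  have "s * (c * p + s * q) + c * (c * q - s * p) = (c\<^sup>2 + s\<^sup>2) * q" for c s p q :: real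
    by (simp add: power2_eq_square algebra_simps)
  from this[of "sin \<theta>" "cos \<theta>"] show ?thesis
    by (simp add: pt_def pt'_def vec_eq_iff)
qed

lemma integral_\<omega>: "integral {0..2*pi} (\<lambda>\<phi>. complex_of_real (\<omega> \<phi> $ i) * c) = 0"
proof (rule integral_periodic_deriv)
  show "((\<lambda>\<phi>. - (complex_of_real (\<nu> \<phi> $ i) * c)) has_vector_derivative complex_of_real (\<omega> \<phi> $ i) * c) (at \<phi>)" for \<phi>
  proof -
    have "((\<lambda>\<phi>. complex_of_real (\<nu> \<phi> $ i)) has_vector_derivative complex_of_real ((- \<omega> \<phi>) $ i)) (at \<phi>)"
      by (intro bounded_linear.has_vector_derivative[OF _ \<nu>_deriv] bounded_linear_compose[OF bounded_linear_of_real bounded_linear_vec_nth])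
    from has_vector_derivative_minus[OF has_vector_derivative_mult_left[OF this]] show ?thesis by simp
  qed
qed (simp add: periodic)

text \<open>The azimuthal part of the Laplacian integrates to zero over the circle.\<close>

lemma cmean_ode:
  assumes P: "solid_harmonic l P"
  shows "complex_of_real (sin \<theta>) * integral {0..2*pi} (\<lambda>\<phi>. dird (- pt \<theta> \<phi>) P (pt \<theta> \<phi>) + hess (pt' \<theta> \<phi>) (pt' \<theta> \<phi>) P (pt \<theta> \<phi>))
    + complex_of_real (cos \<theta>) * integral {0..2*pi} (\<lambda>\<phi>. dird (pt' \<theta> \<phi>) P (pt \<theta> \<phi>))
    + of_nat (l * (l + 1)) * complex_of_real (sin \<theta>) * cmean P \<theta> = 0"
proof -
  have cp: "cpoly P" and hP: "harmonic P" using P by (auto simp: solid_harmonic_def)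
  let ?s = "complex_of_real (sin \<theta>)" and ?c = "complex_of_real (cos \<theta>)"
  define f1 where "f1 \<phi> = dird (- pt \<theta> \<phi>) P (pt \<theta> \<phi>) + hess (pt' \<theta> \<phi>) (pt' \<theta> \<phi>) P (pt \<theta> \<phi>)" for \<phi>
  define f2 where "f2 \<phi> = dird (pt' \<theta> \<phi>) P (pt \<theta> \<phi>)" for \<phi>
  define f3 where "f3 \<phi> = P (pt \<theta> \<phi>)" for \<phi>
  have f: "f1 integrable_on {0..2*pi}" "f2 integrable_on {0..2*pi}" "f3 integrable_on {0..2*pi}"
    unfolding f1_def f2_def f3_def
    by (intro integrable_continuous_interval cont_intros cp continuous_cpoly_comp[OF cp])+
  have der: "((\<lambda>\<phi>. - dird (\<nu> \<phi>) P (pt \<theta> \<phi>)) has_vector_derivative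
     - (dird (- \<omega> \<phi>) P (pt \<theta> \<phi>) + hess (sin \<theta> *\<^sub>R \<nu> \<phi>) (\<nu> \<phi>) P (pt \<theta> \<phi>))) (at \<phi>)" for \<phi>
    by (intro has_vector_derivative_minus dird_chain2 cp pt_deriv_\<phi> \<nu>_deriv)
  \<comment> \<open>Euler's identities contribute -l and -l(l-1) to the coefficient of sin \<theta>
    P, which leaves l out of l(l+1). Together with cos \<theta> \<open>f2\<close> this makes up the
    derivative along \<omega>.\<close>
  have eq: "- (dird (- \<omega> \<phi>) P (pt \<theta> \<phi>) + hess (sin \<theta> *\<^sub>R \<nu> \<phi>) (\<nu> \<phi>) P (pt \<theta> \<phi>))
     = ?s * f1 \<phi> + ?c * f2 \<phi> + of_nat (l * (l + 1)) * ?s * f3 \<phi>" for \<phi>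
  proof -
    have t: "hess (pt' \<theta> \<phi>) (pt' \<theta> \<phi>) P (pt \<theta> \<phi>) = - (hess (pt \<theta> \<phi>) (pt \<theta> \<phi>) P (pt \<theta> \<phi>)) - hess (\<nu> \<phi>) (\<nu> \<phi>) P (pt \<theta> \<phi>)"
      using trace_hess[OF hP, of \<theta> \<phi> "pt \<theta> \<phi>"] by (simp add: algebra_simps eq_neg_iff_add_eq_0)
    have "dird (\<omega> \<phi>) P (pt \<theta> \<phi>) = dird (sin \<theta> *\<^sub>R pt \<theta> \<phi> + cos \<theta> *\<^sub>R pt' \<theta> \<phi>) P (pt \<theta> \<phi>)"
      by (simp only: \<omega>_eq_pt[of \<phi> \<theta>, symmetric])
    then have w: "dird (\<omega> \<phi>) P (pt \<theta> \<phi>) = ?s * (of_nat l * P (pt \<theta> \<phi>)) + ?c * dird (pt' \<theta> \<phi>) P (pt \<theta> \<phi>)"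
      by (simp only: dird_linear euler_pt[OF P])
    show ?thesis
      unfolding f1_def f2_def f3_def t dird_linear w hess_scaleR euler_pt[OF P]
      by (simp only: of_nat_mult of_nat_add of_nat_1) (simp add: algebra_simps)
  qed
  have "((\<lambda>\<phi>. ?s * f1 \<phi> + ?c * f2 \<phi> + of_nat (l * (l + 1)) * ?s * f3 \<phi>) has_integral
      (?s * integral {0..2*pi} f1 + ?c * integral {0..2*pi} f2 + of_nat (l * (l + 1)) * ?s * integral {0..2*pi} f3)) {0..2*pi}"
    by (intro has_integral_add has_integral_mult_right integrable_integral f)
  then have "?s * integral {0..2*pi} f1 + ?c * integral {0..2*pi} f2 + of_nat (l * (l + 1)) * ?s * integral {0..2*pi} f3
   = integral {0..2*pi} (\<lambda>\<phi>. ?s * f1 \<phi> + ?c * f2 \<phi> + of_nat (l * (l + 1)) * ?s * f3 \<phi>)"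
    by (rule integral_unique[symmetric])
  also have "\<dots> = 0"
    unfolding eq[symmetric] by (rule integral_periodic_deriv[OF der]) (simp add: periodic)
  finally show ?thesis
    unfolding f1_def f2_def f3_def cmean_def .
qed

end

text \<open>The tangential part of the gradient of P, with the radial derivative replaced by l P
  through Euler's identity. The expression is polynomial on all of R^3 and is the surface gradient
  for |y| = 1.\<close>

definition sgrad :: "nat \<Rightarrow> (real^3 \<Rightarrow> complex) \<Rightarrow> real^3 \<Rightarrow> complex^3" where
  "sgrad l P y = (\<chi> i. partial_deriv i P y - of_nat l * P y * complex_of_real (y $ i))"

lemma sgrad_nth: "sgrad l P y $ i = partial_deriv i P y - of_nat l * P y * complex_of_real (y $ i)"
  by (simp add: sgrad_def)

lemma cpoly_sgrad: "cpoly P \<Longrightarrow> cpoly (\<lambda>y. sgrad l P y $ i)"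
  unfolding sgrad_nth by (intro cpoly_intros cpoly_gradient)

section \<open>Cross and dot products of complex vectors\<close>

lemma cross3_nth:
  "cross3 v w $ 1 = v $ 2 * w $ 3 - v $ 3 * w $ 2"
  "cross3 v w $ 2 = v $ 3 * w $ 1 - v $ 1 * w $ 3"
  "cross3 v w $ 3 = v $ 1 * w $ 2 - v $ 2 * w $ 1"
  by (simp_all add: cross3_def)

lemma ccross_nth:
  "(v \<times>\<^sub>c w) $ 1 = v $ 2 * w $ 3 - v $ 3 * w $ 2"
  "(v \<times>\<^sub>c w) $ 2 = v $ 3 * w $ 1 - v $ 1 * w $ 3"
  "(v \<times>\<^sub>c w) $ 3 = v $ 1 * w $ 2 - v $ 2 * w $ 1"
  by (simp_all add: ccross_def)

lemma cvec_nth: "cvec v $ i = complex_of_real (v $ i)"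
  by (simp add: cvec_def)

lemma cvec_cross3: "cvec (cross3 v w) = cvec v \<times>\<^sub>c cvec w"
  by (simp add: vec_eq_iff forall_3 cvec_nth ccross_nth cross3_nth)

lemma cdot_cvec: "cvec v \<bullet>\<^sub>c cvec w = complex_of_real (v \<bullet> w)"
  by (simp add: cdot_def cvec_nth inner_vec_def)

text \<open>The part of u along y contributes the first term. The rest of u is tangent like v, so
  its cross product with v is parallel to y, with the triple product as coefficient.\<close>

lemma ccross_tangent:
  fixes u y v :: "complex^3"
  assumes "y \<bullet>\<^sub>c y = 1" "y \<bullet>\<^sub>c v = 0"
  shows "u \<times>\<^sub>c v = (u \<bullet>\<^sub>c y) *s (y \<times>\<^sub>c v) - ((u \<times>\<^sub>c y) \<bullet>\<^sub>c v) *s y"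
proof -
  have a: "y$1 * y$1 + y$2 * y$2 + y$3 * y$3 = 1" "y$1 * v$1 + y$2 * v$2 + y$3 * v$3 = 0"
    using assms by (simp_all add: cdot_def sum_3)
  show ?thesis
    unfolding vec_eq_iff forall_3
    by (intro conjI; simp add: ccross_nth cdot_def sum_3; use a in algebra)
qed

text \<open>The double cross product formula for the bilinear product: v is split into its parts
  along x and orthogonal to x.\<close>

lemma ccross_double:
  fixes x v :: "complex^3"
  assumes "x \<bullet>\<^sub>c x = 1"
  shows "v = (x \<bullet>\<^sub>c v) *s x - x \<times>\<^sub>c (x \<times>\<^sub>c v)"
proof -
  have a: "x$1 * x$1 + x$2 * x$2 + x$3 * x$3 = 1"
    using assms by (simp add: cdot_def sum_3)
  show ?thesis
    unfolding vec_eq_iff forall_3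
    by (intro conjI; simp add: ccross_nth cdot_def sum_3; use a in algebra)
qed

text \<open>By Euler's identity the radial derivative is l P, which is what the second term of
  \<open>sgrad\<close> removes when |y| = 1.\<close>

lemma sgrad_tangent:
  assumes "solid_harmonic l P" "norm y = 1"
  shows "cvec y \<bullet>\<^sub>c sgrad l P y = 0"
proof -
  have "(\<Sum>i\<in>UNIV. complex_of_real (y $ i) * complex_of_real (y $ i)) = 1"
    using assms(2) cdot_cvec[of y y] by (simp add: cdot_def cvec_nth norm_eq_1)
  then have "(\<Sum>i\<in>UNIV. complex_of_real (y $ i) * (of_nat l * P y * complex_of_real (y $ i))) = of_nat l * P y"
    by (simp add: mult.left_commute[of _ "of_nat l * P y"] flip: sum_distrib_left)
  then show ?thesis
    using assms(1) by (simp add: solid_harmonic_def cdot_def sgrad_nth cvec_nth right_diff_distrib sum_subtractf)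
qed

text \<open>For l > 0 this is the integral of P_l from t to 1: Legendre's equation makes it a
  primitive of -P_l, and it vanishes at t = 1. For l = 0 it is identically 0.\<close>

definition legendre_quot :: "nat \<Rightarrow> real \<Rightarrow> real" where
  "legendre_quot l t = (1 - t\<^sup>2) * poly (pderiv (legendre l)) t / real (l * (l + 1))"

lemma legendre_quot_deriv:
  assumes "l \<noteq> 0"
  shows "(legendre_quot l has_real_derivative - poly (legendre l) t) (at t)"
proof -
  have "((\<lambda>t. (1 - t\<^sup>2) * poly (pderiv (legendre l)) t / real (l * (l + 1))) has_real_derivative
     ((1 - t\<^sup>2) * poly (pderiv (pderiv (legendre l))) t - 2 * t * poly (pderiv (legendre l)) t) / real (l * (l + 1))) (at t)"
    by (rule DERIV_cdivide) (auto intro!: derivative_eq_intros simp: algebra_simps)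
  also have "((1 - t\<^sup>2) * poly (pderiv (pderiv (legendre l))) t - 2 * t * poly (pderiv (legendre l)) t) / real (l * (l + 1))
     = (- (real (l * (l + 1)) * poly (legendre l) t)) / real (l * (l + 1))"
    using legendre_ode[of t l] by (intro arg_cong2[where f = "(/)"] refl) linarith
  also have "\<dots> = - poly (legendre l) t"
    using assms by (simp del: of_nat_mult of_nat_add)
  finally show ?thesis unfolding legendre_quot_def[abs_def] .
qed

section \<open>Closed forms of the circle means\<close>

context frame
begin

text \<open>Both sides solve the polar equation with the same value and with slope 0 at \<theta> =
  0, so uniqueness applies to their difference.\<close>

lemma cmean_harmonic:
  assumes P: "solid_harmonic l P" and \<theta>: "0 \<le> \<theta>" "\<theta> < pi"
  shows "cmean P \<theta> = complex_of_real (2 * pi * poly (legendre l) (cos \<theta>)) * P x"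
proof -
  have cp: "cpoly P" using P by (simp add: solid_harmonic_def)
  define I1 where "I1 \<theta> = integral {0..2*pi} (\<lambda>\<phi>. dird (pt' \<theta> \<phi>) P (pt \<theta> \<phi>))" for \<theta>
  define I2 where "I2 \<theta> = integral {0..2*pi} (\<lambda>\<phi>. dird (- pt \<theta> \<phi>) P (pt \<theta> \<phi>) + hess (pt' \<theta> \<phi>) (pt' \<theta> \<phi>) P (pt \<theta> \<phi>))" for \<theta>
  have d1: "(cmean P has_vector_derivative I1 \<theta>) (at \<theta>)" for \<theta>
    unfolding I1_def by (rule cmean_deriv[OF cp])
  have d2: "(I1 has_vector_derivative I2 \<theta>) (at \<theta>)" for \<theta>
    unfolding I1_def[abs_def] I2_def by (rule cmean_deriv2[OF cp])
  have i0: "cmean P 0 = complex_of_real (2 * pi) * P x"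
    by (simp add: cmean_def pt_def scaleR_conv_of_real)
  \<comment> \<open>At the pole the meridian direction is \<omega>, whose integral over the circle
    vanishes.\<close>
  have i1: "I1 0 = 0"
  proof -
    have "((\<lambda>\<phi>. complex_of_real (\<omega> \<phi> $ i) * partial_deriv i P x) has_integral 0) {0..2*pi}" for i
      using integral_\<omega>[of i "partial_deriv i P x"]
      by (subst has_integral_integrable_integral)
         (auto intro!: integrable_continuous_interval continuous_intros continuous_frame)
    then have "((\<lambda>\<phi>. \<Sum>i\<in>UNIV. complex_of_real (\<omega> \<phi> $ i) * partial_deriv i P x) has_integral (\<Sum>i\<in>UNIV. 0)) {0..2*pi}"
      using has_integral_sum[of UNIV "\<lambda>i \<phi>. complex_of_real (\<omega> \<phi> $ i) * partial_deriv i P x" "\<lambda>_. 0"] by simp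
    then show ?thesis
      unfolding I1_def dird_def by (simp add: pt_def pt'_def integral_unique)
  qed
  let ?p = "poly (legendre l)" and ?p' = "poly (pderiv (legendre l))" and ?p'' = "poly (pderiv (pderiv (legendre l)))"
  \<comment> \<open>\<open>g\<close> stands for the real and the imaginary part, since uniqueness is
    stated for real functions.\<close>
  have main: "g (cmean P \<theta>) = g (complex_of_real (2 * pi) * P x) * ?p (cos \<theta>)"
    if g: "bounded_linear g" and gr: "\<And>r z. g (complex_of_real r * z) = r * g z" for g :: "complex \<Rightarrow> real"
  proof -
    define c where "c = g (complex_of_real (2 * pi) * P x)"
    note gadd = bounded_linear.linear[OF g, THEN linear_add]
    have cos': "((\<lambda>\<theta>. poly q (cos \<theta>)) has_real_derivative poly (pderiv q) (cos \<theta>) * (- sin \<theta>)) (at \<theta>)" for q \<theta>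
      by (rule DERIV_chain2[OF poly_DERIV]) (auto intro!: derivative_eq_intros)
    have "(\<lambda>\<theta>. g (cmean P \<theta>) - c * ?p (cos \<theta>)) \<theta> = 0"
    proof (rule polar_ode_unique[OF _ _ _ _ _ _ \<theta>])
      fix \<theta> :: real
      have "((\<lambda>\<theta>. g (cmean P \<theta>)) has_real_derivative g (I1 \<theta>)) (at \<theta>)"
        using bounded_linear.has_vector_derivative[OF g d1] by (simp add: has_real_derivative_iff_has_vector_derivative)
      then show "((\<lambda>\<theta>. g (cmean P \<theta>) - c * ?p (cos \<theta>)) has_real_derivative
          g (I1 \<theta>) - c * (?p' (cos \<theta>) * (- sin \<theta>))) (at \<theta>)"
        by (intro DERIV_diff DERIV_cmult cos')
      have "((\<lambda>\<theta>. g (I1 \<theta>)) has_real_derivative g (I2 \<theta>)) (at \<theta>)"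
        using bounded_linear.has_vector_derivative[OF g d2] by (simp add: has_real_derivative_iff_has_vector_derivative)
      then show "((\<lambda>\<theta>. g (I1 \<theta>) - c * (?p' (cos \<theta>) * (- sin \<theta>))) has_real_derivative
          g (I2 \<theta>) - c * (?p'' (cos \<theta>) * (- sin \<theta>) * (- sin \<theta>) + (- cos \<theta>) * ?p' (cos \<theta>))) (at \<theta>)"
        by (intro DERIV_diff DERIV_cmult DERIV_mult cos') (auto intro!: derivative_eq_intros)
      have "sin \<theta> * g (I2 \<theta>) + cos \<theta> * g (I1 \<theta>) + real (l * (l + 1)) * sin \<theta> * g (cmean P \<theta>) = 0"
      proof -
        have "g (complex_of_real (sin \<theta>) * I2 \<theta> + complex_of_real (cos \<theta>) * I1 \<theta>
           + complex_of_real (real (l * (l + 1)) * sin \<theta>) * cmean P \<theta>) = g 0"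
          using cmean_ode[OF P, of \<theta>] by (simp only: I1_def I2_def of_real_mult of_real_of_nat_eq)
        then show ?thesis by (simp only: gadd gr bounded_linear.linear[OF g, THEN linear_0])
      qed
      moreover have "(1 - (cos \<theta>)\<^sup>2) * ?p'' (cos \<theta>) - 2 * cos \<theta> * ?p' (cos \<theta>) + real (l * (l + 1)) * ?p (cos \<theta>) = 0"
        by (rule legendre_ode)
      then have "c * sin \<theta> * ((sin \<theta>)\<^sup>2 * ?p'' (cos \<theta>) - 2 * cos \<theta> * ?p' (cos \<theta>) + real (l * (l + 1)) * ?p (cos \<theta>)) = 0"
        by (simp add: sin_squared_eq)
      ultimately show "sin \<theta> * (g (I2 \<theta>) - c * (?p'' (cos \<theta>) * (- sin \<theta>) * (- sin \<theta>) + (- cos \<theta>) * ?p' (cos \<theta>)))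
          + cos \<theta> * (g (I1 \<theta>) - c * (?p' (cos \<theta>) * (- sin \<theta>))) + real (l * (l + 1)) * sin \<theta> * (g (cmean P \<theta>) - c * ?p (cos \<theta>)) = 0"
        by (simp only: power2_eq_square) (simp add: algebra_simps)
    next
      show "g (cmean P 0) - c * ?p (cos 0) = 0" by (simp only: i0 c_def) (simp add: legendre_at_1)
      show "g (I1 0) - c * (?p' (cos 0) * - sin 0) = 0" by (simp add: i1 bounded_linear.linear[OF g, THEN linear_0])
    qed simp
    then show ?thesis by (simp add: c_def)
  qed
  show ?thesis
    using main[OF bounded_linear_Re] main[OF bounded_linear_Im]
    by (intro complex_eqI) (simp_all add: mult_ac)
qed

text \<open>Splitting y = cos \<theta> x + sin \<theta> \<omega> leaves a tangential part
  \<open>B\<close>. Its \<theta>-derivative is sin \<theta> times the mean of a combination of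
  rotated harmonics whose value at x is the surface gradient, so \<open>B\<close> is an integral of
  P_l, which is where \<open>legendre_quot\<close> comes from.\<close>

lemma cmean_moment:
  assumes P: "solid_harmonic l P" and l0: "l = 0 \<Longrightarrow> partial_deriv i P x = 0" and \<theta>: "0 \<le> \<theta>" "\<theta> < pi"
  shows "cmean (\<lambda>y. complex_of_real (y $ i) * P y) \<theta> =
    complex_of_real (2 * pi) * (complex_of_real (cos \<theta> * poly (legendre l) (cos \<theta>) * x $ i) * P x
      + complex_of_real (legendre_quot l (cos \<theta>)) * sgrad l P x $ i)"
proof -
  have cp: "cpoly P" using P by (simp add: solid_harmonic_def)
  define B where "B \<theta> = integral {0..2*pi} (\<lambda>\<phi>. complex_of_real (sin \<theta> * \<omega> \<phi> $ i) * P (pt \<theta> \<phi>))" for \<theta>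
  \<comment> \<open>A combination, with fixed coefficients x_j, of angular momentum operators
    applied to P; at y = x it is the i-th component of the surface gradient.\<close>
  define v where "v y = (\<Sum>j\<in>UNIV. complex_of_real (x $ j) * (complex_of_real (y $ j) * partial_deriv i P y - complex_of_real (y $ i) * partial_deriv j P y))" for y
  define V where "V = sgrad l P x $ i"
  let ?p = "poly (legendre l)"
  have cv: "cpoly v" unfolding v_def by (intro cpoly_intros cpoly_gradient cp)
  have v_eq: "v y = complex_of_real (x \<bullet> y) * partial_deriv i P y - complex_of_real (y $ i) * dird x P y" for y
    by (simp add: v_def dird_def inner_vec_def sum_subtractf sum_distrib_left sum_distrib_right algebra_simps)
  have cmv: "cmean v \<theta> = complex_of_real (2 * pi * ?p (cos \<theta>)) * V" if "0 \<le> \<theta>" "\<theta> < pi" for \<theta>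
  proof -
    have "cmean v \<theta> = (\<Sum>j\<in>UNIV. cmean (\<lambda>y. complex_of_real (x $ j) * (complex_of_real (y $ j) * partial_deriv i P y - complex_of_real (y $ i) * partial_deriv j P y)) \<theta>)"
      unfolding cmean_def v_def
      by (intro integral_sum) (auto intro!: cmean_integrable cpoly_intros cpoly_gradient cp)
    also have "\<dots> = (\<Sum>j\<in>UNIV. complex_of_real (x $ j) * (complex_of_real (2 * pi * ?p (cos \<theta>)) *
       (complex_of_real (x $ j) * partial_deriv i P x - complex_of_real (x $ i) * partial_deriv j P x)))"
      by (simp only: cmean_cmult cmean_harmonic[OF solid_harmonic_rotation[OF P] that])
    also have "\<dots> = complex_of_real (2 * pi * ?p (cos \<theta>)) * v x"
      unfolding v_def sum_distrib_left by (intro sum.cong refl) (simp only: mult_ac)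
    also have "v x = V"
      unfolding v_eq V_def sgrad_nth euler_pt[OF P] by (simp add: unit mult_ac)
    finally show ?thesis .
  qed
  have B': "(B has_vector_derivative complex_of_real (sin \<theta>) * cmean v \<theta>) (at \<theta>)" for \<theta>
  proof -
    define f' where "f' \<theta> \<phi> = complex_of_real (sin \<theta> * \<omega> \<phi> $ i) * dird (pt' \<theta> \<phi>) P (pt \<theta> \<phi>)
       + complex_of_real (cos \<theta> * \<omega> \<phi> $ i) * P (pt \<theta> \<phi>)" for \<theta> \<phi>
    have 1: "(B has_vector_derivative integral {0..2*pi} (f' \<theta>)) (at \<theta>)"
      unfolding B_def
    proof (rule leibniz_circle)
      fix \<theta> \<phi>
      have "((\<lambda>\<theta>. sin \<theta> * \<omega> \<phi> $ i) has_real_derivative cos \<theta> * \<omega> \<phi> $ i) (at \<theta>)"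
        by (auto intro!: derivative_eq_intros)
      from has_vector_derivative_mult[OF has_vector_derivative_of_real[OF this] dird_chain[OF cp pt_deriv]]
      show "((\<lambda>\<theta>. complex_of_real (sin \<theta> * \<omega> \<phi> $ i) * P (pt \<theta> \<phi>)) has_vector_derivative f' \<theta> \<phi>) (at \<theta>)"
        by (simp add: f'_def)
      show "continuous_on UNIV (\<lambda>z. f' (fst z) (snd z))"
        unfolding f'_def
        by (intro cont_intros continuous_on_of_real continuous_on_component continuous_on_sin continuous_on_cos cp continuous_cpoly_comp[OF cp])
      show "continuous_on UNIV (\<lambda>\<phi>. complex_of_real (sin \<theta> * \<omega> \<phi> $ i) * P (pt \<theta> \<phi>))"
        by (intro cont_intros continuous_on_of_real continuous_on_component continuous_on_sin continuous_on_cos cp continuous_cpoly_comp[OF cp])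
    qed
    \<comment> \<open>This \<phi>-derivative has mean zero and is exactly the amount by which the
      \<theta>-derivative of the integrand of \<open>B\<close> differs from sin \<theta>
      \<open>v\<close>.\<close>
    have der: "((\<lambda>\<phi>. - complex_of_real (cos \<theta>) * (complex_of_real (\<nu> \<phi> $ i) * P (pt \<theta> \<phi>))) has_vector_derivative
       - complex_of_real (cos \<theta>) * (complex_of_real (\<nu> \<phi> $ i) * dird (sin \<theta> *\<^sub>R \<nu> \<phi>) P (pt \<theta> \<phi>) + complex_of_real ((- \<omega> \<phi>) $ i) * P (pt \<theta> \<phi>))) (at \<phi>)" for \<phi>
      by (intro has_vector_derivative_mult_right has_vector_derivative_mult dird_chain cp pt_deriv_\<phi>
         bounded_linear.has_vector_derivative[OF _ \<nu>_deriv] bounded_linear_compose[OF bounded_linear_of_real bounded_linear_vec_nth])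
    have eq: "f' \<theta> \<phi> = complex_of_real (sin \<theta>) * v (pt \<theta> \<phi>) +
       - complex_of_real (cos \<theta>) * (complex_of_real (\<nu> \<phi> $ i) * dird (sin \<theta> *\<^sub>R \<nu> \<phi>) P (pt \<theta> \<phi>) + complex_of_real ((- \<omega> \<phi>) $ i) * P (pt \<theta> \<phi>))" for \<phi>
    proof -
      define S C w n X W N p where d: "S = complex_of_real (sin \<theta>)" "C = complex_of_real (cos \<theta>)"
        "w = complex_of_real (\<omega> \<phi> $ i)" "n = complex_of_real (\<nu> \<phi> $ i)"
        "X = dird x P (pt \<theta> \<phi>)" "W = dird (\<omega> \<phi>) P (pt \<theta> \<phi>)" "N = dird (\<nu> \<phi>) P (pt \<theta> \<phi>)" "p = P (pt \<theta> \<phi>)"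
      define xi where "xi = complex_of_real (x $ i)"
      have 1: "f' \<theta> \<phi> = S * w * (C * W - S * X) + C * w * p"
        unfolding f'_def d by (simp add: pt'_def dird_linear)
      have 2: "v (pt \<theta> \<phi>) = C * (xi * X + w * W + n * N) - (C * xi + S * w) * X"
        unfolding v_eq inner_pt dird_decomp[of i P "pt \<theta> \<phi>" \<phi>] d xi_def by (simp add: pt_def)
      have 3: "dird (sin \<theta> *\<^sub>R \<nu> \<phi>) P (pt \<theta> \<phi>) = S * N" by (simp only: dird_linear d)
      have 4: "complex_of_real ((- \<omega> \<phi>) $ i) = - w" by (simp add: d)
      show ?thesis
        unfolding 1 2 3 4 d(1,2,4,8)[symmetric] by (simp add: algebra_simps)
    qed
    have "((\<lambda>\<phi>. complex_of_real (sin \<theta>) * v (pt \<theta> \<phi>) +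
       - complex_of_real (cos \<theta>) * (complex_of_real (\<nu> \<phi> $ i) * dird (sin \<theta> *\<^sub>R \<nu> \<phi>) P (pt \<theta> \<phi>) + complex_of_real ((- \<omega> \<phi>) $ i) * P (pt \<theta> \<phi>)))
       has_integral (complex_of_real (sin \<theta>) * cmean v \<theta> +
       (- complex_of_real (cos \<theta>) * (complex_of_real (\<nu> (2 * pi) $ i) * P (pt \<theta> (2 * pi)))
        - (- complex_of_real (cos \<theta>) * (complex_of_real (\<nu> 0 $ i) * P (pt \<theta> 0)))))) {0..2*pi}"
      unfolding cmean_def
      by (intro has_integral_add has_integral_mult_right integrable_integral cmean_integrable[OF cv]
          fundamental_theorem_of_calculus has_vector_derivative_at_within[OF der]) simp
    then have "integral {0..2*pi} (f' \<theta>) = complex_of_real (sin \<theta>) * cmean v \<theta>"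
      unfolding eq[symmetric] periodic by (simp add: integral_unique)
    with 1 show ?thesis by simp
  qed
  have main: "B \<theta> = complex_of_real (2 * pi * legendre_quot l (cos \<theta>)) * V"
  proof -
    \<comment> \<open>On the half-open interval the closed form of the harmonic mean is available,
      and it contains the starting point 0.\<close>
    have "((\<lambda>s. B s - complex_of_real (2 * pi * legendre_quot l (cos s)) * V) has_vector_derivative 0) (at s within {0..<pi})"
      if "s \<in> {0..<pi}" for s
    proof (cases "l = 0")
      case True
      then have "V = 0" by (simp add: V_def sgrad_nth l0)
      then have "cmean v s = 0" using cmv[of s] that by simp
      then show ?thesis using has_vector_derivative_at_within[OF B'[of s]] \<open>V = 0\<close> by simp
    next
      case False
      have "((\<lambda>s. legendre_quot l (cos s)) has_real_derivative - ?p (cos s) * (- sin s)) (at s)"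
        by (rule DERIV_chain2[OF legendre_quot_deriv[OF False]]) (auto intro!: derivative_eq_intros)
      from DERIV_cmult[OF this, of "2 * pi"]
      have "((\<lambda>s. complex_of_real (2 * pi * legendre_quot l (cos s)) * V) has_vector_derivative
         complex_of_real (2 * pi * (- ?p (cos s) * (- sin s))) * V) (at s)"
        by (intro has_vector_derivative_mult_left has_vector_derivative_of_real)
      note diff = has_vector_derivative_at_within[OF has_vector_derivative_diff[OF B'[of s] this]]
      have "complex_of_real (sin s) * cmean v s - complex_of_real (2 * pi * (- ?p (cos s) * (- sin s))) * V = 0"
        using that by (simp add: cmv)
      with diff show ?thesis by (simp only:)
    qed
    then obtain c where c: "\<And>s. s \<in> {0..<pi} \<Longrightarrow> B s - complex_of_real (2 * pi * legendre_quot l (cos s)) * V = c"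
      by (rule has_vector_derivative_zero_constant[OF convex_real_interval(7), of 0 pi]) blast+
    \<comment> \<open>At \<theta> = 0 the factor sin annihilates \<open>B\<close>, and 1 - t^2
      annihilates the quotient.\<close>
    have "c = 0" using c[of 0] by (simp add: B_def legendre_quot_def)
    then show ?thesis using c[of \<theta>] \<theta> by simp
  qed
  have "cmean (\<lambda>y. complex_of_real (y $ i) * P y) \<theta> = integral {0..2*pi} (\<lambda>\<phi>.
      complex_of_real (cos \<theta> * x $ i) * P (pt \<theta> \<phi>) + complex_of_real (sin \<theta> * \<omega> \<phi> $ i) * P (pt \<theta> \<phi>))"
    unfolding cmean_def by (simp add: pt_def distrib_right)
  also have "\<dots> = complex_of_real (cos \<theta> * x $ i) * cmean P \<theta> + B \<theta>"
  proof -
    have "(\<lambda>\<phi>. complex_of_real (sin \<theta> * \<omega> \<phi> $ i) * P (pt \<theta> \<phi>)) integrable_on {0..2*pi}"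
      by (intro integrable_continuous_interval cont_intros continuous_on_of_real continuous_on_component cp continuous_cpoly_comp[OF cp])
    then show ?thesis
      unfolding B_def cmean_def
      by (intro integral_unique has_integral_add has_integral_mult_right integrable_integral cmean_integrable[OF cp])
  qed
  finally show ?thesis
    unfolding main cmean_harmonic[OF P \<theta>] V_def by (simp add: algebra_simps)
qed

text \<open>On the circle x \<bullet> \<nabla>u is -sin \<theta> times the meridian derivative, so
  the mean follows by differentiating the closed form of the harmonic mean. The chain rule supplies
  a second factor -sin \<theta>.\<close>

lemma cmean_sgrad_radial:
  assumes P: "solid_harmonic l P" and \<theta>: "0 < \<theta>" "\<theta> < pi"
  shows "cmean (\<lambda>y. cvec x \<bullet>\<^sub>c sgrad l P y) \<theta> =
    complex_of_real (2 * pi * ((1 - (cos \<theta>)\<^sup>2) * poly (pderiv (legendre l)) (cos \<theta>))) * P x"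
proof -
  have cp: "cpoly P" using P by (simp add: solid_harmonic_def)
  define I1 where "I1 = integral {0..2*pi} (\<lambda>\<phi>. dird (pt' \<theta> \<phi>) P (pt \<theta> \<phi>))"
  have "(cmean P has_vector_derivative I1) (at \<theta>)"
    unfolding I1_def by (rule cmean_deriv[OF cp])
  moreover have "((\<lambda>\<theta>. poly (legendre l) (cos \<theta>)) has_real_derivative poly (pderiv (legendre l)) (cos \<theta>) * (- sin \<theta>)) (at \<theta>)"
    by (rule DERIV_chain2[OF poly_DERIV]) (auto intro!: derivative_eq_intros)
  from DERIV_cmult[OF this, of "2 * pi"]
  have "((\<lambda>s. complex_of_real (2 * pi * poly (legendre l) (cos s)) * P x) has_vector_derivative
      complex_of_real (2 * pi * (poly (pderiv (legendre l)) (cos \<theta>) * (- sin \<theta>))) * P x) (at \<theta>)"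
    by (intro has_vector_derivative_mult_left has_vector_derivative_of_real)
  then have "(cmean P has_vector_derivative
      complex_of_real (2 * pi * (poly (pderiv (legendre l)) (cos \<theta>) * (- sin \<theta>))) * P x) (at \<theta>)"
    by (rule has_vector_derivative_transform_within_open[of _ _ _ "{0<..<pi}"])
       (use \<theta> in \<open>auto simp: cmean_harmonic[OF P]\<close>)
  ultimately have I1: "I1 = complex_of_real (2 * pi * (poly (pderiv (legendre l)) (cos \<theta>) * (- sin \<theta>))) * P x"
    by (rule vector_derivative_unique_at)
  have "cvec x \<bullet>\<^sub>c sgrad l P (pt \<theta> \<phi>) = - complex_of_real (sin \<theta>) * dird (pt' \<theta> \<phi>) P (pt \<theta> \<phi>)" for \<phi>
  proof -
    have "cvec x \<bullet>\<^sub>c sgrad l P y = dird x P y - complex_of_real (x \<bullet> y) * (of_nat l * P y)" for y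
      by (simp add: cdot_def sgrad_nth cvec_nth dird_def inner_vec_def sum_subtractf sum_distrib_right sum_distrib_left algebra_simps)
    moreover have "sin \<theta> *\<^sub>R pt' \<theta> \<phi> = cos \<theta> *\<^sub>R pt \<theta> \<phi> - x"
    proof -
      have "s * (c * q - s * p) = c * (c * p + s * q) - (c\<^sup>2 + s\<^sup>2) * p" for c s p q :: real
        by (simp add: power2_eq_square algebra_simps)
      from this[of "sin \<theta>" "cos \<theta>"] show ?thesis
        by (simp add: pt_def pt'_def vec_eq_iff)
    qed
    then have "complex_of_real (sin \<theta>) * dird (pt' \<theta> \<phi>) P (pt \<theta> \<phi>) = complex_of_real (cos \<theta>) * dird (pt \<theta> \<phi>) P (pt \<theta> \<phi>) - dird x P (pt \<theta> \<phi>)"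
      by (metis dird_linear(2,3))
    ultimately show ?thesis
      by (simp only: euler_pt[OF P] inner_pt) (simp add: algebra_simps)
  qed
  then have "cmean (\<lambda>y. cvec x \<bullet>\<^sub>c sgrad l P y) \<theta> = - complex_of_real (sin \<theta>) * I1"
    by (simp add: cmean_def I1_def)
  also have "\<dots> = complex_of_real (2 * pi * ((sin \<theta>)\<^sup>2 * poly (pderiv (legendre l)) (cos \<theta>))) * P x"
    unfolding I1 by (simp add: power2_eq_square)
  finally show ?thesis by (simp only: sin_squared_eq)
qed

text \<open>The term l P y of \<open>sgrad\<close> drops out because x \<times> y is orthogonal to
  y; the azimuthal component is thus a derivative along the circle.\<close>

lemma dot_cross_sgrad: "cvec (cross3 x y) \<bullet>\<^sub>c sgrad l P y = dird (cross3 x y) P y"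
  by (simp add: cdot_def sgrad_nth cvec_nth dird_def sum_3 cross3_nth algebra_simps)

lemma cmean_sgrad_azimuthal:
  assumes P: "cpoly P"
  shows "cmean (\<lambda>y. cvec (cross3 x y) \<bullet>\<^sub>c sgrad l P y) \<theta> = 0"
  unfolding dot_cross_sgrad by (rule cmean_rotation[OF P])

lemma rot_sgrad_nth:
  "(cvec y \<times>\<^sub>c sgrad l P y) $ 1 = complex_of_real (y $ 2) * partial_deriv 3 P y - complex_of_real (y $ 3) * partial_deriv 2 P y"
  "(cvec y \<times>\<^sub>c sgrad l P y) $ 2 = complex_of_real (y $ 3) * partial_deriv 1 P y - complex_of_real (y $ 1) * partial_deriv 3 P y"
  "(cvec y \<times>\<^sub>c sgrad l P y) $ 3 = complex_of_real (y $ 1) * partial_deriv 2 P y - complex_of_real (y $ 2) * partial_deriv 1 P y"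
  by (simp_all add: ccross_nth cvec_nth sgrad_nth algebra_simps)

text \<open>The term l P y of \<open>sgrad\<close> is annihilated by y \<times>, and what remains in
  each component is an angular momentum operator applied to P, hence a solid harmonic of the same
  degree.\<close>

lemma cmean_rot_sgrad:
  assumes P: "solid_harmonic l P" and \<theta>: "0 \<le> \<theta>" "\<theta> < pi"
  shows "cmean (\<lambda>y. (cvec y \<times>\<^sub>c sgrad l P y) $ i) \<theta> =
    complex_of_real (2 * pi * poly (legendre l) (cos \<theta>)) * (cvec x \<times>\<^sub>c sgrad l P x) $ i"
  using exhaust_3[of i] unfolding rot_sgrad_nth
  by (auto simp only: rot_sgrad_nth cmean_harmonic[OF solid_harmonic_rotation[OF P] \<theta>])

text \<open>Integration by parts along the circle: the derivative of y_k P along x \<times> y has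
  mean zero, and that of y_k is the k-th component of x \<times> y.\<close>

lemma cmean_cross_moment:
  assumes P: "cpoly P"
  shows "cmean (\<lambda>y. complex_of_real (y $ k) * dird (cross3 x y) P y) \<theta> =
    - cmean (\<lambda>y. complex_of_real (cross3 x y $ k) * P y) \<theta>"
proof -
  have "dird v (\<lambda>y. complex_of_real (y $ k) * P y) y = complex_of_real (y $ k) * dird v P y + complex_of_real (v $ k) * P y" for v y
  proof -
    have "dird v (\<lambda>y. complex_of_real (y $ k) * P y) y =
      (\<Sum>i\<in>UNIV. complex_of_real (y $ k) * (complex_of_real (v $ i) * partial_deriv i P y) + (if i = k then complex_of_real (v $ k) * P y else 0))"
      unfolding dird_def by (intro sum.cong refl) (simp add: partial_deriv_mult partial_deriv_coord cpoly_coord P algebra_simps)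
    then show ?thesis by (simp add: sum.distrib dird_def sum_distrib_left)
  qed
  then have "cmean (\<lambda>y. complex_of_real (y $ k) * dird (cross3 x y) P y + complex_of_real (cross3 x y $ k) * P y) \<theta> = 0"
    using cmean_rotation[of "\<lambda>y. complex_of_real (y $ k) * P y" \<theta>] P by (simp add: cpoly_intros)
  moreover have c: "cpoly (\<lambda>y. complex_of_real (cross3 x y $ j))" for j
    using exhaust_3[of j] by (auto simp: cross3_nth intro!: cpoly_intros)
  ultimately show ?thesis
    unfolding dird_def
    by (subst (asm) cmean_add) (auto intro!: cpoly_intros cpoly_gradient P simp: eq_neg_iff_add_eq_0)
qed

text \<open>Taking the cross product with x annihilates the radial part of the moment and leaves the
  quotient term.\<close>

lemma cmean_cross_harmonic:
  assumes P: "solid_harmonic l P" and l0: "\<And>i. l = 0 \<Longrightarrow> partial_deriv i P x = 0" and \<theta>: "0 \<le> \<theta>" "\<theta> < pi"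
  shows "cmean (\<lambda>y. complex_of_real (cross3 x y $ k) * P y) \<theta> =
    complex_of_real (2 * pi * legendre_quot l (cos \<theta>)) * (cvec x \<times>\<^sub>c sgrad l P x) $ k"
proof -
  have cp: "cpoly P" using P by (simp add: solid_harmonic_def)
  define Y where "Y j = cmean (\<lambda>y. complex_of_real (y $ j) * P y) \<theta>" for j
  have Y: "Y j = complex_of_real (2 * pi) * (complex_of_real (cos \<theta> * poly (legendre l) (cos \<theta>) * x $ j) * P x
      + complex_of_real (legendre_quot l (cos \<theta>)) * sgrad l P x $ j)" for j
    unfolding Y_def by (rule cmean_moment[OF P l0 \<theta>])
  have lin: "cmean (\<lambda>y. complex_of_real (r * y $ i - s * y $ j) * P y) \<theta> = complex_of_real r * Y i - complex_of_real s * Y j" for r s i j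
  proof -
    have "cmean (\<lambda>y. complex_of_real (r * y $ i - s * y $ j) * P y) \<theta> =
       cmean (\<lambda>y. complex_of_real r * (complex_of_real (y $ i) * P y) - complex_of_real s * (complex_of_real (y $ j) * P y)) \<theta>"
      by (simp add: algebra_simps)
    then show ?thesis by (simp add: cmean_diff cmean_cmult cpoly_intros cp Y_def)
  qed
  show ?thesis
    using exhaust_3[of k]
    by (elim disjE; hypsubst; simp only: cross3_nth lin ccross_nth cvec_nth Y; simp add: algebra_simps)
qed

text \<open>On the circle x \<times> \<nabla>u equals cos \<theta> (y \<times> \<nabla>u) minus y
  times the derivative of u along x \<times> y. The first term is a mean of harmonics, the second is
  integrated by parts.\<close>

lemma cmean_cross_sgrad:
  assumes P: "solid_harmonic l P" and l0: "\<And>i. l = 0 \<Longrightarrow> partial_deriv i P x = 0" and \<theta>: "0 \<le> \<theta>" "\<theta> < pi"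
  shows "cmean (\<lambda>y. (cvec x \<times>\<^sub>c sgrad l P y) $ k) \<theta> =
    complex_of_real (2 * pi * (cos \<theta> * poly (legendre l) (cos \<theta>) + legendre_quot l (cos \<theta>))) * (cvec x \<times>\<^sub>c sgrad l P x) $ k"
proof -
  have cp: "cpoly P" using P by (simp add: solid_harmonic_def)
  let ?t = "complex_of_real (cos \<theta>)"
  have "cmean (\<lambda>y. (cvec x \<times>\<^sub>c sgrad l P y) $ k) \<theta> = cmean (\<lambda>y. ?t * (cvec y \<times>\<^sub>c sgrad l P y) $ k - complex_of_real (y $ k) * dird (cross3 x y) P y) \<theta>"
  proof (rule cmean_cong)
    fix y assume y: "norm y = 1" "x \<bullet> y = cos \<theta>"
    have "cvec x \<times>\<^sub>c sgrad l P y = ?t *s (cvec y \<times>\<^sub>c sgrad l P y) - dird (cross3 x y) P y *s cvec y"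
      using ccross_tangent[of "cvec y" "sgrad l P y" "cvec x"] sgrad_tangent[OF P y(1)] y
      by (simp add: cdot_cvec norm_eq_1 flip: cvec_cross3 dot_cross_sgrad[of y l P])
    then show "(cvec x \<times>\<^sub>c sgrad l P y) $ k = ?t * (cvec y \<times>\<^sub>c sgrad l P y) $ k - complex_of_real (y $ k) * dird (cross3 x y) P y"
      by (simp add: cvec_nth mult.commute)
  qed
  also have "\<dots> = ?t * cmean (\<lambda>y. (cvec y \<times>\<^sub>c sgrad l P y) $ k) \<theta> + cmean (\<lambda>y. complex_of_real (cross3 x y $ k) * P y) \<theta>"
  proof -
    have "cpoly (\<lambda>y. (cvec y \<times>\<^sub>c sgrad l P y) $ k)"
      using exhaust_3[of k] by (auto simp: rot_sgrad_nth intro!: cpoly_intros cpoly_gradient cp)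
    moreover have "cpoly (\<lambda>y. complex_of_real (y $ k) * dird (cross3 x y) P y)"
      unfolding dird_def sum_3 cross3_nth of_real_diff of_real_mult by (intro cpoly_intros cpoly_gradient cp)
    ultimately show ?thesis
      by (simp add: cmean_diff cmean_cmult cpoly_intros cmean_cross_moment[OF cp])
  qed
  also have "cmean (\<lambda>y. complex_of_real (cross3 x y $ k) * P y) \<theta> =
      complex_of_real (2 * pi * legendre_quot l (cos \<theta>)) * (cvec x \<times>\<^sub>c sgrad l P x) $ k"
    by (rule cmean_cross_harmonic[OF P _ \<theta>]) (rule l0)
  finally show ?thesis
    unfolding cmean_rot_sgrad[OF P \<theta>] by (simp add: algebra_simps)
qed

text \<open>A vector is recovered from its component along x and its cross product with x, and the
  means of both are known.\<close>

lemma cmean_sgrad: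
  assumes P: "solid_harmonic l P" and l0: "\<And>i. l = 0 \<Longrightarrow> partial_deriv i P x = 0" and \<theta>: "0 < \<theta>" "\<theta> < pi"
  shows "cmean (\<lambda>y. sgrad l P y $ i) \<theta> =
    complex_of_real (2 * pi) * (complex_of_real ((1 - (cos \<theta>)\<^sup>2) * poly (pderiv (legendre l)) (cos \<theta>) * x $ i) * P x
     + complex_of_real (cos \<theta> * poly (legendre l) (cos \<theta>) + legendre_quot l (cos \<theta>)) * sgrad l P x $ i)"
proof -
  have cp: "cpoly P" using P by (simp add: solid_harmonic_def)
  note cs = cpoly_sgrad[OF cp, of l]
  let ?t = "complex_of_real (cos \<theta>)" and ?p = "complex_of_real (poly (legendre l) (cos \<theta>))"
    and ?q = "complex_of_real (legendre_quot l (cos \<theta>))"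
  define W where "W y = cvec x \<times>\<^sub>c sgrad l P y" for y
  define R where "R = cvec x \<times>\<^sub>c sgrad l P x"
  have cW: "cpoly (\<lambda>y. W y $ k)" for k
    using exhaust_3[of k] by (auto simp: W_def ccross_nth cvec_nth intro!: cpoly_intros cs)
  have mW: "cmean (\<lambda>y. W y $ k) \<theta> = complex_of_real (2 * pi) * (?t * ?p + ?q) * R $ k" for k
    unfolding W_def R_def using cmean_cross_sgrad[OF P l0, of \<theta> k] \<theta> by simp
  define N where "N y = cvec x \<bullet>\<^sub>c sgrad l P y" for y
  have cN: "cpoly N" unfolding N_def cdot_def cvec_nth by (intro cpoly_intros cs)
  have mN: "cmean N \<theta> = complex_of_real (2 * pi * ((1 - (cos \<theta>)\<^sup>2) * poly (pderiv (legendre l)) (cos \<theta>))) * P x"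
    unfolding N_def by (rule cmean_sgrad_radial[OF P \<theta>])
  have xx: "cvec x \<bullet>\<^sub>c cvec x = 1" by (simp add: cdot_cvec unit)
  have lin: "cmean (\<lambda>y. complex_of_real c * N y - (complex_of_real r * W y $ i - complex_of_real s * W y $ j)) \<theta> =
      complex_of_real c * cmean N \<theta> - (complex_of_real r * cmean (\<lambda>y. W y $ i) \<theta> - complex_of_real s * cmean (\<lambda>y. W y $ j) \<theta>)" for c r s i j
    by (simp add: cmean_diff cmean_cmult cpoly_intros cN cW)
  have "sgrad l P y = N y *s cvec x - cvec x \<times>\<^sub>c W y" for y
    unfolding N_def W_def by (rule ccross_double[OF xx])
  then have comp: "sgrad l P y $ k = complex_of_real (x $ k) * N y - (cvec x \<times>\<^sub>c W y) $ k" for y k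
    by (simp add: cvec_nth mult.commute)
  have "sgrad l P x = - (cvec x \<times>\<^sub>c R)"
    using ccross_double[OF xx, of "sgrad l P x"] sgrad_tangent[OF P, of x] unit by (simp add: R_def norm_eq_1)
  then have V: "sgrad l P x $ k = - (cvec x \<times>\<^sub>c R) $ k" for k by simp
  have "cmean (\<lambda>y. sgrad l P y $ i) \<theta> = cmean (\<lambda>y. complex_of_real (x $ i) * N y - (cvec x \<times>\<^sub>c W y) $ i) \<theta>"
    unfolding comp ..
  then show ?thesis
    unfolding V using exhaust_3[of i]
    by (elim disjE; hypsubst; simp only: ccross_nth cvec_nth lin mN mW; simp add: algebra_simps)
qed

end

section \<open>Rotation invariance of the surface measure\<close>

text \<open>Polar coordinates for an arbitrary triple instead of an orthonormal frame: the map is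
  linear in (x, a, b), so its derivative along a moving triple is again of this form.\<close>

definition sph :: "real^3 \<Rightarrow> real^3 \<Rightarrow> real^3 \<Rightarrow> real \<Rightarrow> real \<Rightarrow> real^3" where
  "sph x a b \<theta> \<phi> = cos \<theta> *\<^sub>R x + sin \<theta> *\<^sub>R (cos \<phi> *\<^sub>R a + sin \<phi> *\<^sub>R b)"

definition sph_\<theta> :: "real^3 \<Rightarrow> real^3 \<Rightarrow> real^3 \<Rightarrow> real \<Rightarrow> real \<Rightarrow> real^3" where
  "sph_\<theta> x a b \<theta> \<phi> = cos \<theta> *\<^sub>R (cos \<phi> *\<^sub>R a + sin \<phi> *\<^sub>R b) - sin \<theta> *\<^sub>R x"

definition sph_\<phi> :: "real^3 \<Rightarrow> real^3 \<Rightarrow> real^3 \<Rightarrow> real \<Rightarrow> real \<Rightarrow> real^3" where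
  "sph_\<phi> x a b \<theta> \<phi> = sin \<theta> *\<^sub>R (cos \<phi> *\<^sub>R b - sin \<phi> *\<^sub>R a)"

lemma sph_derivs:
  "((\<lambda>\<theta>. sph x a b \<theta> \<phi>) has_vector_derivative sph_\<theta> x a b \<theta> \<phi>) (at \<theta>)"
  "((\<lambda>\<phi>. sph x a b \<theta> \<phi>) has_vector_derivative sph_\<phi> x a b \<theta> \<phi>) (at \<phi>)"
  unfolding sph_def sph_\<theta>_def sph_\<phi>_def by (auto intro!: derivative_eq_intros)

lemma continuous_sph:
  fixes A :: "'z::t2_space set"
  assumes "continuous_on A x" "continuous_on A a" "continuous_on A b" "continuous_on A f" "continuous_on A g"
  shows "continuous_on A (\<lambda>z. sph (x z) (a z) (b z) (f z) (g z))"
    "continuous_on A (\<lambda>z. sph_\<theta> (x z) (a z) (b z) (f z) (g z))"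
    "continuous_on A (\<lambda>z. sph_\<phi> (x z) (a z) (b z) (f z) (g z))"
  unfolding sph_def sph_\<theta>_def sph_\<phi>_def
  by (intro continuous_intros continuous_on_cos continuous_on_sin assms)+

lemma spherical_coords_sph: "spherical_coords (\<theta>, \<phi>) = sph (axis 3 1) (axis 1 1) (axis 2 1) \<theta> \<phi>"
  by (simp add: spherical_coords_def sph_def vec_eq_iff forall_3 axis_def)

lemma integral_rectangle_swap:
  fixes f :: "real \<times> real \<Rightarrow> real"
  assumes "continuous_on (cbox (a, c) (b, d)) f"
  shows "integral (cbox (a, c) (b, d)) f = integral {a..b} (\<lambda>x. integral {c..d} (\<lambda>y. f (x, y)))"
    "integral (cbox (a, c) (b, d)) f = integral {c..d} (\<lambda>y. integral {a..b} (\<lambda>x. f (x, y)))"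
proof -
  show 1: "integral (cbox (a, c) (b, d)) f = integral {a..b} (\<lambda>x. integral {c..d} (\<lambda>y. f (x, y)))"
    using integral_prod_continuous[OF assms] by simp
  also have "\<dots> = integral {c..d} (\<lambda>y. integral {a..b} (\<lambda>x. f (x, y)))"
    using integral_swap_continuous[of a c b d "\<lambda>x y. f (x, y)"] assms by simp
  finally show "integral (cbox (a, c) (b, d)) f = integral {c..d} (\<lambda>y. integral {a..b} (\<lambda>x. f (x, y)))" .
qed

lemma integral_real_derivative:
  assumes "\<And>t. (f has_real_derivative f' t) (at t)" "a \<le> b"
  shows "integral {a..b} f' = f b - f a"
proof (intro integral_unique fundamental_theorem_of_calculus assms(2))
  show "(f has_vector_derivative f' t) (at t within {a..b})" for t
    using assms(1) unfolding has_real_derivative_iff_has_vector_derivative by (rule has_vector_derivative_at_within)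
qed

lemma zero_vector_derivative_const:
  fixes f :: "real \<Rightarrow> real"
  assumes "\<And>s. (f has_vector_derivative 0) (at s)"
  shows "f s = f 0"
  using assms unfolding has_real_derivative_iff_has_vector_derivative[symmetric]
  by (intro DERIV_isconst_all allI)

section \<open>Derivatives of surface integrals along rotations\<close>

locale smooth_fun =
  fixes F :: "real^3 \<Rightarrow> real" and G :: "3 \<Rightarrow> real^3 \<Rightarrow> real"
  assumes F_deriv: "(F has_derivative (\<lambda>v. \<Sum>i\<in>UNIV. v $ i * G i y)) (at y)"
    and G_cont: "continuous_on UNIV (G i)"
begin

definition dF where "dF v y = (\<Sum>i\<in>UNIV. v $ i * G i y)"

lemma dF_linear: "dF (v + w) y = dF v y + dF w y" "dF (v - w) y = dF v y - dF w y" "dF (c *\<^sub>R v) y = c * dF v y"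
  by (simp_all add: dF_def sum.distrib sum_subtractf sum_distrib_left distrib_right left_diff_distrib mult.assoc)

lemma F_chain:
  assumes "(p has_vector_derivative p') (at s)"
  shows "((\<lambda>s. F (p s)) has_real_derivative dF p' (p s)) (at s)"
proof -
  have "((\<lambda>s. F (p s)) has_derivative (\<lambda>h. \<Sum>i\<in>UNIV. (h *\<^sub>R p') $ i * G i (p s))) (at s)"
    using assms unfolding has_vector_derivative_def by (rule has_derivative_compose) (rule F_deriv)
  also have "(\<lambda>h. \<Sum>i\<in>UNIV. (h *\<^sub>R p') $ i * G i (p s)) = (*) (dF p' (p s))"
    by (simp add: dF_def fun_eq_iff sum_distrib_left mult_ac)
  finally show ?thesis by (simp add: has_field_derivative_def)
qed

lemma F_cont: "continuous_on A p \<Longrightarrow> continuous_on A (\<lambda>z. F (p z))"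
  by (rule continuous_on_compose2[of UNIV F])
     (auto intro!: continuous_at_imp_continuous_on has_derivative_continuous[OF F_deriv])

lemma dF_cont: "continuous_on A v \<Longrightarrow> continuous_on A p \<Longrightarrow> continuous_on A (\<lambda>z. dF (v z) (p z))"
  unfolding dF_def
  by (intro continuous_on_sum continuous_on_mult continuous_on_component continuous_on_compose2[OF G_cont]) auto

text \<open>The surface integral of F in the coordinates attached to (x, a, b); the triple is a
  parameter so that it can move along a rotation.\<close>

definition J where
  "J x a b = integral (cbox (0, 0) (pi, 2 * pi)) (\<lambda>z. sin (fst z) * F (sph x a b (fst z) (snd z)))"

lemma J_deriv:
  fixes x a b x' a' b' :: "real \<Rightarrow> real^3"
  assumes d: "\<And>s. (x has_vector_derivative x' s) (at s)" "\<And>s. (a has_vector_derivative a' s) (at s)"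
      "\<And>s. (b has_vector_derivative b' s) (at s)"
    and c: "continuous_on UNIV x'" "continuous_on UNIV a'" "continuous_on UNIV b'"
  shows "((\<lambda>s. J (x s) (a s) (b s)) has_vector_derivative
     integral (cbox (0, 0) (pi, 2 * pi)) (\<lambda>z. sin (fst z) * dF (sph (x' s) (a' s) (b' s) (fst z) (snd z)) (sph (x s) (a s) (b s) (fst z) (snd z)))) (at s)"
proof -
  have cont: "continuous_on UNIV x" "continuous_on UNIV a" "continuous_on UNIV b"
    using d by (meson has_vector_derivative_continuous continuous_at_imp_continuous_on)+
  have cc: "continuous_on (A :: 'z::t2_space set) f \<Longrightarrow> continuous_on A (\<lambda>z. x (f z))"
     "continuous_on A f \<Longrightarrow> continuous_on A (\<lambda>z. a (f z))" "continuous_on A f \<Longrightarrow> continuous_on A (\<lambda>z. b (f z))"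
     "continuous_on A f \<Longrightarrow> continuous_on A (\<lambda>z. x' (f z))"
     "continuous_on A f \<Longrightarrow> continuous_on A (\<lambda>z. a' (f z))" "continuous_on A f \<Longrightarrow> continuous_on A (\<lambda>z. b' (f z))" for A f
    using cont c by (auto intro: continuous_on_compose2)
  have "((\<lambda>s. integral (cbox (0, 0) (pi, 2 * pi)) (\<lambda>z. sin (fst z) * F (sph (x s) (a s) (b s) (fst z) (snd z)))) has_vector_derivative
     integral (cbox (0, 0) (pi, 2 * pi)) (\<lambda>z. sin (fst z) * dF (sph (x' s) (a' s) (b' s) (fst z) (snd z)) (sph (x s) (a s) (b s) (fst z) (snd z)))) (at s within UNIV)"
  proof (rule leibniz_rule_vector_derivative)
    fix s and z :: "real \<times> real"
    have "((\<lambda>s. sph (x s) (a s) (b s) (fst z) (snd z)) has_vector_derivative sph (x' s) (a' s) (b' s) (fst z) (snd z)) (at s)"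
      unfolding sph_def by (auto intro!: derivative_eq_intros d)
    from DERIV_cmult[OF F_chain[OF this], of "sin (fst z)"]
    show "((\<lambda>s. sin (fst z) * F (sph (x s) (a s) (b s) (fst z) (snd z))) has_vector_derivative
       sin (fst z) * dF (sph (x' s) (a' s) (b' s) (fst z) (snd z)) (sph (x s) (a s) (b s) (fst z) (snd z))) (at s within UNIV)"
      by (simp add: has_real_derivative_iff_has_vector_derivative)
  next
    show "(\<lambda>z. sin (fst z) * F (sph (x s) (a s) (b s) (fst z) (snd z))) integrable_on cbox (0, 0) (pi, 2 * pi)" for s
      by (intro integrable_continuous continuous_on_mult continuous_on_sin F_cont continuous_sph cc continuous_on_fst continuous_on_snd continuous_on_id continuous_on_const)
  next
    show "continuous_on (UNIV \<times> cbox (0, 0) (pi, 2 * pi))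
      (\<lambda>(s, z). sin (fst z) * dF (sph (x' s) (a' s) (b' s) (fst z) (snd z)) (sph (x s) (a s) (b s) (fst z) (snd z)))"
      unfolding split_beta
      by (intro continuous_on_mult continuous_on_sin dF_cont continuous_sph cc continuous_on_fst continuous_on_snd continuous_on_id continuous_on_const)
  qed auto
  then show ?thesis unfolding J_def by simp
qed

text \<open>Turning a and b only shifts the azimuth, so the derivative along the rotation is the
  integral of a \<phi>-derivative over a full period.\<close>

lemma J_rotate_azimuth:
  "J x (cos s *\<^sub>R a + sin s *\<^sub>R b) (cos s *\<^sub>R b - sin s *\<^sub>R a) = J x a b"
proof -
  define A where "A s = cos s *\<^sub>R a + sin s *\<^sub>R b" for s
  define B where "B s = cos s *\<^sub>R b - sin s *\<^sub>R a" for s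
  have dA: "(A has_vector_derivative B s) (at s)" and dB: "(B has_vector_derivative - A s) (at s)" for s
    unfolding A_def B_def by (auto intro!: derivative_eq_intros)
  have cA: "continuous_on UNIV A" "continuous_on UNIV B"
    unfolding A_def B_def by (intro continuous_intros)+
  have "((\<lambda>s. J x (A s) (B s)) has_vector_derivative 0) (at s)" for s
  proof -
    have z: "integral {0..2*pi} (\<lambda>\<phi>. sin \<theta> * dF (sph 0 (B s) (- A s) \<theta> \<phi>) (sph x (A s) (B s) \<theta> \<phi>)) = 0" for \<theta>
    proof -
      have e: "sph 0 (B s) (- A s) \<theta> \<phi> = sph_\<phi> x (A s) (B s) \<theta> \<phi>" for \<phi>
        by (simp add: sph_def sph_\<phi>_def)
      have "((\<lambda>\<phi>. sin \<theta> * F (sph x (A s) (B s) \<theta> \<phi>)) has_real_derivative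
          sin \<theta> * dF (sph_\<phi> x (A s) (B s) \<theta> \<phi>) (sph x (A s) (B s) \<theta> \<phi>)) (at \<phi>)" for \<phi>
        by (intro DERIV_cmult F_chain sph_derivs)
      then have "integral {0..2*pi} (\<lambda>\<phi>. sin \<theta> * dF (sph_\<phi> x (A s) (B s) \<theta> \<phi>) (sph x (A s) (B s) \<theta> \<phi>))
          = sin \<theta> * F (sph x (A s) (B s) \<theta> (2 * pi)) - sin \<theta> * F (sph x (A s) (B s) \<theta> 0)"
        by (rule integral_real_derivative) simp
      then show ?thesis unfolding e by (simp add: sph_def)
    qed
    have "integral (cbox (0, 0) (pi, 2 * pi)) (\<lambda>z. sin (fst z) * dF (sph 0 (B s) (- A s) (fst z) (snd z)) (sph x (A s) (B s) (fst z) (snd z)))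
      = integral {0..pi} (\<lambda>\<theta>. integral {0..2*pi} (\<lambda>\<phi>. sin \<theta> * dF (sph 0 (B s) (- A s) \<theta> \<phi>) (sph x (A s) (B s) \<theta> \<phi>)))"
      by (subst integral_rectangle_swap(1))
         (simp_all, intro continuous_on_mult continuous_on_sin dF_cont continuous_sph continuous_on_fst continuous_on_snd continuous_on_id continuous_on_const)
    also have "\<dots> = 0" unfolding z by simp
    finally show ?thesis
      using J_deriv[OF _ dA dB, of "\<lambda>_. x" "\<lambda>_. 0" s] cA by (simp add: continuous_on_minus)
  qed
  from zero_vector_derivative_const[of "\<lambda>s. J x (A s) (B s)", OF this]
  show ?thesis by (simp add: A_def B_def)
qed

text \<open>The derivative along this rotation is the divergence
  \<open>\<partial>\<^sub>\<theta>(sin \<theta> cos \<phi> F) - \<partial>\<^sub>\<phi>(cos \<theta> sin \<phi> F)\<close>.\<close>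

lemma J_rotate_polar:
  "J (cos s *\<^sub>R x + sin s *\<^sub>R a) (cos s *\<^sub>R a - sin s *\<^sub>R x) b = J x a b"
proof -
  define X where "X s = cos s *\<^sub>R x + sin s *\<^sub>R a" for s
  define A where "A s = cos s *\<^sub>R a - sin s *\<^sub>R x" for s
  have dX: "(X has_vector_derivative A s) (at s)" and dA: "(A has_vector_derivative - X s) (at s)" for s
    unfolding A_def X_def by (auto intro!: derivative_eq_intros)
  have cX: "continuous_on UNIV X" "continuous_on UNIV A"
    unfolding A_def X_def by (intro continuous_intros)+
  have "((\<lambda>s. J (X s) (A s) b) has_vector_derivative 0) (at s)" for s
  proof -
    define f where "f \<theta> \<phi> = F (sph (X s) (A s) b \<theta> \<phi>)" for \<theta> \<phi>
    define f\<^sub>\<theta> where "f\<^sub>\<theta> \<theta> \<phi> = dF (sph_\<theta> (X s) (A s) b \<theta> \<phi>) (sph (X s) (A s) b \<theta> \<phi>)" for \<theta> \<phi>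
    define f\<^sub>\<phi> where "f\<^sub>\<phi> \<theta> \<phi> = dF (sph_\<phi> (X s) (A s) b \<theta> \<phi>) (sph (X s) (A s) b \<theta> \<phi>)" for \<theta> \<phi>
    have fd: "((\<lambda>\<theta>. f \<theta> \<phi>) has_real_derivative f\<^sub>\<theta> \<theta> \<phi>) (at \<theta>)"
       "((\<lambda>\<phi>. f \<theta> \<phi>) has_real_derivative f\<^sub>\<phi> \<theta> \<phi>) (at \<phi>)" for \<theta> \<phi>
      unfolding f_def f\<^sub>\<theta>_def f\<^sub>\<phi>_def by (intro F_chain sph_derivs)+
    have fc: "continuous_on UNIV (\<lambda>z. f (fst z) (snd z))" "continuous_on UNIV (\<lambda>z. f\<^sub>\<theta> (fst z) (snd z))" "continuous_on UNIV (\<lambda>z. f\<^sub>\<phi> (fst z) (snd z))"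
      unfolding f_def f\<^sub>\<theta>_def f\<^sub>\<phi>_def
      by (intro F_cont dF_cont continuous_sph continuous_on_fst continuous_on_snd continuous_on_id continuous_on_const)+
    \<comment> \<open>\<open>U\<close> and \<open>W\<close> share the term cos \<theta> cos \<phi>
      f, which cancels in their difference; adding it turns each of them into a total
      derivative.\<close>
    define U where "U \<theta> \<phi> = cos \<theta> * cos \<phi> * f \<theta> \<phi> + sin \<theta> * cos \<phi> * f\<^sub>\<theta> \<theta> \<phi>" for \<theta> \<phi>
    define W where "W \<theta> \<phi> = cos \<theta> * cos \<phi> * f \<theta> \<phi> + cos \<theta> * sin \<phi> * f\<^sub>\<phi> \<theta> \<phi>" for \<theta> \<phi>
    have Uc: "continuous_on (cbox (0, 0) (pi, 2 * pi)) (\<lambda>z. U (fst z) (snd z))"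
      and Wc: "continuous_on (cbox (0, 0) (pi, 2 * pi)) (\<lambda>z. W (fst z) (snd z))"
      unfolding U_def W_def
      by (intro continuous_on_add continuous_on_mult continuous_on_sin continuous_on_cos continuous_on_fst continuous_on_snd continuous_on_id
            fc[THEN continuous_on_subset] subset_UNIV)+
    have eq: "sin \<theta> * dF (sph (A s) (- X s) 0 \<theta> \<phi>) (sph (X s) (A s) b \<theta> \<phi>) = U \<theta> \<phi> - W \<theta> \<phi>" for \<theta> \<phi>
    proof -
      have "sin \<theta> *\<^sub>R sph (A s) (- X s) 0 \<theta> \<phi> = (sin \<theta> * cos \<phi>) *\<^sub>R sph_\<theta> (X s) (A s) b \<theta> \<phi> - (cos \<theta> * sin \<phi>) *\<^sub>R sph_\<phi> (X s) (A s) b \<theta> \<phi>"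
      proof -
        have id: "S * (C * a1 - S * c * x1) = S * c * (C * (c * a1 + t * b1) - S * x1) - C * t * S * (c * b1 - t * a1)"
          if "c\<^sup>2 + t\<^sup>2 = 1" for S C c t a1 b1 x1 :: real
        proof -
          have "S * c * (C * (c * a1 + t * b1) - S * x1) - C * t * S * (c * b1 - t * a1) = S * C * a1 * (c\<^sup>2 + t\<^sup>2) - S * S * c * x1"
            by (simp add: power2_eq_square algebra_simps)
          then show ?thesis using that by (simp add: algebra_simps)
        qed
        show ?thesis
          unfolding vec_eq_iff
          by (simp add: sph_def sph_\<theta>_def sph_\<phi>_def id[of "cos \<phi>" "sin \<phi>" "sin \<theta>" "cos \<theta>"])
      qed
      then have "dF (sin \<theta> *\<^sub>R sph (A s) (- X s) 0 \<theta> \<phi>) (sph (X s) (A s) b \<theta> \<phi>)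
         = (sin \<theta> * cos \<phi>) * f\<^sub>\<theta> \<theta> \<phi> - (cos \<theta> * sin \<phi>) * f\<^sub>\<phi> \<theta> \<phi>"
        by (simp only: dF_linear f\<^sub>\<theta>_def f\<^sub>\<phi>_def)
      then show ?thesis by (simp add: dF_linear U_def W_def)
    qed
    have U0: "integral {0..pi} (\<lambda>\<theta>. U \<theta> \<phi>) = 0" for \<phi>
    proof -
      have "((\<lambda>\<theta>. sin \<theta> * cos \<phi> * f \<theta> \<phi>) has_real_derivative U \<theta> \<phi>) (at \<theta>)" for \<theta>
        unfolding U_def by (auto intro!: derivative_eq_intros fd)
      from integral_real_derivative[of _ "\<lambda>\<theta>. U \<theta> \<phi>", OF this, of 0 pi] show ?thesis by simp
    qed
    have W0: "integral {0..2*pi} (\<lambda>\<phi>. W \<theta> \<phi>) = 0" for \<theta>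
    proof -
      have "((\<lambda>\<phi>. cos \<theta> * sin \<phi> * f \<theta> \<phi>) has_real_derivative W \<theta> \<phi>) (at \<phi>)" for \<phi>
        unfolding W_def by (auto intro!: derivative_eq_intros fd)
      from integral_real_derivative[of _ "\<lambda>\<phi>. W \<theta> \<phi>", OF this, of 0 "2 * pi"] show ?thesis by simp
    qed
    have "integral (cbox (0, 0) (pi, 2 * pi)) (\<lambda>z. U (fst z) (snd z) - W (fst z) (snd z)) = 0"
      using integral_rectangle_swap(2)[OF Uc] integral_rectangle_swap(1)[OF Wc] U0 W0
      by (subst integral_diff) (auto intro!: integrable_continuous Uc Wc)
    then show ?thesis
      using J_deriv[OF dX dA, of "\<lambda>_. b" "\<lambda>_. 0" s] cX by (simp add: continuous_on_minus eq)
  qed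
  from zero_vector_derivative_const[of "\<lambda>s. J (X s) (A s) b", OF this]
  show ?thesis by (simp add: A_def X_def)
qed

end

section \<open>Smoothed indicators of orthants as test functions\<close>

definition soft_step :: "real \<Rightarrow> real \<Rightarrow> real" where
  "soft_step \<epsilon> t = smooth_ramp \<epsilon> t / (\<epsilon> + smooth_ramp \<epsilon> t)"

definition soft_step' :: "real \<Rightarrow> real \<Rightarrow> real" where
  "soft_step' \<epsilon> t = smooth_ramp' \<epsilon> t * \<epsilon> / (\<epsilon> + smooth_ramp \<epsilon> t)\<^sup>2"

lemma smooth_ramp_nonneg: "0 < \<epsilon> \<Longrightarrow> 0 \<le> smooth_ramp \<epsilon> t"
  by (simp add: smooth_ramp_def)

lemma soft_step_deriv:
  assumes "0 < \<epsilon>"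
  shows "(soft_step \<epsilon> has_real_derivative soft_step' \<epsilon> t) (at t)"
proof -
  have nz: "\<epsilon> + smooth_ramp \<epsilon> t \<noteq> 0" using assms smooth_ramp_nonneg[OF assms, of t] by linarith
  have "((\<lambda>t. \<epsilon> + smooth_ramp \<epsilon> t) has_real_derivative smooth_ramp' \<epsilon> t) (at t)"
    by (auto intro!: derivative_eq_intros smooth_ramp_deriv[OF assms])
  from DERIV_divide[OF smooth_ramp_deriv[OF assms] this nz]
  show ?thesis
    unfolding soft_step_def[abs_def] soft_step'_def power2_eq_square
    by (rule back_subst[of "\<lambda>d. (_ has_real_derivative d) _"]) (simp add: algebra_simps)
qed

lemma soft_step'_continuous:
  assumes "0 < \<epsilon>"
  shows "continuous_on UNIV (soft_step' \<epsilon>)"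
proof -
  have "continuous_on UNIV (smooth_ramp \<epsilon>)"
    using smooth_ramp_deriv[OF assms] by (meson DERIV_isCont continuous_at_imp_continuous_on)
  moreover have "\<epsilon> + smooth_ramp \<epsilon> t \<noteq> 0" for t using assms smooth_ramp_nonneg[OF assms, of t] by linarith
  ultimately show ?thesis
    unfolding soft_step'_def by (intro continuous_intros smooth_ramp'_continuous assms) auto
qed

lemma soft_step_bounds: "0 < \<epsilon> \<Longrightarrow> 0 \<le> soft_step \<epsilon> t" "0 < \<epsilon> \<Longrightarrow> soft_step \<epsilon> t \<le> 1"
  using smooth_ramp_nonneg[of \<epsilon> t] by (simp_all add: soft_step_def divide_le_eq_1)

lemma soft_step_tendsto:
  "(\<lambda>n. soft_step (1 / real (Suc n)) t) \<longlonglongrightarrow> (if 0 < t then 1 else 0)"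
proof (cases "0 < t")
  case True
  have e: "(\<lambda>n. 1 / real (Suc n)) \<longlonglongrightarrow> 0" by (rule LIMSEQ_Suc[OF lim_1_over_n])
  have "(\<lambda>n. soft_step (1 / real (Suc n)) t) \<longlonglongrightarrow> t / (0 + t)"
    unfolding soft_step_def using True by (intro tendsto_intros e smooth_ramp_tendsto) auto
  then show ?thesis using True by simp
next
  case False
  have "smooth_ramp (1 / real (Suc n)) t = 0" for n
  proof -
    have "t - 1 / real (Suc n) \<le> t" by simp
    then have "t - 1 / real (Suc n) \<le> 0" using False by linarith
    then show ?thesis by (simp only: smooth_ramp_def max_absorb1) simp
  qed
  then show ?thesis using False by (simp add: soft_step_def)
qed

text \<open>As \<epsilon> tends to 0 this converges to the indicator of the open orthant above c.
  Orthants generate the Borel sets, while the differentiation of \<open>J\<close> asks for C^1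
  functions.\<close>

definition corner :: "real \<Rightarrow> real^3 \<Rightarrow> real^3 \<Rightarrow> real" where
  "corner \<epsilon> c y = soft_step \<epsilon> (y $ 1 - c $ 1) * (soft_step \<epsilon> (y $ 2 - c $ 2) * soft_step \<epsilon> (y $ 3 - c $ 3))"

definition corner_grad :: "real \<Rightarrow> real^3 \<Rightarrow> 3 \<Rightarrow> real^3 \<Rightarrow> real" where
  "corner_grad \<epsilon> c i y = soft_step' \<epsilon> (y $ i - c $ i) *
     (if i = 1 then soft_step \<epsilon> (y $ 2 - c $ 2) * soft_step \<epsilon> (y $ 3 - c $ 3)
      else if i = 2 then soft_step \<epsilon> (y $ 1 - c $ 1) * soft_step \<epsilon> (y $ 3 - c $ 3)
      else soft_step \<epsilon> (y $ 1 - c $ 1) * soft_step \<epsilon> (y $ 2 - c $ 2))"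

lemma corner_smooth:
  assumes "0 < \<epsilon>"
  shows "smooth_fun (corner \<epsilon> c) (corner_grad \<epsilon> c)"
proof
  have comp: "((\<lambda>y. soft_step \<epsilon> (y $ i - c $ i)) has_derivative (\<lambda>v. v $ i * soft_step' \<epsilon> (y $ i - c $ i))) (at y)" for i y
  proof -
    have "((\<lambda>y. y $ i - c $ i) has_derivative (\<lambda>v. v $ i - 0)) (at y)"
      by (intro has_derivative_diff has_derivative_const bounded_linear_imp_has_derivative bounded_linear_vec_nth)
    then have "((\<lambda>y. soft_step \<epsilon> (y $ i - c $ i)) has_derivative (\<lambda>v. soft_step' \<epsilon> (y $ i - c $ i) * (v $ i - 0))) (at y)"
      by (rule has_derivative_compose) (rule soft_step_deriv[OF assms, unfolded has_field_derivative_def])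
    then show ?thesis by (simp add: mult.commute)
  qed
  show "(corner \<epsilon> c has_derivative (\<lambda>v. \<Sum>i\<in>UNIV. v $ i * corner_grad \<epsilon> c i y)) (at y)" for y
    unfolding corner_def[abs_def] corner_grad_def
    by (rule has_derivative_eq_rhs[OF has_derivative_mult[OF comp has_derivative_mult[OF comp comp]]])
       (simp add: sum_3 fun_eq_iff algebra_simps)
  have c: "continuous_on UNIV (\<lambda>y. soft_step \<epsilon> (y $ i - c $ i))" for i
    using comp by (meson has_derivative_continuous continuous_at_imp_continuous_on)
  have c': "continuous_on UNIV (\<lambda>y. soft_step' \<epsilon> (y $ i - c $ i))" for i
    by (rule continuous_on_compose2[OF soft_step'_continuous[OF assms]]) (auto intro!: continuous_intros)
  show "continuous_on UNIV (corner_grad \<epsilon> c i)" for i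
    unfolding corner_grad_def[abs_def]
    by (cases "i = 1"; cases "i = 2"; simp) (intro continuous_on_mult c c')+
qed

lemma continuous_corner: "0 < \<epsilon> \<Longrightarrow> continuous_on UNIV (corner \<epsilon> c)"
  using smooth_fun.F_cont[OF corner_smooth, of \<epsilon> UNIV "\<lambda>y. y" c] by simp

section \<open>The surface measure in rotated coordinates\<close>

definition sph_weight :: "real \<times> real \<Rightarrow> real" where
  "sph_weight z = indicator ({0..pi} \<times> {0..<2*pi}) z * sin (fst z)"

lemma sph_weight_nonneg: "0 \<le> sph_weight z"
  by (cases z) (auto simp: sph_weight_def indicator_def sin_ge_zero)

lemma sph_weight_measurable [measurable]: "sph_weight \<in> borel_measurable borel"
  unfolding sph_weight_def by (intro borel_measurable_times borel_measurable_indicator)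
    (auto intro!: borel_measurable_continuous_onI continuous_intros simp flip: borel_prod)

lemma sph_measurable [measurable]: "(\<lambda>z. sph x a b (fst z) (snd z)) \<in> borel_measurable borel"
  by (intro borel_measurable_continuous_onI continuous_sph continuous_on_fst continuous_on_snd continuous_on_id continuous_on_const)

lemma sph_density: "density lborel (\<lambda>(\<theta>, \<phi>). indicator ({0..pi} \<times> {0..<2*pi}) (\<theta>, \<phi>) * ennreal (sin \<theta>))
    = density lborel (\<lambda>z. ennreal (sph_weight z))"
proof -
  have "(\<lambda>(\<theta>, \<phi>). indicator ({0..pi} \<times> {0..<2*pi}) (\<theta>, \<phi>) * ennreal (sin \<theta>)) = (\<lambda>z. ennreal (sph_weight z))"
    by (auto simp: fun_eq_iff sph_weight_def indicator_def)
  then show ?thesis by simp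
qed

lemma integral_sph_weight:
  fixes g :: "real \<times> real \<Rightarrow> real"
  assumes g: "continuous_on UNIV g"
  shows "integrable lborel (\<lambda>z. sph_weight z * g z)"
    and "(LINT z|lborel. sph_weight z * g z) = integral (cbox (0, 0) (pi, 2 * pi)) (\<lambda>z. sin (fst z) * g z)"
proof -
  have c: "continuous_on (cbox (0, 0) (pi, 2 * pi)) (\<lambda>z. sin (fst z) * g z)"
    by (intro continuous_intros continuous_on_sin continuous_on_subset[OF g]) auto
  have i: "set_integrable lborel (cbox (0, 0) (pi, 2 * pi)) (\<lambda>z. sin (fst z) * g z)"
    by (rule borel_integrable_compact[OF compact_cbox c, folded set_integrable_def])
  have 1: "(LINT z:cbox (0, 0) (pi, 2 * pi)|lborel. sin (fst z) * g z) = integral (cbox (0, 0) (pi, 2 * pi)) (\<lambda>z. sin (fst z) * g z)"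
    by (rule set_borel_integral_eq_integral(2)[OF i])
  \<comment> \<open>The weight lives on a half-open range of azimuths and the box is closed; they
    differ by the null line \<phi> = 2 pi.\<close>
  have N: "UNIV \<times> {2 * pi} \<in> null_sets (lborel :: (real \<times> real) measure)"
  proof -
    have "negligible {z :: real \<times> real. z \<bullet> (0, 1) = 2 * pi}"
      by (rule negligible_standard_hyperplane) (simp add: Basis_prod_def)
    moreover have "{z :: real \<times> real. z \<bullet> (0, 1) = 2 * pi} = UNIV \<times> {2 * pi}" by auto
    ultimately have "UNIV \<times> {2 * pi} \<in> null_sets (lebesgue :: (real \<times> real) measure)"
      by (simp add: negligible_iff_null_sets)
    moreover have "UNIV \<times> {2 * pi} \<in> sets (borel :: (real \<times> real) measure)"
      by (intro borel_closed closed_Times) auto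
    ultimately show ?thesis by (simp add: null_sets_completion_iff)
  qed
  have ae: "AE z in lborel. indicator (cbox (0, 0) (pi, 2 * pi)) z *\<^sub>R (sin (fst z) * g z) = sph_weight z * g z"
    by (rule AE_I'[OF N]) (auto simp: sph_weight_def indicator_def split: if_splits)
  have m: "(\<lambda>z. sph_weight z * g z) \<in> borel_measurable lborel"
    using borel_measurable_continuous_onI[OF g] sph_weight_measurable by simp
  show "integrable lborel (\<lambda>z. sph_weight z * g z)"
    using i unfolding set_integrable_def
    by (rule integrable_cong_AE_imp) (use m ae in auto)
  show "(LINT z|lborel. sph_weight z * g z) = integral (cbox (0, 0) (pi, 2 * pi)) (\<lambda>z. sin (fst z) * g z)"
    unfolding 1[symmetric] set_lebesgue_integral_def
    by (rule integral_cong_AE) (use m ae i in \<open>auto simp: set_integrable_def\<close>)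
qed

text \<open>In contrast to \<Omega> it is a measure on all of R^3, where orthants serve as a
  generator. Rotation invariance becomes the statement that rotated frames give the same
  measure.\<close>

definition sph_measure :: "real^3 \<Rightarrow> real^3 \<Rightarrow> real^3 \<Rightarrow> (real^3) measure" where
  "sph_measure x a b = distr (density lborel (\<lambda>z. ennreal (sph_weight z))) borel (\<lambda>z. sph x a b (fst z) (snd z))"

lemma finite_sph_measure: "finite_measure (sph_measure x a b)"
proof (rule finite_measureI)
  have "emeasure (sph_measure x a b) (space (sph_measure x a b)) = (\<integral>\<^sup>+z. ennreal (sph_weight z) \<partial>lborel)"
    by (simp add: sph_measure_def emeasure_distr emeasure_density)
  also have "\<dots> = ennreal (LINT z|lborel. sph_weight z)"
    using integral_sph_weight(1)[of "\<lambda>_. 1"] by (intro nn_integral_eq_integral) (auto simp: sph_weight_nonneg)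
  finally show "emeasure (sph_measure x a b) (space (sph_measure x a b)) \<noteq> \<infinity>" by simp
qed

lemma integral_sph_measure_corner:
  assumes "0 < \<epsilon>"
  shows "integral\<^sup>L (sph_measure x a b) (corner \<epsilon> c) = smooth_fun.J (corner \<epsilon> c) x a b"
proof -
  interpret smooth_fun "corner \<epsilon> c" "corner_grad \<epsilon> c" by (rule corner_smooth[OF assms])
  have m: "corner \<epsilon> c \<in> borel_measurable borel"
    by (rule borel_measurable_continuous_onI[OF continuous_corner[OF assms]])
  have "integral\<^sup>L (sph_measure x a b) (corner \<epsilon> c) = (LINT z|lborel. sph_weight z * corner \<epsilon> c (sph x a b (fst z) (snd z)))"
    unfolding sph_measure_def
    by (subst integral_distr[OF _ m], simp, subst integral_density)
       (auto intro!: measurable_compose[OF _ m] sph_measurable simp: sph_weight_nonneg)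
  also have "\<dots> = J x a b"
    unfolding J_def
    by (intro integral_sph_weight(2) F_cont continuous_sph continuous_on_fst continuous_on_snd continuous_on_id continuous_on_const)
  finally show ?thesis .
qed

lemma sph_measure_corner_tendsto:
  "(\<lambda>n. integral\<^sup>L (sph_measure x a b) (corner (1 / real (Suc n)) c)) \<longlonglongrightarrow> measure (sph_measure x a b) {y. eucl_less c y}"
proof -
  interpret finite_measure "sph_measure x a b" by (rule finite_sph_measure)
  have S: "{y. eucl_less c y} = {y. c $ 1 < y $ 1 \<and> c $ 2 < y $ 2 \<and> c $ 3 < y $ 3}"
    by (auto simp: eucl_less_def Basis_vec_def inner_axis forall_3)
  have Sm: "{y. eucl_less c y} \<in> sets borel"
    unfolding S by (intro borel_open open_Collect_conj open_Collect_less continuous_intros)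
  have "(\<lambda>n. integral\<^sup>L (sph_measure x a b) (corner (1 / real (Suc n)) c)) \<longlonglongrightarrow> integral\<^sup>L (sph_measure x a b) (indicator {y. eucl_less c y})"
  proof (rule integral_dominated_convergence[where w = "\<lambda>_. 1"])
    show "AE y in sph_measure x a b. (\<lambda>n. corner (1 / real (Suc n)) c y) \<longlonglongrightarrow> indicator {y. eucl_less c y} y"
    proof (rule AE_I2)
      fix y
      have "(\<lambda>n. corner (1 / real (Suc n)) c y) \<longlonglongrightarrow>
         (if 0 < y $ 1 - c $ 1 then 1 else 0) * ((if 0 < y $ 2 - c $ 2 then 1 else 0) * (if 0 < y $ 3 - c $ 3 then 1 else 0))"
        unfolding corner_def by (intro tendsto_mult soft_step_tendsto)
      also have "(if 0 < y $ 1 - c $ 1 then 1 else 0) * ((if 0 < y $ 2 - c $ 2 then 1 else 0) * (if 0 < y $ 3 - c $ 3 then 1 else 0))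
         = (indicator {y. eucl_less c y} y :: real)"
        unfolding S indicator_def by simp
      finally show "(\<lambda>n. corner (1 / real (Suc n)) c y) \<longlonglongrightarrow> indicator {y. eucl_less c y} y" .
    qed
    show "AE y in sph_measure x a b. norm (corner (1 / real (Suc n)) c y) \<le> 1" for n
    proof (rule AE_I2)
      fix y
      note b = soft_step_bounds[of "1 / real (Suc n)"]
      have "0 \<le> corner (1 / real (Suc n)) c y" "corner (1 / real (Suc n)) c y \<le> 1"
        unfolding corner_def by (intro mult_nonneg_nonneg mult_le_one b; simp)+
      then show "norm (corner (1 / real (Suc n)) c y) \<le> 1" by simp
    qed
    show "corner (1 / real (Suc n)) c \<in> borel_measurable (sph_measure x a b)" for n
      using borel_measurable_continuous_onI[OF continuous_corner] by (simp add: sph_measure_def)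
    show "integrable (sph_measure x a b) (\<lambda>_. 1 :: real)" by simp
  qed (use Sm in \<open>auto simp: sph_measure_def\<close>)
  then show ?thesis using Sm by (simp add: sph_measure_def)
qed

text \<open>Letting \<epsilon> tend to 0 transfers the equality of \<open>J\<close> to open
  orthants. These are stable under intersection, by maxima of the corners, and generate the Borel
  sets, so the two finite measures agree.\<close>

lemma sph_measure_eqI:
  assumes "\<And>\<epsilon> c. 0 < \<epsilon> \<Longrightarrow> smooth_fun.J (corner \<epsilon> c) x a b = smooth_fun.J (corner \<epsilon> c) x' a' b'"
  shows "sph_measure x a b = sph_measure x' a' b'"
proof (rule measure_eqI_generator_eq[where E = "range (\<lambda>c. {y. eucl_less c y})" and \<Omega> = UNIV and A = "\<lambda>n. {y. eucl_less (\<chi> i. - real n) y}"])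
  interpret A: finite_measure "sph_measure x a b" by (rule finite_sph_measure)
  interpret B: finite_measure "sph_measure x' a' b'" by (rule finite_sph_measure)
  have S: "{y. eucl_less c y} = {y :: real^3. \<forall>i. c $ i < y $ i}" for c
    by (auto simp: eucl_less_def Basis_vec_def inner_axis)
  show "Int_stable (range (\<lambda>c :: real^3. {y. eucl_less c y}))"
    unfolding Int_stable_def
  proof clarify
    fix c d :: "real^3"
    have "{y. eucl_less c y} \<inter> {y. eucl_less d y} = {y. eucl_less (\<chi> i. max (c $ i) (d $ i)) y}"
      unfolding S by auto
    then show "{y. eucl_less c y} \<inter> {y. eucl_less d y} \<in> range (\<lambda>c. {y. eucl_less c y})" by blast
  qed
  fix X assume "X \<in> range (\<lambda>c :: real^3. {y. eucl_less c y})"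
  then obtain c :: "real^3" where X: "X = {y. eucl_less c y}" by auto
  have "(\<lambda>n. integral\<^sup>L (sph_measure x a b) (corner (1 / real (Suc n)) c)) \<longlonglongrightarrow> measure (sph_measure x' a' b') X"
    using sph_measure_corner_tendsto[of x' a' b' c] assms[of "1 / real (Suc _)" c]
    by (simp add: integral_sph_measure_corner X)
  then have "measure (sph_measure x a b) X = measure (sph_measure x' a' b') X"
    using sph_measure_corner_tendsto[of x a b c] unfolding X by (rule LIMSEQ_unique[rotated])
  then show "emeasure (sph_measure x a b) X = emeasure (sph_measure x' a' b') X"
    by (simp add: A.emeasure_eq_measure B.emeasure_eq_measure)
next
  interpret A: finite_measure "sph_measure x a b" by (rule finite_sph_measure)
  show "sets (sph_measure x a b) = sigma_sets UNIV (range (\<lambda>c. {y. eucl_less c y}))"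
    "sets (sph_measure x' a' b') = sigma_sets UNIV (range (\<lambda>c. {y. eucl_less c y}))"
    by (simp_all add: sph_measure_def borel_eq_greaterThan)
  show "(\<Union>n. {y :: real^3. eucl_less (\<chi> i. - real n) y}) = UNIV"
  proof (intro set_eqI iffI UNIV_I)
    fix y :: "real^3"
    obtain n where n: "norm y < real n" using reals_Archimedean2 by blast
    have "- real n < y $ i" for i
      using n component_le_norm_cart[of y i] by linarith
    then show "y \<in> (\<Union>n. {y. eucl_less (\<chi> i. - real n) y})"
      by (auto simp: eucl_less_def Basis_vec_def inner_axis)
  qed
  show "emeasure (sph_measure x a b) {y. eucl_less (\<chi> i. - real n) y} \<noteq> \<infinity>" for n by simp
qed auto

text \<open>A rotation by \<phi> about the third axis, followed by one by \<theta> that tilts this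
  axis, carries the standard frame to one with pole x; both leave the measure unchanged.\<close>

lemma polar_frame_ex:
  assumes "x \<in> S2"
  obtains a b where "frame x a b" "sph_measure x a b = sph_measure (axis 3 1) (axis 1 1) (axis 2 1)"
proof -
  have n: "(x $ 1)\<^sup>2 + (x $ 2)\<^sup>2 + (x $ 3)\<^sup>2 = 1"
    using assms by (simp add: norm_eq_1 inner_vec_def sum_3 power2_eq_square)
  define \<theta> where "\<theta> = arccos (x $ 3)"
  have "(x $ 3)\<^sup>2 \<le> 1" using n zero_le_power2[of "x $ 1"] zero_le_power2[of "x $ 2"] by linarith
  then have x3: "\<bar>x $ 3\<bar> \<le> 1" by (simp add: abs_square_le_1)
  then have c: "cos \<theta> = x $ 3" by (simp add: \<theta>_def cos_arccos_abs)
  have s: "(x $ 1)\<^sup>2 + (x $ 2)\<^sup>2 = (sin \<theta>)\<^sup>2"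
    using n by (simp add: sin_squared_eq c)
  obtain \<phi> where p: "x $ 1 = sin \<theta> * cos \<phi>" "x $ 2 = sin \<theta> * sin \<phi>"
  \<comment> \<open>At the two poles both horizontal components are 0 and any azimuth would do; 0 is
    taken.\<close>
  proof (cases "sin \<theta> = 0")
    case True
    then show ?thesis using s that[of 0] by (simp add: sum_power2_eq_zero_iff)
  next
    case False
    then have "(x $ 1 / sin \<theta>)\<^sup>2 + (x $ 2 / sin \<theta>)\<^sup>2 = 1"
      using s by (simp add: power_divide add_divide_distrib[symmetric])
    then obtain t where "x $ 1 / sin \<theta> = cos t" "x $ 2 / sin \<theta> = sin t"
      by (rule sincos_total_2pi)
    then show ?thesis using False that[of t] by (simp add: field_simps)
  qed
  define e1 e2 e3 :: "real^3" where e: "e1 = axis 1 1" "e2 = axis 2 1" "e3 = axis 3 1"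
  define a1 where "a1 = cos \<phi> *\<^sub>R e1 + sin \<phi> *\<^sub>R e2"
  define b where "b = cos \<phi> *\<^sub>R e2 - sin \<phi> *\<^sub>R e1"
  define a where "a = cos \<theta> *\<^sub>R a1 - sin \<theta> *\<^sub>R e3"
  have x: "x = cos \<theta> *\<^sub>R e3 + sin \<theta> *\<^sub>R a1"
    by (simp add: vec_eq_iff forall_3 a1_def e axis_def p c)
  have "smooth_fun.J (corner \<epsilon> k) x a b = smooth_fun.J (corner \<epsilon> k) e3 e1 e2" if "0 < \<epsilon>" for \<epsilon> k
  proof -
    interpret smooth_fun "corner \<epsilon> k" "corner_grad \<epsilon> k" by (rule corner_smooth[OF that])
    show ?thesis
      using J_rotate_polar[of \<theta> e3 a1 b] J_rotate_azimuth[of e3 \<phi> e1 e2]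
      by (simp add: x a_def a1_def b_def)
  qed
  then have m: "sph_measure x a b = sph_measure (axis 3 1) (axis 1 1) (axis 2 1)"
    unfolding e[symmetric] by (rule sph_measure_eqI)
  have comps: "x $ 1 = sin \<theta> * cos \<phi>" "x $ 2 = sin \<theta> * sin \<phi>" "x $ 3 = cos \<theta>"
    "a $ 1 = cos \<theta> * cos \<phi>" "a $ 2 = cos \<theta> * sin \<phi>" "a $ 3 = - sin \<theta>"
    "b $ 1 = - sin \<phi>" "b $ 2 = cos \<phi>" "b $ 3 = 0"
    by (simp_all add: p c a_def a1_def b_def e axis_def)
  define C S c' s' where cs: "C = cos \<theta>" "S = sin \<theta>" "c' = cos \<phi>" "s' = sin \<phi>"
  have CS: "C * C + S * S = 1" "c' * c' + s' * s' = 1"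
    by (simp_all add: cs)
  have "frame x a b"
  proof
    show "x \<bullet> x = 1" "a \<bullet> a = 1" "b \<bullet> b = 1" "x \<bullet> a = 0" "x \<bullet> b = 0" "a \<bullet> b = 0"
      unfolding inner_vec_def sum_3 comps inner_real_def cs[symmetric] using CS by algebra+
    have h: "(C * C + S * S) * s' = s'" "(C * C + S * S) * c' = c'" "(c' * c' + s' * s') * S = S"
      unfolding CS by simp_all
    show "cross3 x a = b"
      unfolding vec_eq_iff forall_3 cross3_nth comps cs[symmetric] using h(1,2) by (simp add: algebra_simps)
    show "cross3 x b = - a"
      unfolding vec_eq_iff forall_3 cross3_nth comps vector_uminus_component cs[symmetric]
      using h(3) by (simp add: algebra_simps)
  qed
  then show ?thesis using m by (rule that)
qed

section \<open>Integrals of zonal functions\<close>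

definition polar_weight :: "real \<Rightarrow> real" where
  "polar_weight \<theta> = indicator {0..pi} \<theta> * sin \<theta>"

lemma polar_weight_nonneg: "0 \<le> polar_weight \<theta>"
  by (auto simp: polar_weight_def indicator_def sin_ge_zero)

lemma polar_weight_measurable [measurable]: "polar_weight \<in> borel_measurable borel"
  unfolding polar_weight_def
  by (intro borel_measurable_times borel_measurable_indicator) (auto intro!: borel_measurable_continuous_onI continuous_intros)

lemma cos_measurable [measurable]: "(cos :: real \<Rightarrow> real) \<in> borel_measurable borel"
  by (intro borel_measurable_continuous_onI continuous_intros)

text \<open>The substitution t = cos \<theta> as an identity of measures: in this form integrability
  and integrals of arbitrary Borel functions are transferred together.\<close>

lemma distr_cos:
  "distr (density lborel (\<lambda>\<theta>. ennreal (polar_weight \<theta>))) borel cos = density lborel (\<lambda>t. ennreal (indicator {-1..1} t))"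
proof (rule measure_eqI)
  fix A assume "A \<in> sets (distr (density lborel (\<lambda>\<theta>. ennreal (polar_weight \<theta>))) borel (cos :: real \<Rightarrow> real))"
  then have A: "A \<in> sets borel" by simp
  have "emeasure (distr (density lborel (\<lambda>\<theta>. ennreal (polar_weight \<theta>))) borel cos) A
      = (\<integral>\<^sup>+\<theta>. ennreal (polar_weight \<theta>) * indicator (cos -` A) \<theta> \<partial>lborel)"
    using A by (subst emeasure_distr) (simp_all add: emeasure_density measurable_sets_borel[OF cos_measurable])
  \<comment> \<open>The substitution rule is applied to the increasing function -cos; a reflection
    of the line undoes the sign afterwards.\<close>
  also have "\<dots> = (\<integral>\<^sup>+\<theta>. ennreal (indicator A (- (- cos \<theta>)) * sin \<theta> * indicator {0..pi} \<theta>) \<partial>lborel)"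
    by (intro nn_integral_cong) (auto simp: polar_weight_def indicator_def)
  also have "\<dots> = (\<integral>\<^sup>+t. ennreal (indicator A (- t) * indicator {- cos 0..- cos pi} t) \<partial>lborel)"
  proof (rule nn_integral_substitution[symmetric])
    show "set_borel_measurable borel {- cos 0..- cos pi} (\<lambda>t. indicator A (- t) :: real)"
    proof -
      have "(\<lambda>t. indicator A (- t) :: real) \<in> borel_measurable borel"
        by (rule measurable_compose[OF _ borel_measurable_indicator[OF A]]) simp
      then show ?thesis
        unfolding set_borel_measurable_def by (intro borel_measurable_scaleR borel_measurable_indicator) simp_all
    qed
    show "((\<lambda>\<theta>. - cos \<theta>) has_real_derivative sin \<theta>) (at \<theta>)" for \<theta>
      by (auto intro!: derivative_eq_intros)
    show "continuous_on {0..pi} sin" by (intro continuous_intros)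
  qed (auto simp: sin_ge_zero)
  also have "\<dots> = (\<integral>\<^sup>+t. ennreal (indicator A (- t) * indicator {-1..1} t) \<partial>lborel)" by simp
  also have "\<dots> = (\<integral>\<^sup>+t. ennreal (indicator A t * indicator {-1..1} t) \<partial>lborel)"
    using A by (subst nn_integral_real_affine[of _ "-1" 0]) (auto intro!: nn_integral_cong simp: indicator_def)
  also have "\<dots> = emeasure (density lborel (\<lambda>t. ennreal (indicator {-1..1} t))) A"
    using A by (subst emeasure_density) (auto intro!: nn_integral_cong simp: indicator_def)
  finally show "emeasure (distr (density lborel (\<lambda>\<theta>. ennreal (polar_weight \<theta>))) borel cos) A =
     emeasure (density lborel (\<lambda>t. ennreal (indicator {-1..1} t))) A" .
qed simp

lemma cos_substitution:
  fixes g :: "real \<Rightarrow> 'b::{banach, second_countable_topology}"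
  assumes g: "g \<in> borel_measurable borel"
  shows "integrable lborel (\<lambda>\<theta>. polar_weight \<theta> *\<^sub>R g (cos \<theta>)) \<longleftrightarrow> integrable lborel (\<lambda>t. indicator {-1..1} t *\<^sub>R g t)"
    and "(LINT \<theta>|lborel. polar_weight \<theta> *\<^sub>R g (cos \<theta>)) = (LINT t|lborel. indicator {-1..1} t *\<^sub>R g t)"
proof -
  have gc: "(\<lambda>\<theta>. g (cos \<theta>)) \<in> borel_measurable borel"
    by (rule measurable_compose[OF cos_measurable g])
  let ?D = "density lborel (\<lambda>\<theta>. ennreal (polar_weight \<theta>))" and ?E = "density lborel (\<lambda>t. ennreal (indicator {-1..1} t))"
  have cD: "cos \<in> measurable ?D borel" by simp
  have "integrable lborel (\<lambda>\<theta>. polar_weight \<theta> *\<^sub>R g (cos \<theta>)) \<longleftrightarrow> integrable ?D (\<lambda>\<theta>. g (cos \<theta>))"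
    using gc by (subst integrable_density) (auto simp: polar_weight_nonneg)
  also have "\<dots> \<longleftrightarrow> integrable ?E g"
    unfolding distr_cos[symmetric] by (rule integrable_distr_eq[OF cD g, symmetric])
  also have "\<dots> \<longleftrightarrow> integrable lborel (\<lambda>t. indicator {-1..1} t *\<^sub>R g t)"
    using g by (subst integrable_density) auto
  finally show "integrable lborel (\<lambda>\<theta>. polar_weight \<theta> *\<^sub>R g (cos \<theta>)) \<longleftrightarrow> integrable lborel (\<lambda>t. indicator {-1..1} t *\<^sub>R g t)" .
  have "(LINT \<theta>|lborel. polar_weight \<theta> *\<^sub>R g (cos \<theta>)) = (LINT \<theta>|?D. g (cos \<theta>))"
    using gc by (subst integral_density) (auto simp: polar_weight_nonneg)
  also have "\<dots> = integral\<^sup>L ?E g"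
    unfolding distr_cos[symmetric] by (rule integral_distr[OF cD g, symmetric])
  also have "\<dots> = (LINT t|lborel. indicator {-1..1} t *\<^sub>R g t)"
    using g by (subst integral_density) auto
  finally show "(LINT \<theta>|lborel. polar_weight \<theta> *\<^sub>R g (cos \<theta>)) = (LINT t|lborel. indicator {-1..1} t *\<^sub>R g t)" .
qed

abbreviation standard_frame_measure :: "(real^3) measure" where
  "standard_frame_measure \<equiv> sph_measure (axis 3 1) (axis 1 1) (axis 2 1)"

lemma Omega_alt: "\<Omega> = distr (density lborel (\<lambda>z. ennreal (sph_weight z))) (restrict_space borel S2) (\<lambda>z. sph (axis 3 1) (axis 1 1) (axis 2 1) (fst z) (snd z))"
proof -
  have "spherical_coords = (\<lambda>z. sph (axis 3 1) (axis 1 1) (axis 2 1) (fst z) (snd z))"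
    by (simp add: fun_eq_iff flip: spherical_coords_sph)
  then show ?thesis unfolding \<Omega>_def sph_density by simp
qed

lemma space_Omega: "space \<Omega> = S2"
  by (simp add: \<Omega>_def space_restrict_space)

text \<open>\<Omega> lives on the sphere and the coordinate measures on R^3, but both are images of
  the same weighted rectangle; passing through the standard frame allows the frame to be
  exchanged.\<close>

lemma integral_Omega:
  fixes g :: "real^3 \<Rightarrow> 'b::{banach, second_countable_topology}"
  assumes g: "g \<in> borel_measurable borel" and m: "sph_measure x a b = standard_frame_measure"
  shows "integrable \<Omega> g \<longleftrightarrow> integrable lborel (\<lambda>z. sph_weight z *\<^sub>R g (sph x a b (fst z) (snd z)))"
    and "integral\<^sup>L \<Omega> g = (LINT z|lborel. sph_weight z *\<^sub>R g (sph x a b (fst z) (snd z)))"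
proof -
  let ?N = "density lborel (\<lambda>z. ennreal (sph_weight z))"
  let ?s = "\<lambda>z. sph (axis 3 1) (axis 1 1) (axis 2 1) (fst z) (snd z)"
  interpret frame "axis 3 1" "axis 1 1" "axis 2 1"
    by unfold_locales (simp_all add: inner_vec_def sum_3 vec_eq_iff forall_3 cross3_nth axis_def)
  have unit: "norm (?s z) = 1" for z
    using norm_pt by (simp add: pt_def \<omega>_def sph_def)
  have s: "?s \<in> measurable ?N (restrict_space borel S2)"
    by (rule measurable_restrict_space2) (use unit sph_measurable in auto)
  have s': "(\<lambda>z. sph x a b (fst z) (snd z)) \<in> measurable ?N borel" for x a b
    using sph_measurable by simp
  have gr: "g \<in> borel_measurable (restrict_space borel S2)"
    using g by (rule measurable_restrict_space1)
  have gs: "(\<lambda>z. g (sph x a b (fst z) (snd z))) \<in> borel_measurable lborel"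
    using measurable_compose[OF sph_measurable g] by simp
  have "integrable \<Omega> g \<longleftrightarrow> integrable ?N (\<lambda>z. g (?s z))"
    unfolding Omega_alt by (rule integrable_distr_eq[OF s gr])
  also have "\<dots> \<longleftrightarrow> integrable standard_frame_measure g"
    unfolding sph_measure_def by (rule integrable_distr_eq[OF s' g, symmetric])
  also have "\<dots> \<longleftrightarrow> integrable ?N (\<lambda>z. g (sph x a b (fst z) (snd z)))"
    unfolding m[symmetric] unfolding sph_measure_def by (rule integrable_distr_eq[OF s' g])
  also have "\<dots> \<longleftrightarrow> integrable lborel (\<lambda>z. sph_weight z *\<^sub>R g (sph x a b (fst z) (snd z)))"
    using gs by (subst integrable_density) (auto simp: sph_weight_nonneg)
  finally show "integrable \<Omega> g \<longleftrightarrow> integrable lborel (\<lambda>z. sph_weight z *\<^sub>R g (sph x a b (fst z) (snd z)))" .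
  have "integral\<^sup>L \<Omega> g = (LINT z|?N. g (?s z))"
    unfolding Omega_alt by (rule integral_distr[OF s gr])
  also have "\<dots> = integral\<^sup>L standard_frame_measure g"
    unfolding sph_measure_def by (rule integral_distr[OF s' g, symmetric])
  also have "\<dots> = (LINT z|?N. g (sph x a b (fst z) (snd z)))"
    unfolding m[symmetric] unfolding sph_measure_def by (rule integral_distr[OF s' g])
  also have "\<dots> = (LINT z|lborel. sph_weight z *\<^sub>R g (sph x a b (fst z) (snd z)))"
    using gs by (subst integral_density) (auto simp: sph_weight_nonneg)
  finally show "integral\<^sup>L \<Omega> g = (LINT z|lborel. sph_weight z *\<^sub>R g (sph x a b (fst z) (snd z)))" .
qed

context frame
begin

lemma pt_sph: "pt \<theta> \<phi> = sph x a b \<theta> \<phi>"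
  by (simp add: pt_def \<omega>_def sph_def)

text \<open>Fubini in polar coordinates about x, followed by t = cos \<theta>. The kernel alone may
  fail to be integrable: h is bounded by a multiple of \<rho>, and it is k \<rho> that is
  integrable. Measurability of k concerns the open interval, so the poles need separate
  care.\<close>

lemma zonal_integral:
  fixes h :: "real^3 \<Rightarrow> complex" and m :: "real \<Rightarrow> complex"
  assumes \<mu>: "sph_measure x a b = standard_frame_measure"
    and k: "(\<lambda>t. indicator {-1<..<1} t * k t) \<in> borel_measurable borel"
    and \<rho>: "set_integrable lborel {-1<..<1} (\<lambda>t. k t * \<rho> t)"
    and h: "continuous_on S2 h" and bound: "\<And>y. y \<in> S2 \<Longrightarrow> norm (h y) \<le> C * \<rho> (x \<bullet> y)"
    and m: "m \<in> borel_measurable borel" "\<And>\<theta>. 0 < \<theta> \<Longrightarrow> \<theta> < pi \<Longrightarrow> cmean h \<theta> = m (cos \<theta>)"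
  shows "integrable \<Omega> (\<lambda>y. k (x \<bullet> y) *\<^sub>R h y)"
    and "(LINT y|\<Omega>. k (x \<bullet> y) *\<^sub>R h y) = (LBINT t:{-1<..<1}. k t *\<^sub>R m t)"
proof -
  define k1 where "k1 t = indicator {-1<..<1} t * k t" for t
  \<comment> \<open>Borel on the line and equal to \<open>k\<close> on the whole of [-1, 1], so that
    the integrand on the sphere is matched exactly, poles included.\<close>
  define k2 where "k2 t = k1 t + (indicator {1} t * k 1 + indicator {-1} t * k (-1))" for t
  have k1m [measurable]: "k1 \<in> borel_measurable borel" using k by (simp add: k1_def[abs_def])
  have k2m [measurable]: "k2 \<in> borel_measurable borel" unfolding k2_def by measurable
  have k2: "k2 t = k t" if "-1 \<le> t" "t \<le> 1" for t
    using that by (auto simp: k2_def k1_def indicator_def)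
  define G where "G y = k2 (x \<bullet> y) *\<^sub>R (indicator S2 y *\<^sub>R h y)" for y
  have Gm: "G \<in> borel_measurable borel"
  proof -
    have "(\<lambda>y. indicator S2 y *\<^sub>R h y) \<in> borel_measurable borel"
      using borel_measurable_continuous_on_indicator[OF _ h] by simp
    then show ?thesis unfolding G_def by measurable
  qed
  have Gk: "G y = k (x \<bullet> y) *\<^sub>R h y" if "y \<in> space \<Omega>" for y
  proof -
    have y: "norm y = 1" using that by (simp add: space_Omega)
    have "\<bar>x \<bullet> y\<bar> \<le> norm x * norm y" by (rule Cauchy_Schwarz_ineq2)
    then have "\<bar>x \<bullet> y\<bar> \<le> 1" using y unit by (simp add: norm_eq_sqrt_inner)
    then show ?thesis using y k2[of "x \<bullet> y"] by (simp add: G_def abs_le_iff)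
  qed
  define f where "f z = sph_weight z *\<^sub>R G (sph x a b (fst z) (snd z))" for z
  define c where "c \<theta> = polar_weight \<theta> * k1 (cos \<theta>)" for \<theta>
  have fm: "f \<in> borel_measurable (lborel \<Otimes>\<^sub>M lborel)"
    unfolding f_def using measurable_compose[OF sph_measurable Gm] sph_weight_measurable
    by (simp add: lborel_prod)
  \<comment> \<open>At \<theta> = 0 and \<theta> = pi the factor sin vanishes, so the pole values
    that distinguish \<open>k2\<close> from \<open>k1\<close> disappear.\<close>
  have f: "f (\<theta>, \<phi>) = c \<theta> *\<^sub>R (indicator {0..<2*pi} \<phi> *\<^sub>R h (pt \<theta> \<phi>))" for \<theta> \<phi>
  proof (cases "0 < \<theta> \<and> \<theta> < pi")
    case True
    then have "k2 (cos \<theta>) = k1 (cos \<theta>)"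
      using cos_monotone_0_pi[of 0 \<theta>] cos_monotone_0_pi[of \<theta> pi] by (simp add: k2_def)
    then show ?thesis
      using inner_pt[of \<theta> \<phi>] norm_pt[of \<theta> \<phi>]
      by (simp add: f_def c_def G_def sph_weight_def polar_weight_def indicator_def flip: pt_sph)
  next
    case False
    then have "\<theta> = 0 \<or> \<theta> = pi \<or> \<theta> \<notin> {0..pi}" by auto
    then show ?thesis
      by (auto simp: f_def c_def sph_weight_def polar_weight_def)
  qed
  have hp: "continuous_on UNIV (\<lambda>\<phi>. h (pt \<theta> \<phi>))" for \<theta>
    by (rule continuous_on_compose2[OF h]) (auto intro!: continuous_frame continuous_intros simp: norm_pt)
  have hi: "set_integrable lborel {0..2*pi} (\<lambda>\<phi>. h (pt \<theta> \<phi>))" for \<theta>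
    unfolding set_integrable_def by (rule borel_integrable_compact) (auto intro: continuous_on_subset[OF hp])
  then have hi': "set_integrable lborel {0..<2*pi} (\<lambda>\<phi>. h (pt \<theta> \<phi>))" for \<theta>
    by (rule set_integrable_subset) auto
  have hint: "(LINT \<phi>|lborel. indicator {0..<2*pi} \<phi> *\<^sub>R h (pt \<theta> \<phi>)) = cmean h \<theta>" for \<theta>
  proof -
    have "(LINT \<phi>|lborel. indicator {0..<2*pi} \<phi> *\<^sub>R h (pt \<theta> \<phi>)) = (LINT \<phi>:{0..2*pi}|lborel. h (pt \<theta> \<phi>))"
      unfolding set_lebesgue_integral_def
    proof (rule integral_cong_AE)
      show "AE \<phi> in lborel. indicator {0..<2*pi} \<phi> *\<^sub>R h (pt \<theta> \<phi>) = indicator {0..2*pi} \<phi> *\<^sub>R h (pt \<theta> \<phi>)"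
        by (rule AE_I'[of "{2*pi}"]) (auto simp: indicator_def split: if_splits)
    qed (use hi hi' in \<open>auto simp: set_integrable_def\<close>)
    then show ?thesis by (simp add: set_borel_integral_eq_integral(2)[OF hi] cmean_def)
  qed
  have kr: "integrable lborel (\<lambda>t. k1 t * \<rho> t)"
    using \<rho> by (simp add: set_integrable_def k1_def mult.assoc)
  have "integrable lborel (\<lambda>t. indicator {-1..1} t *\<^sub>R (k1 t * \<rho> t))"
    using kr by (rule back_subst[of "integrable lborel"]) (auto simp: fun_eq_iff k1_def indicator_def)
  then have b: "integrable lborel (\<lambda>\<theta>. polar_weight \<theta> *\<^sub>R (k1 (cos \<theta>) * \<rho> (cos \<theta>)))"
    using kr by (subst cos_substitution(1)[where g = "\<lambda>t. k1 t * \<rho> t"]) auto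
  have fi: "integrable (lborel \<Otimes>\<^sub>M lborel) f"
  proof (rule lborel_pair.Fubini_integrable[OF fm])
    show "AE \<theta> in lborel. integrable lborel (\<lambda>\<phi>. f (\<theta>, \<phi>))"
      unfolding f using hi' by (intro AE_I2 integrable_scaleR_right) (simp add: set_integrable_def)
    show "integrable lborel (\<lambda>\<theta>. LINT \<phi>|lborel. norm (f (\<theta>, \<phi>)))"
    proof (rule Bochner_Integration.integrable_bound)
      show "integrable lborel (\<lambda>\<theta>. 2 * pi * C * (polar_weight \<theta> *\<^sub>R (k1 (cos \<theta>) * \<rho> (cos \<theta>))))"
        using b by (rule integrable_mult_right)
      show "(\<lambda>\<theta>. LINT \<phi>|lborel. norm (f (\<theta>, \<phi>))) \<in> borel_measurable lborel"
        by (rule lborel.borel_measurable_lebesgue_integral)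
           (use measurable_compose[OF fm borel_measurable_norm] in \<open>simp add: split_beta'\<close>)
      show "AE \<theta> in lborel. norm (LINT \<phi>|lborel. norm (f (\<theta>, \<phi>))) \<le> norm (2 * pi * C * (polar_weight \<theta> *\<^sub>R (k1 (cos \<theta>) * \<rho> (cos \<theta>))))"
      proof (rule AE_I2)
        fix \<theta> :: real
        have b0: "norm (h (pt \<theta> \<phi>)) \<le> C * \<rho> (cos \<theta>)" for \<phi>
          using bound[of "pt \<theta> \<phi>"] by (simp add: norm_pt inner_pt)
        \<comment> \<open>C and \<rho> have no known sign, but their product dominates a norm; it
          may therefore be replaced by its absolute value.\<close>
        have C0: "0 \<le> C * \<rho> (cos \<theta>)" using b0[of 0] norm_ge_zero order_trans by blast
        have "(LINT \<phi>|lborel. norm (f (\<theta>, \<phi>))) = \<bar>c \<theta>\<bar> * (LINT \<phi>|lborel. indicator {0..<2*pi} \<phi> * norm (h (pt \<theta> \<phi>)))"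
          by (simp add: f abs_mult mult.assoc)
        also have "\<dots> \<le> \<bar>c \<theta>\<bar> * (LINT \<phi>|lborel. indicator {0..<2*pi} \<phi> * (C * \<rho> (cos \<theta>)))"
        proof (rule mult_left_mono[OF integral_mono])
          have "integrable lborel (\<lambda>\<phi>. norm (indicator {0..<2*pi} \<phi> *\<^sub>R h (pt \<theta> \<phi>)))"
            using hi'[of \<theta>] unfolding set_integrable_def by (rule integrable_norm)
          then show "integrable lborel (\<lambda>\<phi>. indicator {0..<2*pi} \<phi> * norm (h (pt \<theta> \<phi>)))" by simp
          show "integrable lborel (\<lambda>\<phi>. indicator {0..<2*pi} \<phi> * (C * \<rho> (cos \<theta>)))"
            by (intro integrable_mult_left integrable_real_indicator) auto
          show "indicator {0..<2*pi} \<phi> * norm (h (pt \<theta> \<phi>)) \<le> indicator {0..<2*pi} \<phi> * (C * \<rho> (cos \<theta>))" for \<phi>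
            by (intro mult_left_mono b0) simp
        qed simp
        also have "\<dots> = \<bar>c \<theta>\<bar> * (2 * pi * (C * \<rho> (cos \<theta>)))" by simp
        also have "\<dots> = norm (2 * pi * C * (polar_weight \<theta> *\<^sub>R (k1 (cos \<theta>) * \<rho> (cos \<theta>))))"
        proof -
          have "C * \<rho> (cos \<theta>) = \<bar>C\<bar> * \<bar>\<rho> (cos \<theta>)\<bar>" using C0 by (simp flip: abs_mult)
          then show ?thesis by (simp add: c_def abs_mult mult_ac)
        qed
        finally show "norm (LINT \<phi>|lborel. norm (f (\<theta>, \<phi>))) \<le> norm (2 * pi * C * (polar_weight \<theta> *\<^sub>R (k1 (cos \<theta>) * \<rho> (cos \<theta>))))"
          by simp
      qed
    qed
  qed
  have "integrable \<Omega> G"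
    using fi unfolding integral_Omega(1)[OF Gm \<mu>] f_def[abs_def] lborel_prod .
  then show "integrable \<Omega> (\<lambda>y. k (x \<bullet> y) *\<^sub>R h y)"
    by (subst (asm) Bochner_Integration.integrable_cong[OF refl Gk]) auto
  have "(LINT y|\<Omega>. k (x \<bullet> y) *\<^sub>R h y) = integral\<^sup>L \<Omega> G"
    by (rule Bochner_Integration.integral_cong[OF refl]) (simp add: Gk)
  also have "\<dots> = integral\<^sup>L (lborel \<Otimes>\<^sub>M lborel) f"
    unfolding integral_Omega(2)[OF Gm \<mu>] f_def[abs_def] lborel_prod ..
  also have "\<dots> = (LINT \<theta>|lborel. LINT \<phi>|lborel. f (\<theta>, \<phi>))"
    using lborel_pair.integral_fst'[OF fi] by simp
  also have "\<dots> = (LINT \<theta>|lborel. c \<theta> *\<^sub>R cmean h \<theta>)"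
    by (simp only: f integral_scaleR_right hint)
  also have "\<dots> = (LINT \<theta>|lborel. polar_weight \<theta> *\<^sub>R (k1 (cos \<theta>) *\<^sub>R m (cos \<theta>)))"
  proof (rule Bochner_Integration.integral_cong[OF refl])
    fix \<theta> :: real
    show "c \<theta> *\<^sub>R cmean h \<theta> = polar_weight \<theta> *\<^sub>R (k1 (cos \<theta>) *\<^sub>R m (cos \<theta>))"
    proof (cases "0 < \<theta> \<and> \<theta> < pi")
      case True
      then show ?thesis by (simp add: c_def m(2))
    next
      case False
      then have "\<theta> = 0 \<or> \<theta> = pi \<or> \<theta> \<notin> {0..pi}" by auto
      then show ?thesis by (auto simp: c_def polar_weight_def)
    qed
  qed
  also have "\<dots> = (LINT t|lborel. indicator {-1..1} t *\<^sub>R (k1 t *\<^sub>R m t))"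
    using m(1) by (intro cos_substitution(2)) measurable
  also have "\<dots> = (LBINT t:{-1<..<1}. k t *\<^sub>R m t)"
    unfolding set_lebesgue_integral_def
    by (rule Bochner_Integration.integral_cong[OF refl]) (auto simp: k1_def indicator_def)
  finally show "(LINT y|\<Omega>. k (x \<bullet> y) *\<^sub>R h y) = (LBINT t:{-1<..<1}. k t *\<^sub>R m t)" .
qed

end

section \<open>Surface gradients and complex vector algebra\<close>

text \<open>The derivative of z / |z| at a unit vector y is the projection onto the tangent plane,
  and Euler's identity evaluates the removed radial derivative as l P.\<close>

lemma surf_grad_harmonic:
  assumes P: "solid_harmonic l P" and u: "\<And>y. y \<in> S2 \<Longrightarrow> u y = P y" and y: "y \<in> S2"
  shows "surf_grad u y = sgrad l P y"
proof -
  have cp: "cpoly P" using P by (simp add: solid_harmonic_def)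
  have ny: "norm y = 1" "y \<noteq> 0" using y by auto
  have s: "sgn y = y" using ny by (simp add: sgn_div_norm)
  have nd: "(norm has_derivative (\<lambda>v. y \<bullet> v)) (at y)"
    using has_derivative_norm[OF ny(2)] s by (simp add: inner_commute[of _ y])
  have id: "((\<lambda>z. z) has_derivative (\<lambda>v. v)) (at y)" by (rule has_derivative_ident)
  have "((\<lambda>z. inverse (norm z)) has_derivative (\<lambda>v. - (inverse (norm y) * (y \<bullet> v) * inverse (norm y)))) (at y)"
    by (rule Deriv.has_derivative_inverse[OF _ nd]) (use ny in simp)
  from has_derivative_scaleR[OF this id]
  have "((\<lambda>z. inverse (norm z) *\<^sub>R z) has_derivative (\<lambda>v. v - (y \<bullet> v) *\<^sub>R y)) (at y)"
    using ny by simp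
  then have "(sgn has_derivative (\<lambda>v. v - (y \<bullet> v) *\<^sub>R y)) (at y)"
    by (simp add: sgn_div_norm[abs_def])
  moreover have "(P has_derivative (\<lambda>v. \<Sum>i\<in>UNIV. complex_of_real (v $ i) * partial_deriv i P y)) (at (sgn y))"
    unfolding s by (rule cpoly_gradient(2)[OF cp])
  ultimately have "((\<lambda>z. P (sgn z)) has_derivative (\<lambda>v. \<Sum>i\<in>UNIV. complex_of_real ((v - (y \<bullet> v) *\<^sub>R y) $ i) * partial_deriv i P y)) (at y)"
    by (rule has_derivative_compose)
  then have "((\<lambda>z. P (sgn z)) has_derivative (\<lambda>v. dird (v - (y \<bullet> v) *\<^sub>R y) P y)) (at y)"
    by (simp only: dird_def)
  also have "(\<lambda>v. dird (v - (y \<bullet> v) *\<^sub>R y) P y) = (\<lambda>v. \<Sum>i\<in>UNIV. complex_of_real (v $ i) * sgrad l P y $ i)"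
  proof
    fix v
    have "dird (v - (y \<bullet> v) *\<^sub>R y) P y = dird v P y - complex_of_real (y \<bullet> v) * (of_nat l * P y)"
      using P by (simp add: dird_linear) (simp add: dird_def solid_harmonic_def)
    also have "\<dots> = (\<Sum>i\<in>UNIV. complex_of_real (v $ i) * sgrad l P y $ i)"
      by (simp add: dird_def sgrad_nth inner_vec_def right_diff_distrib sum_subtractf sum_distrib_left sum_distrib_right mult_ac)
    finally show "dird (v - (y \<bullet> v) *\<^sub>R y) P y = (\<Sum>i\<in>UNIV. complex_of_real (v $ i) * sgrad l P y $ i)" .
  qed
  \<comment> \<open>\<open>u\<close> is known only on the sphere, but \<open>sgn z\<close> lies
    there for every z \<noteq> 0, so the two extensions agree near y.\<close>
  finally have "((\<lambda>z. u (sgn z)) has_derivative (\<lambda>v. \<Sum>i\<in>UNIV. complex_of_real (v $ i) * sgrad l P y $ i)) (at y)"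
  proof (rule has_derivative_transform_within_open)
    show "open (- {0 :: real^3})" by auto
    show "y \<in> - {0}" using ny by simp
    show "P (sgn z) = u (sgn z)" if "z \<in> - {0}" for z
      using that by (intro u[symmetric]) (simp add: norm_sgn)
  qed
  then show ?thesis
    unfolding surf_grad_def by (simp add: vec_eq_iff partial_deriv_eqI)
qed

lemma bounded_linear_axis: "bounded_linear (axis i :: complex \<Rightarrow> complex^3)"
  by (auto intro!: linearI simp: linear_conv_bounded_linear[symmetric] axis_def vec_eq_iff)

lemma integral_vec3:
  fixes f :: "'a \<Rightarrow> complex^3"
  assumes "\<And>i. integrable M (\<lambda>x. f x $ i)"
  shows "integrable M f" "integral\<^sup>L M f $ i = (LINT x|M. f x $ i)"
proof -
  have "f = (\<lambda>x. \<Sum>i\<in>UNIV. axis i (f x $ i))"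
    by (simp add: fun_eq_iff vec_eq_iff axis_def if_distrib cong: if_cong)
  moreover have "integrable M (\<lambda>x. \<Sum>i\<in>UNIV. axis i (f x $ i))"
    by (intro Bochner_Integration.integrable_sum integrable_bounded_linear[OF bounded_linear_axis] assms)
  ultimately show i: "integrable M f" by simp
  show "integral\<^sup>L M f $ i = (LINT x|M. f x $ i)"
    using integral_bounded_linear[OF bounded_linear_vec_nth i] by simp
qed

section \<open>Bilinear vector algebra over the complex numbers\<close>

lemma cvec_linear: "cvec (v + w) = cvec v + cvec w" "cvec (v - w) = cvec v - cvec w" "cvec (c *\<^sub>R v) = c *\<^sub>R cvec v"
  by (simp_all add: vec_eq_iff cvec_nth scaleR_conv_of_real[where 'a = complex])

lemma ccross_linear:
  "(a + b) \<times>\<^sub>c c = a \<times>\<^sub>c c + b \<times>\<^sub>c c" "(a - b) \<times>\<^sub>c c = a \<times>\<^sub>c c - b \<times>\<^sub>c c"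
  "a \<times>\<^sub>c (b + c) = a \<times>\<^sub>c b + a \<times>\<^sub>c c" "a \<times>\<^sub>c (b - c) = a \<times>\<^sub>c b - a \<times>\<^sub>c c"
  "(k *s a) \<times>\<^sub>c b = k *s (a \<times>\<^sub>c b)" "a \<times>\<^sub>c (k *s b) = k *s (a \<times>\<^sub>c b)"
  "(r *\<^sub>R a) \<times>\<^sub>c b = r *\<^sub>R (a \<times>\<^sub>c b)" "(- a) \<times>\<^sub>c b = - (a \<times>\<^sub>c b)" "a \<times>\<^sub>c (- b) = - (a \<times>\<^sub>c b)"
  "a \<times>\<^sub>c 0 = 0" "a \<times>\<^sub>c a = 0"
  by (simp_all add: vec_eq_iff forall_3 ccross_nth algebra_simps)

lemma cdot_linear:
  "(a - b) \<bullet>\<^sub>c c = a \<bullet>\<^sub>c c - b \<bullet>\<^sub>c c" "a \<bullet>\<^sub>c (b - c) = a \<bullet>\<^sub>c b - a \<bullet>\<^sub>c c"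
  "(k *s a) \<bullet>\<^sub>c b = k * (a \<bullet>\<^sub>c b)" "a \<bullet>\<^sub>c (k *s b) = k * (a \<bullet>\<^sub>c b)"
  "(r *\<^sub>R a) \<bullet>\<^sub>c b = r *\<^sub>R (a \<bullet>\<^sub>c b)" "a \<bullet>\<^sub>c (r *\<^sub>R b) = r *\<^sub>R (a \<bullet>\<^sub>c b)"
  "a \<bullet>\<^sub>c 0 = 0" "a \<bullet>\<^sub>c (- b) = - (a \<bullet>\<^sub>c b)"
  by (simp_all add: cdot_def sum_3 scaleR_right_distrib algebra_simps)

lemma cdot_commute: "a \<bullet>\<^sub>c b = b \<bullet>\<^sub>c a"
  by (simp add: cdot_def mult.commute)

lemma cdot_unit: "norm y = 1 \<Longrightarrow> cvec y \<bullet>\<^sub>c cvec y = 1"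
  by (simp add: cdot_cvec norm_eq_1)

lemma ccross_double_tangent:
  assumes "y \<bullet>\<^sub>c y = 1" "y \<bullet>\<^sub>c v = 0"
  shows "y \<times>\<^sub>c (y \<times>\<^sub>c v) = - v"
proof -
  have "v = - (y \<times>\<^sub>c (y \<times>\<^sub>c v))"
    by (rule trans[OF ccross_double[OF assms(1), of v]]) (simp add: assms(2))
  then show ?thesis by (metis minus_minus)
qed

text \<open>A bound by which h compensates the singularity of the kernel: \<rho> is sqrt (1 - t^2)
  for integrands vanishing at x and -x, and the chord length sqrt (2 (1 - t)) for those known to
  vanish at x only.\<close>

definition zonal_bounded :: "real^3 \<Rightarrow> (real \<Rightarrow> real) \<Rightarrow> (real^3 \<Rightarrow> complex) \<Rightarrow> bool" where
  "zonal_bounded x \<rho> h \<longleftrightarrow> continuous_on S2 h \<and> (\<exists>C. \<forall>y\<in>S2. norm (h y) \<le> C * \<rho> (x \<bullet> y))"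

lemma zonal_bounded_add:
  assumes "zonal_bounded x \<rho> f" "zonal_bounded x \<rho> g"
  shows "zonal_bounded x \<rho> (\<lambda>y. f y + g y)"
proof -
  obtain C D where "\<And>y. y \<in> S2 \<Longrightarrow> norm (f y) \<le> C * \<rho> (x \<bullet> y)" "\<And>y. y \<in> S2 \<Longrightarrow> norm (g y) \<le> D * \<rho> (x \<bullet> y)"
    using assms unfolding zonal_bounded_def by blast
  then have "norm (f y + g y) \<le> (C + D) * \<rho> (x \<bullet> y)" if "y \<in> S2" for y
    using that norm_triangle_ineq[of "f y" "g y"] by (fastforce simp: distrib_right)
  then show ?thesis
    using assms unfolding zonal_bounded_def by (intro conjI continuous_on_add exI[of _ "C + D"] ballI) auto
qed

lemma zonal_bounded_mult:
  assumes f: "zonal_bounded x \<rho> f" and g: "continuous_on S2 g"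
  shows "zonal_bounded x \<rho> (\<lambda>y. f y * g y)"
proof -
  obtain C where C: "\<And>y. y \<in> S2 \<Longrightarrow> norm (f y) \<le> C * \<rho> (x \<bullet> y)"
    using f unfolding zonal_bounded_def by blast
  have "compact (g ` S2)" by (rule compact_continuous_image[OF g]) simp
  then obtain B where B: "\<And>y. y \<in> S2 \<Longrightarrow> norm (g y) \<le> B"
    using compact_imp_bounded bounded_iff by (metis imageI)
  have "norm (f y * g y) \<le> (C * B) * \<rho> (x \<bullet> y)" if "y \<in> S2" for y
  proof -
    have "norm (f y * g y) \<le> (C * \<rho> (x \<bullet> y)) * B"
      unfolding norm_mult using C[OF that] B[OF that] by (intro mult_mono order_trans[OF norm_ge_zero C[OF that]]) auto
    then show ?thesis by (simp add: mult_ac)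
  qed
  then show ?thesis
    using f g unfolding zonal_bounded_def by (intro conjI continuous_on_mult exI[of _ "C * B"] ballI) auto
qed

lemma zonal_bounded_diff:
  assumes "zonal_bounded x \<rho> f" "zonal_bounded x \<rho> g"
  shows "zonal_bounded x \<rho> (\<lambda>y. f y - g y)"
  using zonal_bounded_add[OF assms(1) zonal_bounded_mult[OF assms(2), of "\<lambda>_. -1"]] by simp

lemma zonal_bounded_cvec:
  assumes "continuous_on S2 e" "\<And>y. y \<in> S2 \<Longrightarrow> norm (e y) \<le> \<rho> (x \<bullet> y)"
  shows "zonal_bounded x \<rho> (\<lambda>y. cvec (e y) $ k)"
  unfolding zonal_bounded_def cvec_nth
proof (intro conjI exI[of _ 1] ballI)
  show "continuous_on S2 (\<lambda>y. complex_of_real (e y $ k))"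
    using assms(1) by (intro continuous_intros)
  show "norm (complex_of_real (e y $ k)) \<le> 1 * \<rho> (x \<bullet> y)" if "y \<in> S2" for y
    using assms(2)[OF that] component_le_norm_cart[of "e y" k] by simp
qed

lemma zonal_bounded_ccross:
  assumes "\<And>k. zonal_bounded x \<rho> (\<lambda>y. E y $ k)" "\<And>k. continuous_on S2 (\<lambda>y. F y $ k)"
  shows "zonal_bounded x \<rho> (\<lambda>y. (E y \<times>\<^sub>c F y) $ k)"
  using exhaust_3[of k] by (auto simp: ccross_nth intro!: zonal_bounded_diff zonal_bounded_mult assms)

lemma zonal_bounded_cdot:
  assumes "\<And>k. zonal_bounded x \<rho> (\<lambda>y. E y $ k)" "\<And>k. continuous_on S2 (\<lambda>y. F y $ k)"
  shows "zonal_bounded x \<rho> (\<lambda>y. F y \<bullet>\<^sub>c E y)"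
  unfolding cdot_def sum_3 mult.commute[of "F _ $ _"]
  by (intro zonal_bounded_add zonal_bounded_mult assms)

lemma norm_projection:
  fixes x y :: "real^3"
  assumes "norm x = 1" "norm y = 1"
  shows "norm (y - (x \<bullet> y) *\<^sub>R x) = sqrt (1 - (x \<bullet> y)\<^sup>2)"
proof -
  have "(y - (x \<bullet> y) *\<^sub>R x) \<bullet> (y - (x \<bullet> y) *\<^sub>R x) = 1 - (x \<bullet> y)\<^sup>2"
    using assms by (simp add: norm_eq_1 inner_diff_left inner_diff_right inner_commute power2_eq_square)
  then show ?thesis by (simp add: norm_eq_sqrt_inner)
qed

lemma norm_chord:
  fixes x y :: "real^3"
  assumes "norm x = 1" "norm y = 1"
  shows "norm (y - x) = sqrt (2 * (1 - x \<bullet> y))"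
proof -
  have "(y - x) \<bullet> (y - x) = 2 * (1 - x \<bullet> y)"
    using assms by (simp add: norm_eq_1 inner_diff_left inner_diff_right inner_commute)
  then show ?thesis by (simp add: norm_eq_sqrt_inner)
qed

section \<open>Circle means of vector fields\<close>

context frame
begin

definition vmean :: "(real^3 \<Rightarrow> complex^3) \<Rightarrow> real \<Rightarrow> complex^3" where
  "vmean F \<theta> = (\<chi> k. cmean (\<lambda>y. F y $ k) \<theta>)"

definition vpoly :: "(real^3 \<Rightarrow> complex^3) \<Rightarrow> bool" where
  "vpoly F \<longleftrightarrow> (\<forall>k. cpoly (\<lambda>y. F y $ k))"

lemma vpoly_ops:
  "vpoly F \<Longrightarrow> vpoly G \<Longrightarrow> vpoly (\<lambda>y. F y + G y)" "vpoly F \<Longrightarrow> vpoly G \<Longrightarrow> vpoly (\<lambda>y. F y - G y)"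
  "vpoly (\<lambda>_. c)" "vpoly cvec"
  unfolding vpoly_def by (auto simp: cvec_nth intro!: cpoly_intros)

lemma vpoly_ccross: "vpoly F \<Longrightarrow> vpoly G \<Longrightarrow> vpoly (\<lambda>y. F y \<times>\<^sub>c G y)"
  unfolding vpoly_def forall_3 ccross_nth by (auto intro!: cpoly_intros)

lemma cpoly_cdot: "vpoly F \<Longrightarrow> vpoly G \<Longrightarrow> cpoly (\<lambda>y. F y \<bullet>\<^sub>c G y)"
  unfolding vpoly_def cdot_def by (auto intro!: cpoly_intros)

lemma vpoly_sgrad: "cpoly P \<Longrightarrow> vpoly (sgrad l P)"
  unfolding vpoly_def by (simp add: cpoly_sgrad)

lemma vmean_add: "vpoly F \<Longrightarrow> vpoly G \<Longrightarrow> vmean (\<lambda>y. F y + G y) \<theta> = vmean F \<theta> + vmean G \<theta>"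
  by (simp add: vmean_def vpoly_def vec_eq_iff cmean_add)

lemma vmean_diff: "vpoly F \<Longrightarrow> vpoly G \<Longrightarrow> vmean (\<lambda>y. F y - G y) \<theta> = vmean F \<theta> - vmean G \<theta>"
  by (simp add: vmean_def vpoly_def vec_eq_iff cmean_diff)

lemma vmean_const: "vmean (\<lambda>_. c) \<theta> = (2 * pi) *\<^sub>R c"
  by (simp add: vmean_def vec_eq_iff cmean_def scaleR_conv_of_real[where 'a = complex])

lemma vmean_ccross_left: "vpoly F \<Longrightarrow> vmean (\<lambda>y. c \<times>\<^sub>c F y) \<theta> = c \<times>\<^sub>c vmean F \<theta>"
  by (simp add: vmean_def vpoly_def vec_eq_iff forall_3 ccross_nth cmean_diff cmean_cmult cpoly_intros)

lemma cmean_cdot_left: "vpoly F \<Longrightarrow> cmean (\<lambda>y. c \<bullet>\<^sub>c F y) \<theta> = c \<bullet>\<^sub>c vmean F \<theta>"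
  by (simp add: vmean_def vpoly_def cdot_def sum_3 cmean_add cmean_cmult cpoly_intros)

text \<open>The moment formula for the constant harmonic 1 of degree 0, where the gradient term is
  absent.\<close>

lemma vmean_cvec:
  assumes "0 \<le> \<theta>" "\<theta> < pi"
  shows "vmean cvec \<theta> = (2 * pi * cos \<theta>) *\<^sub>R cvec x"
proof -
  have "solid_harmonic 0 (\<lambda>_. 1)"
    by (simp add: solid_harmonic_def cpoly_const harmonic_def partial_deriv_const)
  from cmean_moment[OF this _ assms]
  have "cmean (\<lambda>y. complex_of_real (y $ k)) \<theta> = complex_of_real (2 * pi) * complex_of_real (cos \<theta> * x $ k)" for k
    by (simp add: partial_deriv_const sgrad_nth legendre_def)
  then show ?thesis
    by (simp add: vmean_def vec_eq_iff cvec_nth scaleR_conv_of_real[where 'a = complex])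
qed

lemma vmean_cong: "(\<And>y. norm y = 1 \<Longrightarrow> x \<bullet> y = cos \<theta> \<Longrightarrow> F y = G y) \<Longrightarrow> vmean F \<theta> = vmean G \<theta>"
  by (simp add: vmean_def cong: cmean_cong)

end

section \<open>Moments of the kernel\<close>

lemma legendre_0: "legendre 0 = 1"
  by (simp add: legendre_def)

text \<open>By \<open>weak\<close> the pointwise derivative of the truncated kernel is also its
  distributional derivative, so no point mass sits at the cutoff. \<open>\<mu>\<close> is the
  rotation invariance of the surface measure for the chosen frame.\<close>

locale nonlocal_setting = frame x a b for x a b :: "real^3" +
  fixes \<gamma> :: "real \<Rightarrow> real" and \<delta> :: real and l :: nat and P :: "real^3 \<Rightarrow> complex"
  assumes \<delta>: "0 < \<delta>" "\<delta> \<le> 2"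
    and kernel_integrable: "set_integrable lborel {-1<..<1} (truncated \<gamma> \<delta>)"
    and weak: "weak_derivative_on {-1<..<1} (truncated \<gamma> \<delta>) (deriv (truncated \<gamma> \<delta>))"
    and deriv_integrable: "set_integrable lborel {-1<..<1} (\<lambda>t. sqrt (1 - t\<^sup>2) * deriv (truncated \<gamma> \<delta>) t)"
    and P: "solid_harmonic l P" and P0: "l = 0 \<Longrightarrow> partial_deriv i P = (\<lambda>_. 0)"
    and \<mu>: "sph_measure x a b = standard_frame_measure"
begin

definition K where "K t = indicator {0..\<delta>} (sqrt (2 * (1 - t))) * deriv \<gamma> t"

abbreviation D where "D \<equiv> deriv (truncated \<gamma> \<delta>)"
abbreviation cut where "cut \<equiv> 1 - \<delta>\<^sup>2 / 2"

lemma cutoff_indicator: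
  assumes "t \<le> 1"
  shows "indicator {0..\<delta>} (sqrt (2 - 2 * t)) = (if cut \<le> t then 1 else 0 :: real)"
proof -
  have "sqrt (2 - 2 * t) \<le> \<delta> \<longleftrightarrow> sqrt (2 - 2 * t) \<le> sqrt (\<delta>\<^sup>2)" using \<delta> by simp
  also have "\<dots> \<longleftrightarrow> cut \<le> t" by (simp only: real_sqrt_le_iff) auto
  finally show ?thesis using assms by (simp add: indicator_def)
qed

text \<open>Away from the cutoff the truncated kernel agrees locally with \<gamma> or with 0. The
  operators contain \<open>K\<close> and the hypotheses \<open>D\<close>; the exceptional point is
  invisible to integrals in t.\<close>

lemma K_eq_D:
  assumes t: "t \<in> {-1<..<1}" "t \<noteq> cut"
  shows "K t = D t"
proof (cases "cut < t")
  case True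
  have "eventually (\<lambda>s. s \<in> {cut<..<1}) (nhds t)"
    using True t by (intro eventually_nhds_in_open) auto
  then have "eventually (\<lambda>s. truncated \<gamma> \<delta> s = \<gamma> s) (nhds t)"
    by eventually_elim (auto simp: truncated_def cutoff_indicator)
  then have "D t = deriv \<gamma> t" by (intro deriv_cong_ev) auto
  then show ?thesis using True t by (simp add: K_def cutoff_indicator)
next
  case False
  then have "eventually (\<lambda>s. s \<in> {..<cut}) (nhds t)"
    using t by (intro eventually_nhds_in_open) auto
  then have "eventually (\<lambda>s. truncated \<gamma> \<delta> s = 0) (nhds t)"
  proof eventually_elim
    case (elim s)
    have "0 \<le> \<delta>\<^sup>2 / 2" by simp
    with elim have "s \<le> 1" unfolding lessThan_iff by linarith
    then show ?case using elim by (simp add: truncated_def cutoff_indicator)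
  qed
  then have "D t = deriv (\<lambda>_. 0) t" by (intro deriv_cong_ev) auto
  then show ?thesis using False t by (simp add: K_def cutoff_indicator)
qed

lemma set_integrable_K_iff: "set_integrable lborel {-1<..<1} (\<lambda>t. K t * q t) \<longleftrightarrow> set_integrable lborel {-1<..<1} (\<lambda>t. D t * q t)"
  unfolding set_integrable_def
  by (rule integrable_discrete_difference[where X = "{cut}"]) (auto simp: K_eq_D indicator_def)

lemma set_integral_K: "(LBINT t:{-1<..<1}. K t * q t) = (LBINT t:{-1<..<1}. D t * q t)"
  unfolding set_lebesgue_integral_def
  by (rule integral_discrete_difference[where X = "{cut}"]) (auto simp: K_eq_D indicator_def)

lemma one_minus_square_pos: "t \<in> {-1<..<1} \<Longrightarrow> 0 < 1 - t\<^sup>2" for t :: real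
  by (auto simp: abs_square_less_1 abs_less_iff)

lemma K_sqrt_integrable: "set_integrable lborel {-1<..<1} (\<lambda>t. K t * sqrt (1 - t\<^sup>2))"
  unfolding set_integrable_K_iff using deriv_integrable by (simp add: mult.commute)

lemma K_measurable: "(\<lambda>t. indicator {-1<..<1} t * K t) \<in> borel_measurable borel"
proof -
  have "(\<lambda>t. (indicator {-1<..<1} t *\<^sub>R (K t * sqrt (1 - t\<^sup>2))) / sqrt (1 - t\<^sup>2)) \<in> borel_measurable borel"
    using K_sqrt_integrable unfolding set_integrable_def by (intro borel_measurable_divide) auto
  also have "(\<lambda>t. (indicator {-1<..<1} t *\<^sub>R (K t * sqrt (1 - t\<^sup>2))) / sqrt (1 - t\<^sup>2)) = (\<lambda>t. indicator {-1<..<1} t * K t)"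
    using one_minus_square_pos by (force simp: fun_eq_iff indicator_def)
  finally show ?thesis .
qed

text \<open>The comparison of q with \<rho> is asked only where \<open>K\<close> is nonzero, so that
  the support of the truncated kernel can be exploited.\<close>

lemma K_integrable_bound:
  assumes \<rho>: "set_integrable lborel {-1<..<1} (\<lambda>t. K t * \<rho> t)" and q: "continuous_on UNIV q"
    and bound: "\<And>t. t \<in> {-1<..<1} \<Longrightarrow> K t \<noteq> 0 \<Longrightarrow> \<bar>q t\<bar> \<le> C * \<bar>\<rho> t\<bar>"
  shows "set_integrable lborel {-1<..<1} (\<lambda>t. K t * q t)"
  unfolding set_integrable_def
proof (rule Bochner_Integration.integrable_bound)
  show "integrable lborel (\<lambda>t. C * (indicator {-1<..<1} t *\<^sub>R (K t * \<rho> t)))"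
    using \<rho> unfolding set_integrable_def by (rule integrable_mult_right)
  have "(\<lambda>t. (indicator {-1<..<1} t * K t) * q t) \<in> borel_measurable lborel"
    using K_measurable borel_measurable_continuous_onI[OF q] by simp
  then show "(\<lambda>t. indicator {-1<..<1} t *\<^sub>R (K t * q t)) \<in> borel_measurable lborel"
    by (simp add: mult.assoc)
  show "AE t in lborel. norm (indicator {-1<..<1} t *\<^sub>R (K t * q t)) \<le> norm (C * (indicator {-1<..<1} t *\<^sub>R (K t * \<rho> t)))"
  proof (rule AE_I2)
    fix t
    show "norm (indicator {-1<..<1} t *\<^sub>R (K t * q t)) \<le> norm (C * (indicator {-1<..<1} t *\<^sub>R (K t * \<rho> t)))"
    proof (cases "t \<in> {-1<..<1}")
      case True
      have "\<bar>K t\<bar> * \<bar>q t\<bar> \<le> \<bar>K t\<bar> * (\<bar>C\<bar> * \<bar>\<rho> t\<bar>)"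
      proof (cases "K t = 0")
        case False
        have "C * \<bar>\<rho> t\<bar> \<le> \<bar>C\<bar> * \<bar>\<rho> t\<bar>" by (intro mult_right_mono) auto
        then show ?thesis using bound[OF True False] by (intro mult_left_mono) auto
      qed simp
      then show ?thesis using True by (simp add: abs_mult mult_ac)
    qed simp
  qed
qed

abbreviation p where "p \<equiv> poly (legendre l)"
abbreviation p' where "p' \<equiv> poly (pderiv (legendre l))"

text \<open>Integration by parts with the test polynomial P_l': the derivative of (1 - t^2) P_l' is
  -l(l+1) P_l by Legendre's equation, and the two minus signs cancel.\<close>

lemma K_radial:
  "set_integrable lborel {-1<..<1} (\<lambda>t. K t * ((1 - t\<^sup>2) * p' t))"
  "2 * pi * (LBINT t:{-1<..<1}. K t * ((1 - t\<^sup>2) * p' t)) = real (l * (l + 1)) * legendre_coeff l (truncated \<gamma> \<delta>)"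
proof -
  obtain C where C: "0 \<le> C" "\<And>t. -1 \<le> t \<Longrightarrow> t \<le> 1 \<Longrightarrow> \<bar>p' t\<bar> \<le> C"
    using poly_bounded_on_Icc[of "-1" 1 "pderiv (legendre l)"] by blast
  show "set_integrable lborel {-1<..<1} (\<lambda>t. K t * ((1 - t\<^sup>2) * p' t))"
  proof (rule K_integrable_bound[OF K_sqrt_integrable])
    show "continuous_on UNIV (\<lambda>t. (1 - t\<^sup>2) * p' t)" by (intro continuous_intros)
    fix t :: real assume t: "t \<in> {-1<..<1}"
    have "1 - t\<^sup>2 \<le> sqrt (1 - t\<^sup>2)"
      using one_minus_square_pos[OF t] by (intro real_le_rsqrt) (simp add: power2_eq_square mult_left_le)
    then have "\<bar>1 - t\<^sup>2\<bar> * \<bar>p' t\<bar> \<le> sqrt (1 - t\<^sup>2) * C"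
      using one_minus_square_pos[OF t] C t by (intro mult_mono) auto
    then show "\<bar>(1 - t\<^sup>2) * p' t\<bar> \<le> C * \<bar>sqrt (1 - t\<^sup>2)\<bar>"
      using one_minus_square_pos[OF t] by (simp add: abs_mult mult.commute)
  qed
  have "(LBINT t:{-1<..<1}. K t * ((1 - t\<^sup>2) * p' t)) =
      - (LBINT t:{-1<..<1}. truncated \<gamma> \<delta> t * ((1 - t\<^sup>2) * poly (pderiv (pderiv (legendre l))) t - 2 * t * p' t))"
    unfolding set_integral_K by (rule weak_derivative_parts[OF weak kernel_integrable deriv_integrable])
  also have "(\<lambda>t. (1 - t\<^sup>2) * poly (pderiv (pderiv (legendre l))) t - 2 * t * p' t) = (\<lambda>t. - (real (l * (l + 1)) * p t))"
    using legendre_ode[of _ l] by (auto simp: fun_eq_iff eq_neg_iff_add_eq_0)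
  also have "- (LBINT t:{-1<..<1}. truncated \<gamma> \<delta> t * - (real (l * (l + 1)) * p t))
      = real (l * (l + 1)) * (LBINT t:{-1<..<1}. p t * truncated \<gamma> \<delta> t)"
    by (subst set_integral_mult_right[symmetric])
       (simp add: set_lebesgue_integral_def mult_ac flip: integral_minus)
  finally show "2 * pi * (LBINT t:{-1<..<1}. K t * ((1 - t\<^sup>2) * p' t)) = real (l * (l + 1)) * legendre_coeff l (truncated \<gamma> \<delta>)"
    by (simp add: legendre_coeff_def)
qed

lemma K_quot:
  "set_integrable lborel {-1<..<1} (\<lambda>t. K t * legendre_quot l t)"
  "l \<noteq> 0 \<Longrightarrow> 2 * pi * (LBINT t:{-1<..<1}. K t * legendre_quot l t) = legendre_coeff l (truncated \<gamma> \<delta>)"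
proof -
  have eq: "(\<lambda>t. K t * legendre_quot l t) = (\<lambda>t. K t * ((1 - t\<^sup>2) * p' t) / real (l * (l + 1)))"
    by (simp add: legendre_quot_def fun_eq_iff)
  show "set_integrable lborel {-1<..<1} (\<lambda>t. K t * legendre_quot l t)"
    unfolding eq by (intro set_integrable_divide K_radial)
  assume l: "l \<noteq> 0"
  have "2 * pi * (LBINT t:{-1<..<1}. K t * legendre_quot l t) = (2 * pi * (LBINT t:{-1<..<1}. K t * ((1 - t\<^sup>2) * p' t))) / real (l * (l + 1))"
    unfolding eq set_integral_divide_zero by simp
  also have "\<dots> = legendre_coeff l (truncated \<gamma> \<delta>)"
    unfolding K_radial(2) using l by (simp del: of_nat_mult of_nat_add)
  finally show "2 * pi * (LBINT t:{-1<..<1}. K t * legendre_quot l t) = legendre_coeff l (truncated \<gamma> \<delta>)" .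
qed

definition chord_integrable where
  "chord_integrable \<longleftrightarrow> set_integrable lborel {-1<..<1} (\<lambda>t. K t * (1 - t))"

text \<open>For \<delta> < 2 the kernel lives on t \<ge> \<open>cut\<close> > -1, where 1 + t is
  bounded below, so that 1 - t is at most a multiple of sqrt (1 - t^2).\<close>

lemma chord_integrableI:
  assumes "\<delta> = 2 \<longrightarrow> set_integrable lborel {-1<..<1} (\<lambda>t. (1 - t) * D t)"
  shows chord_integrable
proof (cases "\<delta> = 2")
  case True
  then show ?thesis
    using assms unfolding chord_integrable_def set_integrable_K_iff by (simp add: mult.commute)
next
  case False
  then have "\<delta> < 2" using \<delta> by simp
  then have "\<delta>\<^sup>2 < 2\<^sup>2" using \<delta> by (intro power_strict_mono) auto
  then have c: "-1 < cut" by simp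
  \<comment> \<open>This constant comes from sqrt (1 - t) \<le> sqrt 2 and from sqrt (1 + cut) \<le>
    sqrt (1 + t) on the support of \<open>K\<close>.\<close>
  define C where "C = sqrt 2 / sqrt (1 + cut)"
  show ?thesis
    unfolding chord_integrable_def
  proof (rule K_integrable_bound[OF K_sqrt_integrable])
    show "continuous_on UNIV (\<lambda>t :: real. 1 - t)" by (intro continuous_intros)
    fix t :: real assume t: "t \<in> {-1<..<1}" and nz: "K t \<noteq> 0"
    have ct: "cut \<le> t" using nz t by (auto simp: K_def cutoff_indicator split: if_splits)
    have "(1 - t) * sqrt (1 + cut) \<le> (sqrt (1 - t) * sqrt 2) * sqrt (1 + t)"
    proof (rule mult_mono)
      have "1 - t = sqrt (1 - t) * sqrt (1 - t)" using t by simp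
      also have "\<dots> \<le> sqrt (1 - t) * sqrt 2" using t by (intro mult_left_mono) auto
      finally show "1 - t \<le> sqrt (1 - t) * sqrt 2" .
    qed (use t ct c in auto)
    also have "\<dots> = sqrt 2 * sqrt (1 - t\<^sup>2)"
      by (simp add: real_sqrt_mult[symmetric] power2_eq_square algebra_simps)
    finally have "1 - t \<le> C * sqrt (1 - t\<^sup>2)"
      using c by (simp add: C_def field_simps)
    then show "\<bar>1 - t\<bar> \<le> C * \<bar>sqrt (1 - t\<^sup>2)\<bar>"
      using t one_minus_square_pos[OF t] by simp
  qed
qed

text \<open>The chord length behaves like sqrt (1 - t^2) near t = 1 and like 1 - t near t = -1; up
  to the factor sqrt 2 the sum of the two dominates it.\<close>

lemma K_chord_sqrt_integrable:
  assumes chord_integrable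
  shows "set_integrable lborel {-1<..<1} (\<lambda>t. K t * sqrt (2 * (1 - t)))"
proof -
  have "set_integrable lborel {-1<..<1} (\<lambda>t. K t * sqrt (1 - t\<^sup>2) + K t * (1 - t))"
    using assms K_sqrt_integrable unfolding chord_integrable_def by (intro set_integral_add)
  then have "set_integrable lborel {-1<..<1} (\<lambda>t. K t * (sqrt (1 - t\<^sup>2) + (1 - t)))"
    by (simp add: distrib_left)
  then show ?thesis
  proof (rule K_integrable_bound)
    show "continuous_on UNIV (\<lambda>t. sqrt (2 * (1 - t)))" by (intro continuous_intros)
    fix t :: real assume t: "t \<in> {-1<..<1}"
    have "sqrt (1 - t) \<le> sqrt (1 - t\<^sup>2) + (1 - t)"
    proof (cases "0 \<le> t")
      case True
      have "1 - t \<le> 1 - t\<^sup>2" using True t by (simp add: power2_eq_square mult_left_le)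
      then have "sqrt (1 - t) \<le> sqrt (1 - t\<^sup>2)" by simp
      then show ?thesis using t unfolding greaterThanLessThan_iff by linarith
    next
      case False
      have "sqrt (1 - t) \<le> 1 - t" using False by (intro real_le_lsqrt) (auto simp: power2_eq_square)
      then show ?thesis using one_minus_square_pos[OF t] by (simp add: add_nonneg_eq_0_iff add_increasing)
    qed
    then have "sqrt 2 * sqrt (1 - t) \<le> sqrt 2 * (sqrt (1 - t\<^sup>2) + (1 - t))" by (intro mult_left_mono) auto
    then show "\<bar>sqrt (2 * (1 - t))\<bar> \<le> sqrt 2 * \<bar>sqrt (1 - t\<^sup>2) + (1 - t)\<bar>"
      using t one_minus_square_pos[OF t] by (simp add: real_sqrt_mult del: distrib_left_numeral right_diff_distrib_numeral)
  qed
qed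

text \<open>The degree n is free because n = l and n = 0 both occur; the latter comes from the value
  of the field at x, which is constant in y.\<close>

lemma K_chord:
  assumes chord_integrable
  shows "set_integrable lborel {-1<..<1} (\<lambda>t. K t * ((1 - t) * poly (legendre n) t))"
    "2 * pi * (LBINT t:{-1<..<1}. K t * ((1 - t) * poly (legendre n) t)) = legendre_coeff n (\<lambda>t. (1 - t) * D t)"
proof -
  obtain C where C: "0 \<le> C" "\<And>t. -1 \<le> t \<Longrightarrow> t \<le> 1 \<Longrightarrow> \<bar>poly (legendre n) t\<bar> \<le> C"
    using poly_bounded_on_Icc[of "-1" 1 "legendre n"] by blast
  show "set_integrable lborel {-1<..<1} (\<lambda>t. K t * ((1 - t) * poly (legendre n) t))"
  proof (rule K_integrable_bound[OF assms[unfolded chord_integrable_def]])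
    show "continuous_on UNIV (\<lambda>t. (1 - t) * poly (legendre n) t)" by (intro continuous_intros)
    show "\<bar>(1 - t) * poly (legendre n) t\<bar> \<le> C * \<bar>1 - t\<bar>" if "t \<in> {-1<..<1}" for t
      using C(2)[of t] that by (simp add: abs_mult mult.commute mult_right_mono)
  qed
  show "2 * pi * (LBINT t:{-1<..<1}. K t * ((1 - t) * poly (legendre n) t)) = legendre_coeff n (\<lambda>t. (1 - t) * D t)"
    unfolding set_integral_K legendre_coeff_def by (simp add: mult_ac)
qed

end

section \<open>The nonlocal operators\<close>

context nonlocal_setting
begin

abbreviation sg where "sg \<equiv> sgrad l P"
abbreviation L where "L \<equiv> \<Lambda> \<gamma> \<delta> l"
abbreviation q where "q \<equiv> legendre_quot l"

lemma cpoly_P: "cpoly P" using P by (simp add: solid_harmonic_def)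

lemma partial_deriv_zero_at: "l = 0 \<Longrightarrow> partial_deriv i P x = 0"
  by (simp add: P0)

lemma sgrad_zero: "l = 0 \<Longrightarrow> sg y = 0"
  by (simp add: vec_eq_iff sgrad_nth P0)

lemma norm_x: "norm x = 1"
  using unit(1) by (simp add: norm_eq_1)

text \<open>In the first case \<open>h\<close> vanishes at both poles \<open>x\<close> and \<open>-x\<close>, in the second only at \<open>x\<close>; without
  integrability of the kernel at \<open>-x\<close> the last two terms of the mean cannot be integrated.\<close>

lemma zonal_value:
  fixes A B C E :: complex
  assumes h: "zonal_bounded x \<rho> h"
    and mean: "\<And>\<theta>. 0 < \<theta> \<Longrightarrow> \<theta> < pi \<Longrightarrow> cmean h \<theta> = (2 * pi) *\<^sub>R (
        complex_of_real ((1 - (cos \<theta>)\<^sup>2) * p' (cos \<theta>)) * A + complex_of_real (q (cos \<theta>)) * B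
      + complex_of_real ((1 - cos \<theta>) * p (cos \<theta>)) * C + complex_of_real (1 - cos \<theta>) * E)"
    and B: "l = 0 \<Longrightarrow> B = 0"
    and \<rho>: "\<rho> = (\<lambda>t. sqrt (1 - t\<^sup>2)) \<and> C = 0 \<and> E = 0 \<or> \<rho> = (\<lambda>t. sqrt (2 * (1 - t))) \<and> chord_integrable"
  shows "integrable \<Omega> (\<lambda>y. K (x \<bullet> y) *\<^sub>R h y)"
    and "(LINT y|\<Omega>. K (x \<bullet> y) *\<^sub>R h y) = of_nat (l * (l + 1)) * L * A + L * B + \<Theta> \<gamma> \<delta> l * C + \<Theta> \<gamma> \<delta> 0 * E"
proof -
  define m where "m t = (2 * pi) *\<^sub>R (
        complex_of_real ((1 - t\<^sup>2) * p' t) * A + complex_of_real (q t) * B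
      + complex_of_real ((1 - t) * p t) * C + complex_of_real (1 - t) * E)" for t
  obtain c where hc: "continuous_on S2 h" and c: "\<And>y. y \<in> S2 \<Longrightarrow> norm (h y) \<le> c * \<rho> (x \<bullet> y)"
    using h unfolding zonal_bounded_def by blast
  have i: "set_integrable lborel {-1<..<1} (\<lambda>t. K t * \<rho> t)"
    using \<rho> K_sqrt_integrable K_chord_sqrt_integrable by auto
  have "continuous_on UNIV m"
    unfolding m_def legendre_quot_def divide_inverse by (intro continuous_intros)
  then have mm: "m \<in> borel_measurable borel" by (rule borel_measurable_continuous_onI)
  have cm: "cmean h \<theta> = m (cos \<theta>)" if "0 < \<theta>" "\<theta> < pi" for \<theta>
    unfolding m_def by (rule mean[OF that])
  note z = zonal_integral[OF \<mu> K_measurable i hc c mm cm]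
  show "integrable \<Omega> (\<lambda>y. K (x \<bullet> y) *\<^sub>R h y)" by (rule z(1))
  have z2: "(LINT y|\<Omega>. K (x \<bullet> y) *\<^sub>R h y) = (LBINT t:{-1<..<1}. K t *\<^sub>R m t)" by (rule z(2))
  \<comment> \<open>Integrability is asked only for nonzero coefficients: with the weight sqrt (1 -
    t^2) the chord moments need not exist, but then C = E = 0.\<close>
  have hb: "has_bochner_integral lborel (\<lambda>t. indicator {-1<..<1} t *\<^sub>R (complex_of_real (2 * pi * (K t * f t)) * k)) (complex_of_real (2 * pi * (LBINT t:{-1<..<1}. K t * f t)) * k)"
    if "k \<noteq> 0 \<Longrightarrow> set_integrable lborel {-1<..<1} (\<lambda>t. K t * f t)" for f k
  proof (cases "k = 0")
    case False
    have "has_bochner_integral lborel (\<lambda>t. indicator {-1<..<1} t *\<^sub>R (K t * f t)) (LBINT t:{-1<..<1}. K t * f t)"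
      using that[OF False] unfolding set_integrable_def set_lebesgue_integral_def by (rule has_bochner_integral_integrable)
    then have "has_bochner_integral lborel (\<lambda>t. complex_of_real (2 * pi * (indicator {-1<..<1} t *\<^sub>R (K t * f t))) * k)
        (complex_of_real (2 * pi * (LBINT t:{-1<..<1}. K t * f t)) * k)"
      by (intro has_bochner_integral_mult_left has_bochner_integral_of_real has_bochner_integral_mult_right)
    then show ?thesis
      by (rule back_subst[of "\<lambda>F. has_bochner_integral lborel F _"]) (auto simp: fun_eq_iff indicator_def)
  qed (simp add: has_bochner_integral_zero)
  have CE: "C \<noteq> 0 \<or> E \<noteq> 0 \<Longrightarrow> chord_integrable" using \<rho> by auto
  \<comment> \<open>The polynomial P_0 = 1 is inserted into the last term to give it the shape of a
    chord moment.\<close>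
  have "has_bochner_integral lborel (\<lambda>t. indicator {-1<..<1} t *\<^sub>R (complex_of_real (2 * pi * (K t * ((1 - t\<^sup>2) * p' t))) * A)
      + indicator {-1<..<1} t *\<^sub>R (complex_of_real (2 * pi * (K t * q t)) * B)
      + indicator {-1<..<1} t *\<^sub>R (complex_of_real (2 * pi * (K t * ((1 - t) * p t))) * C)
      + indicator {-1<..<1} t *\<^sub>R (complex_of_real (2 * pi * (K t * ((1 - t) * poly (legendre 0) t))) * E))
     (complex_of_real (2 * pi * (LBINT t:{-1<..<1}. K t * ((1 - t\<^sup>2) * p' t))) * A
      + complex_of_real (2 * pi * (LBINT t:{-1<..<1}. K t * q t)) * B
      + complex_of_real (2 * pi * (LBINT t:{-1<..<1}. K t * ((1 - t) * p t))) * C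
      + complex_of_real (2 * pi * (LBINT t:{-1<..<1}. K t * ((1 - t) * poly (legendre 0) t))) * E)"
    by (intro has_bochner_integral_add hb K_radial(1) K_quot(1) K_chord(1) CE) auto
  moreover have "indicator {-1<..<1} t *\<^sub>R (complex_of_real (2 * pi * (K t * ((1 - t\<^sup>2) * p' t))) * A)
      + indicator {-1<..<1} t *\<^sub>R (complex_of_real (2 * pi * (K t * q t)) * B)
      + indicator {-1<..<1} t *\<^sub>R (complex_of_real (2 * pi * (K t * ((1 - t) * p t))) * C)
      + indicator {-1<..<1} t *\<^sub>R (complex_of_real (2 * pi * (K t * ((1 - t) * poly (legendre 0) t))) * E)
     = indicator {-1<..<1} t *\<^sub>R (K t *\<^sub>R m t)" for t
    unfolding scaleR_add_right[symmetric]
    by (rule arg_cong[where f = "scaleR _"]) (simp add: m_def legendre_0 scaleR_conv_of_real[where 'a = complex] algebra_simps)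
  ultimately have "(LBINT t:{-1<..<1}. K t *\<^sub>R m t) = complex_of_real (2 * pi * (LBINT t:{-1<..<1}. K t * ((1 - t\<^sup>2) * p' t))) * A
      + complex_of_real (2 * pi * (LBINT t:{-1<..<1}. K t * q t)) * B
      + complex_of_real (2 * pi * (LBINT t:{-1<..<1}. K t * ((1 - t) * p t))) * C
      + complex_of_real (2 * pi * (LBINT t:{-1<..<1}. K t * ((1 - t) * poly (legendre 0) t))) * E"
    unfolding set_lebesgue_integral_def by (simp add: has_bochner_integral_integral_eq)
  also have "complex_of_real (2 * pi * (LBINT t:{-1<..<1}. K t * ((1 - t\<^sup>2) * p' t))) * A = of_nat (l * (l + 1)) * L * A"
    unfolding K_radial(2) \<Lambda>_def by (simp only: of_real_mult of_real_of_nat_eq)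
  \<comment> \<open>In degree 0 the quotient moment is 0 and not \<Lambda>; there both sides vanish
    because B does.\<close>
  also have "complex_of_real (2 * pi * (LBINT t:{-1<..<1}. K t * q t)) * B = L * B"
    using K_quot(2) B by (cases "l = 0") (simp_all only: \<Lambda>_def mult_zero_right simp_thms)
  also have "complex_of_real (2 * pi * (LBINT t:{-1<..<1}. K t * ((1 - t) * p t))) * C = \<Theta> \<gamma> \<delta> l * C"
    using K_chord(2)[OF CE, of l] by (cases "C = 0") (simp_all only: \<Theta>_def mult_zero_right simp_thms)
  also have "complex_of_real (2 * pi * (LBINT t:{-1<..<1}. K t * ((1 - t) * poly (legendre 0) t))) * E = \<Theta> \<gamma> \<delta> 0 * E"
    using K_chord(2)[OF CE, of 0] by (cases "E = 0") (simp_all only: \<Theta>_def mult_zero_right simp_thms)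
  finally show "(LINT y|\<Omega>. K (x \<bullet> y) *\<^sub>R h y) = of_nat (l * (l + 1)) * L * A + L * B + \<Theta> \<gamma> \<delta> l * C + \<Theta> \<gamma> \<delta> 0 * E"
    unfolding z2 .
qed

lemma zonal_value_vec:
  fixes A B C E :: "complex^3"
  assumes h: "\<And>k. zonal_bounded x \<rho> (\<lambda>y. h y $ k)"
    and mean: "\<And>\<theta>. 0 < \<theta> \<Longrightarrow> \<theta> < pi \<Longrightarrow> vmean h \<theta> = (2 * pi) *\<^sub>R (
        complex_of_real ((1 - (cos \<theta>)\<^sup>2) * p' (cos \<theta>)) *s A + complex_of_real (q (cos \<theta>)) *s B
      + complex_of_real ((1 - cos \<theta>) * p (cos \<theta>)) *s C + complex_of_real (1 - cos \<theta>) *s E)"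
    and B: "l = 0 \<Longrightarrow> B = 0"
    and \<rho>: "\<rho> = (\<lambda>t. sqrt (1 - t\<^sup>2)) \<and> C = 0 \<and> E = 0 \<or> \<rho> = (\<lambda>t. sqrt (2 * (1 - t))) \<and> chord_integrable"
  shows "(LINT y|\<Omega>. K (x \<bullet> y) *\<^sub>R h y) = (of_nat (l * (l + 1)) * L) *s A + L *s B + \<Theta> \<gamma> \<delta> l *s C + \<Theta> \<gamma> \<delta> 0 *s E"
proof -
  have mk: "cmean (\<lambda>y. h y $ k) \<theta> = (2 * pi) *\<^sub>R (
        complex_of_real ((1 - (cos \<theta>)\<^sup>2) * p' (cos \<theta>)) * A $ k + complex_of_real (q (cos \<theta>)) * B $ k
      + complex_of_real ((1 - cos \<theta>) * p (cos \<theta>)) * C $ k + complex_of_real (1 - cos \<theta>) * E $ k)"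
    if "0 < \<theta>" "\<theta> < pi" for \<theta> k
  proof -
    have "cmean (\<lambda>y. h y $ k) \<theta> = vmean h \<theta> $ k" by (simp add: vmean_def)
    also have "\<dots> = (2 * pi) *\<^sub>R (
        complex_of_real ((1 - (cos \<theta>)\<^sup>2) * p' (cos \<theta>)) * A $ k + complex_of_real (q (cos \<theta>)) * B $ k
      + complex_of_real ((1 - cos \<theta>) * p (cos \<theta>)) * C $ k + complex_of_real (1 - cos \<theta>) * E $ k)"
      unfolding mean[OF that] by (simp add: left_diff_distrib)
    finally show ?thesis .
  qed
  have Bk: "l = 0 \<Longrightarrow> B $ k = 0" for k using B by simp
  have \<rho>k: "\<rho> = (\<lambda>t. sqrt (1 - t\<^sup>2)) \<and> C $ k = 0 \<and> E $ k = 0 \<or> \<rho> = (\<lambda>t. sqrt (2 * (1 - t))) \<and> chord_integrable" for k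
    using \<rho> by auto
  note v = zonal_value[OF h mk Bk \<rho>k]
  have "(LINT y|\<Omega>. K (x \<bullet> y) *\<^sub>R h y) $ k = of_nat (l * (l + 1)) * L * A $ k + L * B $ k + \<Theta> \<gamma> \<delta> l * C $ k + \<Theta> \<gamma> \<delta> 0 * E $ k" for k
    using integral_vec3(2)[of \<Omega> "\<lambda>y. K (x \<bullet> y) *\<^sub>R h y" k] v by simp
  then show ?thesis by (simp add: vec_eq_iff)
qed

section \<open>The operators as integrals against the kernel \<open>K\<close>\<close>

lemma horizon_kernel: "y \<in> space \<Omega> \<Longrightarrow> horizon \<delta> x y * deriv \<gamma> (x \<bullet> y) = K (x \<bullet> y)"
  using norm_chord[OF norm_x, of y] by (simp add: horizon_def K_def space_Omega norm_minus_commute[of x])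

lemma horizon_kernel_sym: "y \<in> space \<Omega> \<Longrightarrow> horizon \<delta> x y * deriv \<gamma> (y \<bullet> x) = K (x \<bullet> y)"
  using horizon_kernel[of y] by (simp add: inner_commute)

lemma x_sphere: "x \<in> space \<Omega>"
  by (simp add: space_Omega norm_x)

text \<open>The field is replaced by a representative that agrees with it on the sphere, and the
  common kernel is pulled out of both terms, as it depends symmetrically on x and y.\<close>

lemma nl_surf_div_eq:
  assumes V: "\<forall>y\<in>space \<Omega>. V y = W y"
  shows "nl_surf_div \<gamma> \<delta> V x = (LINT y|\<Omega>. K (x \<bullet> y) *\<^sub>R (W x \<bullet>\<^sub>c cvec (y - (x \<bullet> y) *\<^sub>R x) - W y \<bullet>\<^sub>c cvec (x - (x \<bullet> y) *\<^sub>R y)))"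
  unfolding nl_surf_div_def
proof (rule Bochner_Integration.integral_cong[OF refl])
  fix y assume y: "y \<in> space \<Omega>"
  have al: "cvec (\<alpha> \<gamma> v w) = deriv \<gamma> (v \<bullet> w) *\<^sub>R cvec (w - (v \<bullet> w) *\<^sub>R v)" for v w
    unfolding \<alpha>_def by (rule cvec_linear(3))
  have "horizon \<delta> x y *\<^sub>R (V x \<bullet>\<^sub>c cvec (\<alpha> \<gamma> x y) - V y \<bullet>\<^sub>c cvec (\<alpha> \<gamma> y x))
     = (horizon \<delta> x y * deriv \<gamma> (x \<bullet> y)) *\<^sub>R (V x \<bullet>\<^sub>c cvec (y - (x \<bullet> y) *\<^sub>R x))
      - (horizon \<delta> x y * deriv \<gamma> (y \<bullet> x)) *\<^sub>R (V y \<bullet>\<^sub>c cvec (x - (y \<bullet> x) *\<^sub>R y))"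
    by (simp only: al cdot_linear scaleR_diff_right scaleR_scaleR)
  then show "horizon \<delta> x y *\<^sub>R (V x \<bullet>\<^sub>c cvec (\<alpha> \<gamma> x y) - V y \<bullet>\<^sub>c cvec (\<alpha> \<gamma> y x)) =
     K (x \<bullet> y) *\<^sub>R (W x \<bullet>\<^sub>c cvec (y - (x \<bullet> y) *\<^sub>R x) - W y \<bullet>\<^sub>c cvec (x - (x \<bullet> y) *\<^sub>R y))"
    by (simp only: horizon_kernel[OF y] horizon_kernel_sym[OF y] bspec[OF V y] bspec[OF V x_sphere] scaleR_diff_right inner_commute[of y x])
qed

lemma nl_scalar_surf_curl_eq:
  assumes V: "\<forall>y\<in>space \<Omega>. V y = W y"
  shows "nl_scalar_surf_curl \<gamma> \<delta> V x = (LINT y|\<Omega>. K (x \<bullet> y) *\<^sub>R (- (W y \<bullet>\<^sub>c cvec (cross3 x y)) - W x \<bullet>\<^sub>c cvec (cross3 x y)))"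
  unfolding nl_scalar_surf_curl_def
proof (rule Bochner_Integration.integral_cong[OF refl])
  fix y assume y: "y \<in> space \<Omega>"
  \<comment> \<open>The parts of \<alpha> along x and along y drop out of the cross products, and y
    \<times> x = - (x \<times> y) gives both terms of the integrand the same sign.\<close>
  have c: "cross3 x (\<alpha> \<gamma> x y) = deriv \<gamma> (x \<bullet> y) *\<^sub>R cross3 x y" "cross3 y (\<alpha> \<gamma> y x) = deriv \<gamma> (y \<bullet> x) *\<^sub>R (- cross3 x y)"
    by (simp_all add: vec_eq_iff forall_3 cross3_nth \<alpha>_def algebra_simps)
  have "horizon \<delta> x y *\<^sub>R (V y \<bullet>\<^sub>c cvec (cross3 y (\<alpha> \<gamma> y x)) - V x \<bullet>\<^sub>c cvec (cross3 x (\<alpha> \<gamma> x y)))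
     = (horizon \<delta> x y * deriv \<gamma> (y \<bullet> x)) *\<^sub>R (V y \<bullet>\<^sub>c cvec (- cross3 x y)) - (horizon \<delta> x y * deriv \<gamma> (x \<bullet> y)) *\<^sub>R (V x \<bullet>\<^sub>c cvec (cross3 x y))"
    unfolding c cvec_linear(3)[of "deriv \<gamma> _"] cdot_linear scaleR_diff_right scaleR_scaleR ..
  moreover have "cvec (- v) = - cvec v" for v by (simp add: vec_eq_iff cvec_nth)
  ultimately show "horizon \<delta> x y *\<^sub>R (V y \<bullet>\<^sub>c cvec (cross3 y (\<alpha> \<gamma> y x)) - V x \<bullet>\<^sub>c cvec (cross3 x (\<alpha> \<gamma> x y))) =
     K (x \<bullet> y) *\<^sub>R (- (W y \<bullet>\<^sub>c cvec (cross3 x y)) - W x \<bullet>\<^sub>c cvec (cross3 x y))"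
    by (simp only: horizon_kernel[OF y] horizon_kernel_sym[OF y] bspec[OF V y] bspec[OF V x_sphere] scaleR_diff_right cdot_linear)
qed

lemma nl_surf_grad_eq:
  assumes u: "\<forall>y\<in>space \<Omega>. u y = w y"
  shows "nl_surf_grad \<gamma> \<delta> u x = (LINT y|\<Omega>. K (x \<bullet> y) *\<^sub>R ((w y - w x) *s cvec (y - (x \<bullet> y) *\<^sub>R x)))"
  unfolding nl_surf_grad_def
proof (rule Bochner_Integration.integral_cong[OF refl])
  fix y assume y: "y \<in> space \<Omega>"
  show "horizon \<delta> x y *\<^sub>R ((u y - u x) *s cvec (\<alpha> \<gamma> x y)) = K (x \<bullet> y) *\<^sub>R ((w y - w x) *s cvec (y - (x \<bullet> y) *\<^sub>R x))"
    unfolding horizon_kernel[OF y, symmetric] bspec[OF u y] bspec[OF u x_sphere] \<alpha>_def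
    by (simp add: vec_eq_iff cvec_nth scaleR_conv_of_real[where 'a = complex] algebra_simps)
qed

lemma nl_vector_surf_curl_eq:
  assumes u: "\<forall>y\<in>space \<Omega>. u y = w y"
  shows "nl_vector_surf_curl \<gamma> \<delta> u x = (LINT y|\<Omega>. K (x \<bullet> y) *\<^sub>R ((w y - w x) *s cvec (cross3 x y)))"
  unfolding nl_vector_surf_curl_def
proof (rule Bochner_Integration.integral_cong[OF refl])
  fix y assume y: "y \<in> space \<Omega>"
  have c: "cross3 x (\<alpha> \<gamma> x y) = deriv \<gamma> (x \<bullet> y) *\<^sub>R cross3 x y"
    by (simp_all add: vec_eq_iff forall_3 cross3_nth \<alpha>_def algebra_simps)
  show "horizon \<delta> x y *\<^sub>R ((u y - u x) *s cvec (cross3 x (\<alpha> \<gamma> x y))) = K (x \<bullet> y) *\<^sub>R ((w y - w x) *s cvec (cross3 x y))"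
    unfolding horizon_kernel[OF y, symmetric] bspec[OF u y] bspec[OF u x_sphere] c
    by (simp add: vec_eq_iff cvec_nth scaleR_conv_of_real[where 'a = complex] algebra_simps)
qed

lemma kernel_\<beta>: "y \<in> space \<Omega> \<Longrightarrow> horizon \<delta> x y *\<^sub>R (cvec (\<beta> \<gamma> x y) \<times>\<^sub>c v) = K (x \<bullet> y) *\<^sub>R (cvec (y - x) \<times>\<^sub>c v)"
  unfolding \<beta>_def cvec_linear(3)[of "deriv \<gamma> _"] ccross_linear(7) scaleR_scaleR horizon_kernel ..

lemma nl_curl_eq:
  assumes V: "\<forall>y\<in>space \<Omega>. V y = W y"
  shows "nl_curl \<gamma> \<delta> V x = (LINT y|\<Omega>. K (x \<bullet> y) *\<^sub>R (cvec (y - x) \<times>\<^sub>c (W y - W x)))"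
  unfolding nl_curl_def
  by (rule Bochner_Integration.integral_cong[OF refl]) (simp only: kernel_\<beta> bspec[OF V] bspec[OF V x_sphere])

lemma nl_curl_adj_eq:
  assumes V: "\<forall>y\<in>space \<Omega>. V y = W y"
  shows "nl_curl_adj \<gamma> \<delta> V x = (LINT y|\<Omega>. K (x \<bullet> y) *\<^sub>R (cvec (y - x) \<times>\<^sub>c (W x + W y)))"
  unfolding nl_curl_adj_def
  by (rule Bochner_Integration.integral_cong[OF refl]) (simp only: kernel_\<beta> bspec[OF V] bspec[OF V x_sphere])

lemma ccross_dot_self: "(v \<times>\<^sub>c w) \<bullet>\<^sub>c v = 0"
  by (simp add: cdot_def sum_3 ccross_nth algebra_simps)

lemma ccross_dot_cyclic: "(v \<times>\<^sub>c w) \<bullet>\<^sub>c z = (z \<times>\<^sub>c v) \<bullet>\<^sub>c w"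
  by (simp add: cdot_def sum_3 ccross_nth algebra_simps)

lemma cdot_ccross_cyclic: "v \<bullet>\<^sub>c (w \<times>\<^sub>c z) = w \<bullet>\<^sub>c (z \<times>\<^sub>c v)"
  by (simp add: cdot_def sum_3 ccross_nth algebra_simps)

lemma sphere_norm: "y \<in> space \<Omega> \<Longrightarrow> norm y = 1" "y \<in> S2 \<Longrightarrow> norm y = 1"
  by (simp_all add: space_Omega)

lemma sg_tangent: "norm y = 1 \<Longrightarrow> cvec y \<bullet>\<^sub>c sg y = 0" "norm y = 1 \<Longrightarrow> sg y \<bullet>\<^sub>c cvec y = 0"
  using sgrad_tangent[OF P] by (simp_all add: cdot_commute)

lemma vpoly_fields: "vpoly sg" "vpoly cvec" "vpoly (\<lambda>y. cvec y \<times>\<^sub>c sg y)" "vpoly (\<lambda>y. P y *s cvec y)" "vpoly (\<lambda>y. P y *s cvec (cross3 x y))"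
proof -
  show 1: "vpoly sg" by (rule vpoly_sgrad[OF cpoly_P])
  show 2: "vpoly cvec" by (rule vpoly_ops)
  show "vpoly (\<lambda>y. cvec y \<times>\<^sub>c sg y)" by (rule vpoly_ccross[OF 2 1])
  show "vpoly (\<lambda>y. P y *s cvec y)" using cpoly_P by (simp add: vpoly_def cvec_nth cpoly_intros)
  show "vpoly (\<lambda>y. P y *s cvec (cross3 x y))"
    using cpoly_P unfolding vpoly_def cvec_cross3 forall_3 vector_smult_component ccross_nth cvec_nth by (auto intro!: cpoly_intros)
qed

lemma vpoly_cross: "vpoly (\<lambda>y. cvec (cross3 x y))"
  unfolding cvec_cross3 by (intro vpoly_ccross vpoly_ops)

lemma vpoly_continuous: "vpoly F \<Longrightarrow> continuous_on S2 (\<lambda>y. F y $ k)"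
  by (simp add: vpoly_def cpoly_continuous_on)

abbreviation \<rho>\<^sub>1 where "\<rho>\<^sub>1 \<equiv> (\<lambda>t :: real. sqrt (1 - t\<^sup>2))"
abbreviation \<rho>\<^sub>2 where "\<rho>\<^sub>2 \<equiv> (\<lambda>t :: real. sqrt (2 * (1 - t)))"

lemma zonal_bounded_projection: "zonal_bounded x \<rho>\<^sub>1 (\<lambda>y. cvec (y - (x \<bullet> y) *\<^sub>R x) $ k)"
  by (rule zonal_bounded_cvec) (auto intro!: continuous_intros simp: norm_projection[OF norm_x])

lemma zonal_bounded_projection': "zonal_bounded x \<rho>\<^sub>1 (\<lambda>y. cvec (x - (x \<bullet> y) *\<^sub>R y) $ k)"
proof (rule zonal_bounded_cvec)
  show "norm (x - (x \<bullet> y) *\<^sub>R y) \<le> sqrt (1 - (x \<bullet> y)\<^sup>2)" if "y \<in> S2" for y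
    using norm_projection[OF sphere_norm(2)[OF that] norm_x] by (simp add: inner_commute)
qed (intro continuous_intros)

lemma zonal_bounded_cross: "zonal_bounded x \<rho>\<^sub>1 (\<lambda>y. cvec (cross3 x y) $ k)"
proof (rule zonal_bounded_cvec)
  show "continuous_on S2 (\<lambda>y. cross3 x y)" by (intro continuous_on_cross continuous_intros)
  show "norm (cross3 x y) \<le> sqrt (1 - (x \<bullet> y)\<^sup>2)" if "y \<in> S2" for y
  proof -
    have "(norm (cross3 x y))\<^sup>2 = 1 - (x \<bullet> y)\<^sup>2"
      using norm_cross_dot[of x y] norm_x sphere_norm(2)[OF that] by simp
    then show ?thesis by (metis norm_ge_zero order_refl real_sqrt_abs abs_of_nonneg)
  qed
qed

lemma zonal_bounded_chord: "zonal_bounded x \<rho>\<^sub>2 (\<lambda>y. cvec (y - x) $ k)"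
  by (rule zonal_bounded_cvec) (auto intro!: continuous_intros simp: norm_chord[OF norm_x])

context
  fixes \<theta> :: real
  assumes \<theta>: "0 < \<theta>" "\<theta> < pi"
begin

lemma vm_cvec: "vmean cvec \<theta> = (2 * pi * cos \<theta>) *\<^sub>R cvec x"
  by (rule vmean_cvec) (use \<theta> in auto)

lemma vm_sg: "vmean sg \<theta> = (2 * pi) *\<^sub>R (complex_of_real ((1 - (cos \<theta>)\<^sup>2) * p' (cos \<theta>)) *s (P x *s cvec x)
    + complex_of_real (cos \<theta> * p (cos \<theta>) + q (cos \<theta>)) *s sg x)"
  using cmean_sgrad[OF P partial_deriv_zero_at \<theta>]
  by (simp add: vmean_def vec_eq_iff cvec_nth scaleR_conv_of_real[where 'a = complex] algebra_simps)

lemma vm_rot: "vmean (\<lambda>y. cvec y \<times>\<^sub>c sg y) \<theta> = (2 * pi * p (cos \<theta>)) *\<^sub>R (cvec x \<times>\<^sub>c sg x)"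
  using cmean_rot_sgrad[OF P, of \<theta>] \<theta>
  by (simp add: vmean_def vec_eq_iff scaleR_conv_of_real[where 'a = complex])

lemma vm_cross_sg: "vmean (\<lambda>y. cvec x \<times>\<^sub>c sg y) \<theta> = (2 * pi * (cos \<theta> * p (cos \<theta>) + q (cos \<theta>))) *\<^sub>R (cvec x \<times>\<^sub>c sg x)"
  using cmean_cross_sgrad[OF P partial_deriv_zero_at, of \<theta>] \<theta>
  by (simp add: vmean_def vec_eq_iff scaleR_conv_of_real[where 'a = complex])

lemma vm_cross_P: "vmean (\<lambda>y. P y *s cvec (cross3 x y)) \<theta> = (2 * pi * q (cos \<theta>)) *\<^sub>R (cvec x \<times>\<^sub>c sg x)"
  using cmean_cross_harmonic[OF P partial_deriv_zero_at, of \<theta>] \<theta>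
  by (simp add: vmean_def vec_eq_iff cvec_nth scaleR_conv_of_real[where 'a = complex] mult.commute[of "P _"])

lemma vm_cross: "vmean (\<lambda>y. cvec (cross3 x y)) \<theta> = 0"
  unfolding cvec_cross3 vmean_ccross_left[OF vpoly_fields(2)] vm_cvec
  by (simp add: vec_eq_iff forall_3 ccross_nth)

lemma cm_radial: "cmean (\<lambda>y. cvec x \<bullet>\<^sub>c sg y) \<theta> = (2 * pi) *\<^sub>R (complex_of_real ((1 - (cos \<theta>)\<^sup>2) * p' (cos \<theta>)) * P x)"
  using cmean_sgrad_radial[OF P \<theta>] by (simp add: scaleR_conv_of_real[where 'a = complex])

end

lemma zonal_mult_value:
  assumes h: "zonal_bounded x \<rho>\<^sub>1 h"
    and mean: "\<And>\<theta>. 0 < \<theta> \<Longrightarrow> \<theta> < pi \<Longrightarrow> cmean h \<theta> = (2 * pi) *\<^sub>R (complex_of_real ((1 - (cos \<theta>)\<^sup>2) * p' (cos \<theta>)) * A)"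
  shows "(LINT y|\<Omega>. K (x \<bullet> y) *\<^sub>R h y) = of_nat (l * (l + 1)) * L * A"
  using zonal_value(2)[of \<rho>\<^sub>1 h A 0 0 0] h mean by simp

lemma zonal_mult_value_vec:
  assumes h: "\<And>k. zonal_bounded x \<rho>\<^sub>1 (\<lambda>y. h y $ k)"
    and mean: "\<And>\<theta>. 0 < \<theta> \<Longrightarrow> \<theta> < pi \<Longrightarrow> vmean h \<theta> = (2 * pi * q (cos \<theta>)) *\<^sub>R B"
    and B: "l = 0 \<Longrightarrow> B = 0"
  shows "(LINT y|\<Omega>. K (x \<bullet> y) *\<^sub>R h y) = L *s B"
proof -
  have "(2 * pi * r) *\<^sub>R B = (2 * pi) *\<^sub>R (complex_of_real r *s B)" for r
    by (simp add: vec_eq_iff scaleR_conv_of_real[where 'a = complex])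
  then show ?thesis using zonal_value_vec[of \<rho>\<^sub>1 h 0 B 0 0] h mean B by simp
qed

section \<open>Surface divergence and scalar surface curl\<close>

context
  fixes u :: "real^3 \<Rightarrow> complex"
  assumes u: "\<forall>y\<in>S2. u y = P y"
begin

lemma grad_u: "\<forall>y\<in>space \<Omega>. surf_grad u y = sg y"
  using surf_grad_harmonic[OF P, of u] u by (simp add: space_Omega)

lemma rot_u: "\<forall>y\<in>space \<Omega>. rot_grad u y = cvec y \<times>\<^sub>c sg y"
  by (simp add: rot_grad_def grad_u)

lemma radial_u: "\<forall>y\<in>space \<Omega>. radial u y = P y *s cvec y"
  using u by (simp add: radial_def space_Omega)

lemma u_eq: "\<forall>y\<in>space \<Omega>. u y = P y"
  using u by (simp add: space_Omega)

lemma zonal_bounded_div_integrand: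
  assumes "vpoly F"
  shows "zonal_bounded x \<rho>\<^sub>1 (\<lambda>y. F x \<bullet>\<^sub>c cvec (y - (x \<bullet> y) *\<^sub>R x) - F y \<bullet>\<^sub>c cvec (x - (x \<bullet> y) *\<^sub>R y))"
  by (intro zonal_bounded_diff zonal_bounded_cdot zonal_bounded_projection zonal_bounded_projection' vpoly_continuous[OF assms] continuous_on_const)

lemma zonal_bounded_curl_integrand:
  assumes "vpoly F"
  shows "zonal_bounded x \<rho>\<^sub>1 (\<lambda>y. - (F y \<bullet>\<^sub>c cvec (cross3 x y)) - F x \<bullet>\<^sub>c cvec (cross3 x y))"
proof -
  have "zonal_bounded x \<rho>\<^sub>1 (\<lambda>y. (- F y) \<bullet>\<^sub>c cvec (cross3 x y) - F x \<bullet>\<^sub>c cvec (cross3 x y))"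
    using vpoly_continuous[OF assms]
    by (intro zonal_bounded_diff zonal_bounded_cdot zonal_bounded_cross continuous_on_const) (simp_all add: continuous_on_minus)
  then show ?thesis by (simp add: cdot_def sum_negf)
qed

text \<open>Tangency removes the projection terms. Of the remaining \<nabla>u(x) \<bullet> y - x
  \<bullet> \<nabla>u(y) only the second part has a nonzero mean, since y averages to a multiple of
  x.\<close>

lemma nl_surf_div_surf_grad: "nl_surf_div \<gamma> \<delta> (surf_grad u) x = - L * of_nat (l * (l + 1)) * u x"
proof -
  have "nl_surf_div \<gamma> \<delta> (surf_grad u) x = of_nat (l * (l + 1)) * L * (- P x)"
    unfolding nl_surf_div_eq[of "surf_grad u" sg, OF grad_u]
  proof (rule zonal_mult_value[OF zonal_bounded_div_integrand[OF vpoly_fields(1)]])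
    fix \<theta> :: real assume \<theta>: "0 < \<theta>" "\<theta> < pi"
    have "cmean (\<lambda>y. sg x \<bullet>\<^sub>c cvec (y - (x \<bullet> y) *\<^sub>R x) - sg y \<bullet>\<^sub>c cvec (x - (x \<bullet> y) *\<^sub>R y)) \<theta>
       = cmean (\<lambda>y. sg x \<bullet>\<^sub>c cvec y - cvec x \<bullet>\<^sub>c sg y) \<theta>"
      by (rule cmean_cong) (simp add: cvec_linear cdot_linear sg_tangent norm_x cdot_commute[of "sg _" "cvec x"])
    also have "\<dots> = sg x \<bullet>\<^sub>c vmean cvec \<theta> - cmean (\<lambda>y. cvec x \<bullet>\<^sub>c sg y) \<theta>"
    proof -
      have "cpoly (\<lambda>y. sg x \<bullet>\<^sub>c cvec y)" "cpoly (\<lambda>y. cvec x \<bullet>\<^sub>c sg y)"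
        by (intro cpoly_cdot vpoly_fields vpoly_ops)+
      then show ?thesis by (simp only: cmean_diff cmean_cdot_left[OF vpoly_fields(2)])
    qed
    also have "\<dots> = (2 * pi) *\<^sub>R (complex_of_real ((1 - (cos \<theta>)\<^sup>2) * p' (cos \<theta>)) * (- P x))"
      by (simp add: vm_cvec[OF \<theta>] cm_radial[OF \<theta>] cdot_linear sg_tangent norm_x)
    finally show "cmean (\<lambda>y. sg x \<bullet>\<^sub>c cvec (y - (x \<bullet> y) *\<^sub>R x) - sg y \<bullet>\<^sub>c cvec (x - (x \<bullet> y) *\<^sub>R y)) \<theta> = \<dots>" .
  qed
  then show ?thesis by (simp add: bspec[OF u_eq x_sphere])
qed

text \<open>The term at y is the derivative of u along x \<times> y and has mean zero; the term at x
  averages to zero because y averages to a multiple of x.\<close>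

lemma nl_surf_div_rot_grad: "nl_surf_div \<gamma> \<delta> (rot_grad u) x = 0"
proof -
  have "nl_surf_div \<gamma> \<delta> (rot_grad u) x = of_nat (l * (l + 1)) * L * 0"
    unfolding nl_surf_div_eq[of "rot_grad u" "\<lambda>y. cvec y \<times>\<^sub>c sg y", OF rot_u]
  proof (rule zonal_mult_value[OF zonal_bounded_div_integrand[OF vpoly_fields(3)]])
    fix \<theta> :: real assume \<theta>: "0 < \<theta>" "\<theta> < pi"
    let ?R = "\<lambda>y. cvec y \<times>\<^sub>c sg y"
    have "cmean (\<lambda>y. ?R x \<bullet>\<^sub>c cvec (y - (x \<bullet> y) *\<^sub>R x) - ?R y \<bullet>\<^sub>c cvec (x - (x \<bullet> y) *\<^sub>R y)) \<theta>
       = cmean (\<lambda>y. ?R x \<bullet>\<^sub>c cvec y - cvec (cross3 x y) \<bullet>\<^sub>c sg y) \<theta>"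
    proof (rule cmean_cong)
      fix y
      have "?R y \<bullet>\<^sub>c cvec x = cvec (cross3 x y) \<bullet>\<^sub>c sg y"
        unfolding cvec_cross3 by (rule ccross_dot_cyclic)
      then show "?R x \<bullet>\<^sub>c cvec (y - (x \<bullet> y) *\<^sub>R x) - ?R y \<bullet>\<^sub>c cvec (x - (x \<bullet> y) *\<^sub>R y) = ?R x \<bullet>\<^sub>c cvec y - cvec (cross3 x y) \<bullet>\<^sub>c sg y"
        by (simp add: cvec_linear cdot_linear ccross_dot_self)
    qed
    also have "\<dots> = ?R x \<bullet>\<^sub>c vmean cvec \<theta> - cmean (\<lambda>y. cvec (cross3 x y) \<bullet>\<^sub>c sg y) \<theta>"
    proof -
      have "cpoly (\<lambda>y. ?R x \<bullet>\<^sub>c cvec y)" "cpoly (\<lambda>y. cvec (cross3 x y) \<bullet>\<^sub>c sg y)"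
        by (intro cpoly_cdot vpoly_cross vpoly_fields vpoly_ops)+
      then show ?thesis by (simp only: cmean_diff cmean_cdot_left[OF vpoly_fields(2)])
    qed
    also have "\<dots> = (2 * pi) *\<^sub>R (complex_of_real ((1 - (cos \<theta>)\<^sup>2) * p' (cos \<theta>)) * 0)"
      by (simp add: vm_cvec[OF \<theta>] cdot_linear ccross_dot_self cmean_sgrad_azimuthal[OF cpoly_P])
    finally show "cmean (\<lambda>y. ?R x \<bullet>\<^sub>c cvec (y - (x \<bullet> y) *\<^sub>R x) - ?R y \<bullet>\<^sub>c cvec (x - (x \<bullet> y) *\<^sub>R y)) \<theta> = \<dots>" .
  qed
  then show ?thesis by simp
qed

lemma nl_surf_div_radial: "nl_surf_div \<gamma> \<delta> (radial u) x = 0"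
proof -
  have "(LINT y|\<Omega>. K (x \<bullet> y) *\<^sub>R ((P x *s cvec x) \<bullet>\<^sub>c cvec (y - (x \<bullet> y) *\<^sub>R x) - (P y *s cvec y) \<bullet>\<^sub>c cvec (x - (x \<bullet> y) *\<^sub>R y))) = (LINT y|\<Omega>. 0)"
  proof (rule Bochner_Integration.integral_cong[OF refl])
    fix y assume "y \<in> space \<Omega>"
    then have "norm y = 1" by (rule sphere_norm)
    then have "cvec x \<bullet>\<^sub>c cvec (y - (x \<bullet> y) *\<^sub>R x) = 0" "cvec y \<bullet>\<^sub>c cvec (x - (x \<bullet> y) *\<^sub>R y) = 0"
      using norm_x by (simp_all add: cdot_cvec inner_diff_right norm_eq_1 inner_commute[of y x])
    then show "K (x \<bullet> y) *\<^sub>R ((P x *s cvec x) \<bullet>\<^sub>c cvec (y - (x \<bullet> y) *\<^sub>R x) - (P y *s cvec y) \<bullet>\<^sub>c cvec (x - (x \<bullet> y) *\<^sub>R y)) = 0"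
      by (simp add: cdot_linear)
  qed
  then show ?thesis
    using nl_surf_div_eq[of "radial u" "\<lambda>y. P y *s cvec y", OF radial_u] by simp
qed

text \<open>The field at y contributes a derivative along the circle, the field at x is paired with
  the mean of x \<times> y; both means are zero.\<close>

lemma nl_scalar_surf_curl_surf_grad: "nl_scalar_surf_curl \<gamma> \<delta> (surf_grad u) x = 0"
proof -
  have "nl_scalar_surf_curl \<gamma> \<delta> (surf_grad u) x = of_nat (l * (l + 1)) * L * 0"
    unfolding nl_scalar_surf_curl_eq[of "surf_grad u" sg, OF grad_u]
  proof (rule zonal_mult_value[OF zonal_bounded_curl_integrand[OF vpoly_fields(1)]])
    fix \<theta> :: real assume \<theta>: "0 < \<theta>" "\<theta> < pi"
    have "cmean (\<lambda>y. - (sg y \<bullet>\<^sub>c cvec (cross3 x y)) - sg x \<bullet>\<^sub>c cvec (cross3 x y)) \<theta>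
      = cmean (\<lambda>y. (-1) * (cvec (cross3 x y) \<bullet>\<^sub>c sg y) - sg x \<bullet>\<^sub>c cvec (cross3 x y)) \<theta>"
      by (simp add: cdot_commute[of "sg _"])
    also have "\<dots> = (-1) * cmean (\<lambda>y. cvec (cross3 x y) \<bullet>\<^sub>c sg y) \<theta> - sg x \<bullet>\<^sub>c vmean (\<lambda>y. cvec (cross3 x y)) \<theta>"
    proof -
      have "cpoly (\<lambda>y. (-1) * (cvec (cross3 x y) \<bullet>\<^sub>c sg y))" "cpoly (\<lambda>y. sg x \<bullet>\<^sub>c cvec (cross3 x y))"
        by (intro cpoly_mult cpoly_const cpoly_cdot vpoly_cross vpoly_fields vpoly_ops)+
      then show ?thesis by (simp only: cmean_diff cmean_cmult cmean_cdot_left[OF vpoly_cross])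
    qed
    finally show "cmean (\<lambda>y. - (sg y \<bullet>\<^sub>c cvec (cross3 x y)) - sg x \<bullet>\<^sub>c cvec (cross3 x y)) \<theta> =
        (2 * pi) *\<^sub>R (complex_of_real ((1 - (cos \<theta>)\<^sup>2) * p' (cos \<theta>)) * 0)"
      by (simp add: cmean_sgrad_azimuthal[OF cpoly_P] vm_cross[OF \<theta>] cdot_linear)
  qed
  then show ?thesis by simp
qed

text \<open>A cyclic shift of the triple product produces y \<times> (y \<times> \<nabla>u) =
  -\<nabla>u, so that the mean is that of x \<bullet> \<nabla>u.\<close>

lemma nl_scalar_surf_curl_rot_grad: "nl_scalar_surf_curl \<gamma> \<delta> (rot_grad u) x = L * of_nat (l * (l + 1)) * u x"
proof -
  have "nl_scalar_surf_curl \<gamma> \<delta> (rot_grad u) x = of_nat (l * (l + 1)) * L * P x"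
    unfolding nl_scalar_surf_curl_eq[of "rot_grad u" "\<lambda>y. cvec y \<times>\<^sub>c sg y", OF rot_u]
  proof (rule zonal_mult_value[OF zonal_bounded_curl_integrand[OF vpoly_fields(3)]])
    fix \<theta> :: real assume \<theta>: "0 < \<theta>" "\<theta> < pi"
    let ?R = "\<lambda>y. cvec y \<times>\<^sub>c sg y"
    have "cmean (\<lambda>y. - (?R y \<bullet>\<^sub>c cvec (cross3 x y)) - ?R x \<bullet>\<^sub>c cvec (cross3 x y)) \<theta>
      = cmean (\<lambda>y. cvec x \<bullet>\<^sub>c sg y - ?R x \<bullet>\<^sub>c cvec (cross3 x y)) \<theta>"
    proof (rule cmean_cong)
      fix y :: "real^3" assume y: "norm y = 1"
      have "?R y \<bullet>\<^sub>c cvec (cross3 x y) = cvec x \<bullet>\<^sub>c (cvec y \<times>\<^sub>c ?R y)"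
        unfolding cvec_cross3 by (rule cdot_ccross_cyclic)
      also have "cvec y \<times>\<^sub>c ?R y = - sg y"
        by (rule ccross_double_tangent[OF cdot_unit[OF y] sg_tangent(1)[OF y]])
      finally show "- (?R y \<bullet>\<^sub>c cvec (cross3 x y)) - ?R x \<bullet>\<^sub>c cvec (cross3 x y) = cvec x \<bullet>\<^sub>c sg y - ?R x \<bullet>\<^sub>c cvec (cross3 x y)"
        by (simp add: cdot_linear)
    qed
    also have "\<dots> = cmean (\<lambda>y. cvec x \<bullet>\<^sub>c sg y) \<theta> - ?R x \<bullet>\<^sub>c vmean (\<lambda>y. cvec (cross3 x y)) \<theta>"
    proof -
      have "cpoly (\<lambda>y. cvec x \<bullet>\<^sub>c sg y)" "cpoly (\<lambda>y. ?R x \<bullet>\<^sub>c cvec (cross3 x y))"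
        by (intro cpoly_cdot vpoly_cross vpoly_fields vpoly_ops)+
      then show ?thesis by (simp only: cmean_diff cmean_cdot_left[OF vpoly_cross])
    qed
    finally show "cmean (\<lambda>y. - (?R y \<bullet>\<^sub>c cvec (cross3 x y)) - ?R x \<bullet>\<^sub>c cvec (cross3 x y)) \<theta> =
        (2 * pi) *\<^sub>R (complex_of_real ((1 - (cos \<theta>)\<^sup>2) * p' (cos \<theta>)) * P x)"
      by (simp add: vm_cross[OF \<theta>] cm_radial[OF \<theta>] cdot_linear)
  qed
  then show ?thesis by (simp add: bspec[OF u_eq x_sphere])
qed

lemma nl_scalar_surf_curl_radial: "nl_scalar_surf_curl \<gamma> \<delta> (radial u) x = 0"
proof -
  have "(cvec y \<bullet>\<^sub>c cvec (cross3 x y)) = 0" "(cvec x \<bullet>\<^sub>c cvec (cross3 x y)) = 0" for y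
    by (simp_all add: cdot_cvec dot_cross_self)
  then show ?thesis
    unfolding nl_scalar_surf_curl_eq[of "radial u" "\<lambda>y. P y *s cvec y", OF radial_u] by (simp add: cdot_linear)
qed

end

section \<open>Surface gradient and vector surface curl\<close>

lemma zonal_bounded_smult:
  assumes "\<And>k. zonal_bounded x \<rho> (\<lambda>y. F y $ k)" "continuous_on S2 g"
  shows "zonal_bounded x \<rho> (\<lambda>y. (g y *s F y) $ k)"
  using zonal_bounded_mult[OF assms(1) assms(2)] by (simp add: mult.commute)

lemma P_continuous: "continuous_on S2 P"
  by (rule cpoly_continuous_on[OF cpoly_P])

text \<open>The four products have known means. Their radial parts cancel in pairs, which leaves the
  tangential part of the moment of u.\<close>

lemma grad_mean:
  assumes \<theta>: "0 < \<theta>" "\<theta> < pi"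
  shows "vmean (\<lambda>y. (P y - P x) *s cvec (y - (x \<bullet> y) *\<^sub>R x)) \<theta> = (2 * pi * q (cos \<theta>)) *\<^sub>R sg x"
proof -
  have "cmean (\<lambda>y. ((P y - P x) *s cvec (y - (x \<bullet> y) *\<^sub>R x)) $ k) \<theta> = (2 * pi * q (cos \<theta>)) *\<^sub>R sg x $ k" for k
  proof -
    have 1: "cmean P \<theta> = complex_of_real (2 * pi * p (cos \<theta>)) * P x"
      by (rule cmean_harmonic[OF P]) (use \<theta> in auto)
    have 2: "cmean (\<lambda>y. complex_of_real (y $ k) * P y) \<theta> = complex_of_real (2 * pi) * (complex_of_real (cos \<theta> * p (cos \<theta>) * x $ k) * P x
        + complex_of_real (q (cos \<theta>)) * sg x $ k)"
      by (rule cmean_moment[OF P partial_deriv_zero_at]) (use \<theta> in auto)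
    have 3: "cmean (\<lambda>y. complex_of_real (y $ k)) \<theta> = complex_of_real (2 * pi * cos \<theta> * x $ k)"
      using arg_cong[OF vm_cvec[OF \<theta>], of "\<lambda>v. v $ k"] by (simp add: vmean_def cvec_nth scaleR_conv_of_real[where 'a = complex])
    have 4: "cmean (\<lambda>_. c) \<theta> = complex_of_real (2 * pi) * c" for c
      by (simp add: cmean_def scaleR_conv_of_real)
    let ?t = "complex_of_real (cos \<theta> * x $ k)"
    have "cmean (\<lambda>y. ((P y - P x) *s cvec (y - (x \<bullet> y) *\<^sub>R x)) $ k) \<theta>
      = cmean (\<lambda>y. (complex_of_real (y $ k) * P y - ?t * P y) - (P x * complex_of_real (y $ k) - P x * ?t)) \<theta>"
      by (rule cmean_cong) (simp add: cvec_nth algebra_simps)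
    also have "\<dots> = (cmean (\<lambda>y. complex_of_real (y $ k) * P y) \<theta> - ?t * cmean P \<theta>)
       - (P x * cmean (\<lambda>y. complex_of_real (y $ k)) \<theta> - cmean (\<lambda>_. P x * ?t) \<theta>)"
    proof -
      have "cpoly (\<lambda>y. complex_of_real (y $ k) * P y)" "cpoly (\<lambda>y. ?t * P y)" "cpoly (\<lambda>y. P x * complex_of_real (y $ k))" "cpoly (\<lambda>_. P x * ?t)"
        by (intro cpoly_intros cpoly_P)+
      then show ?thesis by (simp only: cmean_diff cmean_cmult cpoly_diff)
    qed
    also have "\<dots> = (2 * pi * q (cos \<theta>)) *\<^sub>R sg x $ k"
      unfolding 1 2 3 4 by (simp add: scaleR_conv_of_real[where 'a = complex] algebra_simps)
    finally show ?thesis .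
  qed
  then show ?thesis by (simp add: vmean_def vec_eq_iff)
qed

text \<open>The constant c contributes nothing, as x \<times> y averages to zero. It will be - P x
  for differences of values and P x for sums.\<close>

lemma cross_mean:
  assumes \<theta>: "0 < \<theta>" "\<theta> < pi"
  shows "vmean (\<lambda>y. (P y + c) *s cvec (cross3 x y)) \<theta> = (2 * pi * q (cos \<theta>)) *\<^sub>R (cvec x \<times>\<^sub>c sg x)"
proof -
  have "vmean (\<lambda>y. (P y + c) *s cvec (cross3 x y)) \<theta> = vmean (\<lambda>y. P y *s cvec (cross3 x y)) \<theta> + vmean (\<lambda>y. c *s cvec (cross3 x y)) \<theta>"
  proof -
    have "vpoly (\<lambda>y. c *s cvec (cross3 x y))"
      using vpoly_cross by (simp add: vpoly_def cpoly_intros)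
    then show ?thesis by (simp add: vector_sadd_rdistrib vmean_add vpoly_fields)
  qed
  also have "vmean (\<lambda>y. c *s cvec (cross3 x y)) \<theta> = c *s vmean (\<lambda>y. cvec (cross3 x y)) \<theta>"
    by (simp add: vmean_def vec_eq_iff cmean_cmult)
  finally show ?thesis by (simp add: vm_cross[OF \<theta>] vm_cross_P[OF \<theta>])
qed

lemma cross_integral:
  "(LINT y|\<Omega>. K (x \<bullet> y) *\<^sub>R ((P y + c) *s cvec (cross3 x y))) = L *s (cvec x \<times>\<^sub>c sg x)"
proof (rule zonal_mult_value_vec)
  show "zonal_bounded x \<rho>\<^sub>1 (\<lambda>y. ((P y + c) *s cvec (cross3 x y)) $ k)" for k
    by (intro zonal_bounded_smult zonal_bounded_cross continuous_intros P_continuous)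
  show "vmean (\<lambda>y. (P y + c) *s cvec (cross3 x y)) \<theta> = (2 * pi * q (cos \<theta>)) *\<^sub>R (cvec x \<times>\<^sub>c sg x)" if "0 < \<theta>" "\<theta> < pi" for \<theta>
    by (rule cross_mean[OF that])
  show "cvec x \<times>\<^sub>c sg x = 0" if "l = 0" using sgrad_zero[OF that] by (simp add: ccross_linear)
qed

context
  fixes u :: "real^3 \<Rightarrow> complex"
  assumes u: "\<forall>y\<in>S2. u y = P y"
begin

lemmas fields = bspec[OF grad_u[OF u] x_sphere] bspec[OF rot_u[OF u] x_sphere] bspec[OF radial_u[OF u] x_sphere]

lemma nl_surf_grad_harmonic: "nl_surf_grad \<gamma> \<delta> u x = L *s surf_grad u x"
  unfolding nl_surf_grad_eq[OF u_eq[OF u]] fields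
proof (rule zonal_mult_value_vec)
  show "zonal_bounded x \<rho>\<^sub>1 (\<lambda>y. ((P y - P x) *s cvec (y - (x \<bullet> y) *\<^sub>R x)) $ k)" for k
    by (intro zonal_bounded_smult zonal_bounded_projection continuous_intros P_continuous)
  show "vmean (\<lambda>y. (P y - P x) *s cvec (y - (x \<bullet> y) *\<^sub>R x)) \<theta> = (2 * pi * q (cos \<theta>)) *\<^sub>R sg x" if "0 < \<theta>" "\<theta> < pi" for \<theta>
    by (rule grad_mean[OF that])
qed (rule sgrad_zero)

lemma nl_vector_surf_curl_harmonic: "nl_vector_surf_curl \<gamma> \<delta> u x = L *s rot_grad u x"
  using cross_integral[of "- P x"] by (simp only: nl_vector_surf_curl_eq[OF u_eq[OF u]] fields diff_conv_add_uminus)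

section \<open>The nonlocal curl and its adjoint\<close>

lemma chord_cross_radial:
  "cvec (y - x) \<times>\<^sub>c (P y *s cvec y - P x *s cvec x) = - ((P y + (- P x)) *s cvec (cross3 x y))"
  "cvec (y - x) \<times>\<^sub>c (P x *s cvec x + P y *s cvec y) = - ((P y + P x) *s cvec (cross3 x y))"
  by (simp_all add: vec_eq_iff forall_3 ccross_nth cvec_nth cross3_nth algebra_simps)

text \<open>For a radial field the cross product with the chord reduces to a multiple of x \<times>
  y, since x \<times> x and y \<times> y vanish. This factor is 0 at both poles and is covered by
  the weight \<open>\<rho>\<^sub>1\<close>.\<close>

lemma nl_curl_radial: "nl_curl \<gamma> \<delta> (radial u) x = - L *s rot_grad u x"
  unfolding nl_curl_eq[OF radial_u[OF u]] chord_cross_radial fields scaleR_minus_right integral_minus cross_integral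
  by (simp add: vec_eq_iff)

lemma nl_curl_adj_radial: "nl_curl_adj \<gamma> \<delta> (radial u) x = - L *s rot_grad u x"
  unfolding nl_curl_adj_eq[OF radial_u[OF u]] chord_cross_radial fields scaleR_minus_right integral_minus cross_integral
  by (simp add: vec_eq_iff)

text \<open>The sign \<open>\<sigma>\<close> distinguishes the curl (\<open>\<sigma> = -1\<close>) from its adjoint (\<open>\<sigma> = 1\<close>).\<close>

lemma chord_mean:
  assumes \<theta>: "0 < \<theta>" "\<theta> < pi" and F: "vpoly F"
  shows "vmean (\<lambda>y. cvec (y - x) \<times>\<^sub>c (\<sigma> *s F x + F y)) \<theta> =
    vmean (\<lambda>y. cvec y \<times>\<^sub>c F y) \<theta> - cvec x \<times>\<^sub>c vmean F \<theta> - (2 * pi * (1 - cos \<theta>)) *\<^sub>R (\<sigma> *s (cvec x \<times>\<^sub>c F x))"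
proof -
  have v: "vpoly (\<lambda>y. cvec y \<times>\<^sub>c F y)" "vpoly (\<lambda>y. cvec x \<times>\<^sub>c F y)" "vpoly (\<lambda>y. (\<sigma> *s F x) \<times>\<^sub>c cvec y)" "vpoly (\<lambda>y. (\<sigma> *s F x) \<times>\<^sub>c cvec x)"
    by (intro vpoly_ccross vpoly_ops F)+
  have "cvec (y - x) \<times>\<^sub>c (\<sigma> *s F x + F y) = (cvec y \<times>\<^sub>c F y - cvec x \<times>\<^sub>c F y) - ((\<sigma> *s F x) \<times>\<^sub>c cvec y - (\<sigma> *s F x) \<times>\<^sub>c cvec x)" for y
    by (simp add: vec_eq_iff forall_3 ccross_nth cvec_nth algebra_simps)
  then have "vmean (\<lambda>y. cvec (y - x) \<times>\<^sub>c (\<sigma> *s F x + F y)) \<theta>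
     = (vmean (\<lambda>y. cvec y \<times>\<^sub>c F y) \<theta> - vmean (\<lambda>y. cvec x \<times>\<^sub>c F y) \<theta>) - (vmean (\<lambda>y. (\<sigma> *s F x) \<times>\<^sub>c cvec y) \<theta> - vmean (\<lambda>y. (\<sigma> *s F x) \<times>\<^sub>c cvec x) \<theta>)"
    by (simp only: vmean_diff v vpoly_ops)
  then show ?thesis
    unfolding vmean_ccross_left[OF F] vmean_ccross_left[OF vpoly_ops(4)] vm_cvec[OF \<theta>] vmean_const
    by (simp add: vec_eq_iff forall_3 ccross_nth cvec_nth scaleR_conv_of_real[where 'a = complex] algebra_simps)
qed

lemma zonal_bounded_chord_cross:
  assumes "vpoly F"
  shows "zonal_bounded x \<rho>\<^sub>2 (\<lambda>y. (cvec (y - x) \<times>\<^sub>c (c + F y)) $ k)"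
  using vpoly_continuous[OF assms] by (intro zonal_bounded_ccross zonal_bounded_chord) (simp add: continuous_on_add)

text \<open>The means of y \<times> \<nabla>u and x \<times> \<nabla>u combine to (1 - t) P_l -
  \<open>q\<close>, which integrates to \<Theta> of degree l minus \<Lambda>. The field at x is
  constant in y, so its factor 1 - t yields \<Theta> of degree 0.\<close>

lemma chord_grad_integral:
  assumes chord_integrable
  shows "(LINT y|\<Omega>. K (x \<bullet> y) *\<^sub>R (cvec (y - x) \<times>\<^sub>c (\<sigma> *s sg x + sg y))) =
    (- \<sigma> * \<Theta> \<gamma> \<delta> 0 + \<Theta> \<gamma> \<delta> l - L) *s (cvec x \<times>\<^sub>c sg x)"
proof -
  let ?R = "cvec x \<times>\<^sub>c sg x"
  have "(LINT y|\<Omega>. K (x \<bullet> y) *\<^sub>R (cvec (y - x) \<times>\<^sub>c (\<sigma> *s sg x + sg y))) =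
    (of_nat (l * (l + 1)) * L) *s 0 + L *s (- ?R) + \<Theta> \<gamma> \<delta> l *s ?R + \<Theta> \<gamma> \<delta> 0 *s (- \<sigma> *s ?R)"
  proof (rule zonal_value_vec[OF zonal_bounded_chord_cross[OF vpoly_fields(1)]])
    show "- ?R = 0" if "l = 0" using sgrad_zero[OF that] by (simp add: ccross_linear)
    show "\<rho>\<^sub>2 = \<rho>\<^sub>1 \<and> ?R = 0 \<and> - \<sigma> *s ?R = 0 \<or> \<rho>\<^sub>2 = \<rho>\<^sub>2 \<and> chord_integrable" using assms by simp
    fix \<theta> :: real assume \<theta>: "0 < \<theta>" "\<theta> < pi"
    have "cvec x \<times>\<^sub>c vmean sg \<theta> = (2 * pi * (cos \<theta> * p (cos \<theta>) + q (cos \<theta>))) *\<^sub>R ?R"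
      using vm_cross_sg[OF \<theta>] unfolding vmean_ccross_left[OF vpoly_fields(1)] .
    then show "vmean (\<lambda>y. cvec (y - x) \<times>\<^sub>c (\<sigma> *s sg x + sg y)) \<theta> = (2 * pi) *\<^sub>R
      (complex_of_real ((1 - (cos \<theta>)\<^sup>2) * p' (cos \<theta>)) *s 0 + complex_of_real (q (cos \<theta>)) *s (- ?R)
      + complex_of_real ((1 - cos \<theta>) * p (cos \<theta>)) *s ?R + complex_of_real (1 - cos \<theta>) *s (- \<sigma> *s ?R))"
      unfolding chord_mean[OF \<theta> vpoly_fields(1)] vm_rot[OF \<theta>]
      by (simp only:) (simp add: vec_eq_iff scaleR_conv_of_real[where 'a = complex] algebra_simps)
  qed
  then show ?thesis by (simp add: vec_eq_iff algebra_simps)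
qed

text \<open>Since y \<times> (y \<times> \<nabla>u) = -\<nabla>u, the mean of the whole gradient
  enters, and its radial part is the source of the term with l(l+1). The same formula at x reverses
  the sign of \<Theta> of degree 0 compared with the gradient field.\<close>

lemma chord_rot_integral:
  assumes chord_integrable
  shows "(LINT y|\<Omega>. K (x \<bullet> y) *\<^sub>R (cvec (y - x) \<times>\<^sub>c (\<sigma> *s (cvec x \<times>\<^sub>c sg x) + cvec y \<times>\<^sub>c sg y))) =
    (- of_nat (l * (l + 1)) * L) *s (P x *s cvec x) + (\<sigma> * \<Theta> \<gamma> \<delta> 0 + \<Theta> \<gamma> \<delta> l - L) *s sg x"
proof -
  let ?F = "\<lambda>y. cvec y \<times>\<^sub>c sg y"
  have xR: "cvec x \<times>\<^sub>c ?F x = - sg x"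
    by (rule ccross_double_tangent[OF cdot_unit[OF norm_x] sg_tangent(1)[OF norm_x]])
  have "(LINT y|\<Omega>. K (x \<bullet> y) *\<^sub>R (cvec (y - x) \<times>\<^sub>c (\<sigma> *s ?F x + ?F y))) =
    (of_nat (l * (l + 1)) * L) *s (- (P x *s cvec x)) + L *s (- sg x) + \<Theta> \<gamma> \<delta> l *s sg x + \<Theta> \<gamma> \<delta> 0 *s (\<sigma> *s sg x)"
  proof (rule zonal_value_vec[OF zonal_bounded_chord_cross[OF vpoly_fields(3)]])
    show "- sg x = 0" if "l = 0" using sgrad_zero[OF that] by simp
    show "\<rho>\<^sub>2 = \<rho>\<^sub>1 \<and> sg x = 0 \<and> \<sigma> *s sg x = 0 \<or> \<rho>\<^sub>2 = \<rho>\<^sub>2 \<and> chord_integrable" using assms by simp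
    fix \<theta> :: real assume \<theta>: "0 < \<theta>" "\<theta> < pi"
    have "vmean (\<lambda>y. cvec y \<times>\<^sub>c ?F y) \<theta> = vmean (\<lambda>y. 0 - sg y) \<theta>"
      by (rule vmean_cong) (simp add: ccross_double_tangent cdot_unit sg_tangent)
    also have "\<dots> = - vmean sg \<theta>"
      using vmean_diff[OF vpoly_ops(3) vpoly_fields(1), of 0 \<theta>] by (simp add: vmean_const)
    finally have 1: "vmean (\<lambda>y. cvec y \<times>\<^sub>c ?F y) \<theta> = - vmean sg \<theta>" .
    have 2: "cvec x \<times>\<^sub>c vmean ?F \<theta> = - ((2 * pi * p (cos \<theta>)) *\<^sub>R sg x)"
    proof -
      have "a \<times>\<^sub>c (r *\<^sub>R v) = r *\<^sub>R (a \<times>\<^sub>c v)" for a v r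
        by (simp add: vec_eq_iff forall_3 ccross_nth algebra_simps)
      then show ?thesis unfolding vm_rot[OF \<theta>] by (simp add: xR)
    qed
    show "vmean (\<lambda>y. cvec (y - x) \<times>\<^sub>c (\<sigma> *s ?F x + ?F y)) \<theta> = (2 * pi) *\<^sub>R
      (complex_of_real ((1 - (cos \<theta>)\<^sup>2) * p' (cos \<theta>)) *s (- (P x *s cvec x)) + complex_of_real (q (cos \<theta>)) *s (- sg x)
      + complex_of_real ((1 - cos \<theta>) * p (cos \<theta>)) *s sg x + complex_of_real (1 - cos \<theta>) *s (\<sigma> *s sg x))"
      unfolding chord_mean[OF \<theta> vpoly_fields(3)] 1 2 xR vm_sg[OF \<theta>]
      by (simp add: vec_eq_iff scaleR_conv_of_real[where 'a = complex] algebra_simps)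
  qed
  then show ?thesis by (simp add: vec_eq_iff algebra_simps)
qed

lemma nl_curl_surf_grad:
  assumes chord_integrable
  shows "nl_curl \<gamma> \<delta> (surf_grad u) x = (\<Theta> \<gamma> \<delta> 0 + \<Theta> \<gamma> \<delta> l - L) *s rot_grad u x"
    and "nl_curl_adj \<gamma> \<delta> (surf_grad u) x = (- \<Theta> \<gamma> \<delta> 0 + \<Theta> \<gamma> \<delta> l - L) *s rot_grad u x"
  using chord_grad_integral[OF assms, of "-1"] chord_grad_integral[OF assms, of 1]
  unfolding nl_curl_eq[OF grad_u[OF u]] nl_curl_adj_eq[OF grad_u[OF u]] fields by simp_all

lemma nl_curl_rot_grad:
  assumes chord_integrable
  shows "nl_curl \<gamma> \<delta> (rot_grad u) x = - of_nat (l * (l + 1)) * L *s radial u x + (- \<Theta> \<gamma> \<delta> 0 + \<Theta> \<gamma> \<delta> l - L) *s surf_grad u x"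
    and "nl_curl_adj \<gamma> \<delta> (rot_grad u) x = - of_nat (l * (l + 1)) * L *s radial u x + (\<Theta> \<gamma> \<delta> 0 + \<Theta> \<gamma> \<delta> l - L) *s surf_grad u x"
  using chord_rot_integral[OF assms, of "-1"] chord_rot_integral[OF assms, of 1]
  unfolding nl_curl_eq[OF rot_u[OF u]] nl_curl_adj_eq[OF rot_u[OF u]] fields by simp_all

end

end

theorem theorem3p2:
  fixes \<gamma> :: "real \<Rightarrow> real" and \<delta> :: real
    and Y :: "nat \<Rightarrow> int \<Rightarrow> real^3 \<Rightarrow> complex"
    and l :: nat and m :: int and x :: "real^3"
  assumes "0 < \<delta>" "\<delta> \<le> 2"
    and "\<forall>t\<in>{-1<..<1}. \<gamma> differentiable (at t)"
    and "set_integrable lborel {-1<..<1} (truncated \<gamma> \<delta>)"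
    and "weak_derivative_on {-1<..<1} (truncated \<gamma> \<delta>) (deriv (truncated \<gamma> \<delta>))"
    and "set_integrable lborel {-1<..<1} (\<lambda>t. sqrt (1 - t\<^sup>2) * deriv (truncated \<gamma> \<delta>) t)"
    and "orthonormal_harmonics Y"
    and "- int l \<le> m" "m \<le> int l"
    and "x \<in> S2"
  shows
    "nl_surf_div \<gamma> \<delta> (surf_grad (Y l m)) x = - \<Lambda> \<gamma> \<delta> l * of_nat (l * (l + 1)) * Y l m x \<and>
     nl_surf_div \<gamma> \<delta> (rot_grad (Y l m)) x = 0 \<and>
     nl_surf_div \<gamma> \<delta> (radial (Y l m)) x = 0 \<and>
     nl_scalar_surf_curl \<gamma> \<delta> (surf_grad (Y l m)) x = 0 \<and>
     nl_scalar_surf_curl \<gamma> \<delta> (rot_grad (Y l m)) x = \<Lambda> \<gamma> \<delta> l * of_nat (l * (l + 1)) * Y l m x \<and>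
     nl_scalar_surf_curl \<gamma> \<delta> (radial (Y l m)) x = 0 \<and>
     nl_surf_grad \<gamma> \<delta> (Y l m) x = \<Lambda> \<gamma> \<delta> l *s surf_grad (Y l m) x \<and>
     nl_vector_surf_curl \<gamma> \<delta> (Y l m) x = \<Lambda> \<gamma> \<delta> l *s rot_grad (Y l m) x \<and>
     nl_curl \<gamma> \<delta> (radial (Y l m)) x = - \<Lambda> \<gamma> \<delta> l *s rot_grad (Y l m) x \<and>
     nl_curl_adj \<gamma> \<delta> (radial (Y l m)) x = - \<Lambda> \<gamma> \<delta> l *s rot_grad (Y l m) x \<and>
     ((\<delta> = 2 \<longrightarrow> set_integrable lborel {-1<..<1} (\<lambda>t. (1 - t) * deriv (truncated \<gamma> \<delta>) t)) \<longrightarrow>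
        nl_curl \<gamma> \<delta> (surf_grad (Y l m)) x =
          (\<Theta> \<gamma> \<delta> 0 + \<Theta> \<gamma> \<delta> l - \<Lambda> \<gamma> \<delta> l) *s rot_grad (Y l m) x \<and>
        nl_curl \<gamma> \<delta> (rot_grad (Y l m)) x =
          - of_nat (l * (l + 1)) * \<Lambda> \<gamma> \<delta> l *s radial (Y l m) x +
          (- \<Theta> \<gamma> \<delta> 0 + \<Theta> \<gamma> \<delta> l - \<Lambda> \<gamma> \<delta> l) *s surf_grad (Y l m) x \<and>
        nl_curl_adj \<gamma> \<delta> (surf_grad (Y l m)) x =
          (- \<Theta> \<gamma> \<delta> 0 + \<Theta> \<gamma> \<delta> l - \<Lambda> \<gamma> \<delta> l) *s rot_grad (Y l m) x \<and>
        nl_curl_adj \<gamma> \<delta> (rot_grad (Y l m)) x =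
          - of_nat (l * (l + 1)) * \<Lambda> \<gamma> \<delta> l *s radial (Y l m) x +
          (\<Theta> \<gamma> \<delta> 0 + \<Theta> \<gamma> \<delta> l - \<Lambda> \<gamma> \<delta> l) *s surf_grad (Y l m) x)"
proof -
  have "spherical_harmonic l (Y l m)"
    using assms(7-9) by (auto simp: orthonormal_harmonics_def)
  then obtain P where hom: "homogeneous_poly l P" and harm: "harmonic P" and u: "\<forall>y\<in>S2. Y l m y = P y"
    unfolding spherical_harmonic_def by blast
  \<comment> \<open>The identities are pointwise in x, so x itself is taken as the pole of the
    coordinates.\<close>
  obtain a b where fr: "frame x a b" and \<mu>: "sph_measure x a b = standard_frame_measure"
    by (rule polar_frame_ex[OF assms(10)])
  interpret frame x a b by (rule fr)
  interpret nonlocal_setting x a b \<gamma> \<delta> l P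
  proof
    show "solid_harmonic l P" by (rule homogeneous_poly_solid[OF hom harm])
    show "partial_deriv i P = (\<lambda>_. 0)" if "l = 0" for i
      using hom that homogeneous_poly_0 by blast
  qed (use assms(1,2,4,5,6) \<mu> in auto)
  show ?thesis
    using nl_surf_div_surf_grad[OF u] nl_surf_div_rot_grad[OF u] nl_surf_div_radial[OF u] nl_scalar_surf_curl_surf_grad[OF u] nl_scalar_surf_curl_rot_grad[OF u] nl_scalar_surf_curl_radial[OF u]
      nl_surf_grad_harmonic[OF u] nl_vector_surf_curl_harmonic[OF u] nl_curl_radial[OF u] nl_curl_adj_radial[OF u]
      nl_curl_surf_grad[OF u chord_integrableI] nl_curl_rot_grad[OF u chord_integrableI]
    by blast
qed

end
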